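(* Let $f_\chi(t):=\sup_{\varphi\in\mathcal F}\xi(\varphi,t)$ and $f_\omega(t):=\xi(\mathbf 1_{B(0;1/2)},t)$ for $t\in(0,\infty)$. 1. If $\delta=1$ then $f_\chi(t)=f_\omega(t)$ for all $t\in(0,\infty)$. 2. If $\delta<1$ then there exists a constant $0<t_0<\infty$ such that $f_\chi(t)=f_\omega(t)$ for all $t\le t_0$, and the ratio $f_\chi(t)/f_\omega(t)$ is continuous and strictly increasing for $t\ge t_0$.
   Context: $d\ge1$ fixed, $\|\cdot\|$ a fixed norm on $\mathbb R^d$, $B=\{x:\|x\|<1\}$, $B(x;\rho)=\{y:\|x-y\|<\rho\}$, $\mathrm{vol}$ Lebesgue measure. Packing density: for $K>0$ let $N(K)$ be the maximum number of pairwise disjoint translates of $B$ with centres in $(0,K)^d$, and $\delta:=\lim_{K\to\infty}N(K)\mathrm{vol}(B)/K^d$. Weighted integral: $H(x)=x\ln x-x+1$. For nonnegative bounded measurable $\varphi$ with $0<\int\varphi<\infty$ and $0<t<\infty$, $s=s(\varphi,t)$ is the unique $s\ge0$ with $\int H(e^{s\varphi(x)})dx=1/t$, and $\xi(\varphi,t):=\int\varphi e^{s\varphi}$; $\xi(\varphi,\infty):=\int\varphi$; $\xi(\varphi,t)=0$ if $\int\varphi=0$. A set $S$ is well-spread if $\|v-w\|>1$ for distinct $v,w\in S$; a nonnegative measurable $\varphi$ is feasible if $\sum_{v\in S}\varphi(v)\le1$ for every well-spread $S$; $\mathcal F$ is the set of feasible functions. *)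

theory Defs
  imports "HOL-Analysis.Analysis"
begin

definition is_norm :: "(real^'n \<Rightarrow> real) \<Rightarrow> bool" where
  "is_norm N \<longleftrightarrow> (\<forall>x. N x = 0 \<longleftrightarrow> x = 0) \<and> (\<forall>x y. N (x + y) \<le> N x + N y)
      \<and> (\<forall>c x. N (c *\<^sub>R x) = \<bar>c\<bar> * N x)"

definition nball :: "(real^'n \<Rightarrow> real) \<Rightarrow> real^'n \<Rightarrow> real \<Rightarrow> (real^'n) set" where
  "nball N x \<rho> = {y. N (x - y) < \<rho>}"

definition unit_ball :: "(real^'n \<Rightarrow> real) \<Rightarrow> (real^'n) set" where
  "unit_ball N = {x. N x < 1}"

definition pack_count :: "(real^'n \<Rightarrow> real) \<Rightarrow> real \<Rightarrow> nat" where
  "pack_count N K = Sup {card C | C. finite C \<and> C \<subseteq> {x. \<forall>i. 0 < x$i \<and> x$i < K} \<and>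
      (\<forall>v\<in>C. \<forall>w\<in>C. v \<noteq> w \<longrightarrow> ((\<lambda>y. v + y) ` unit_ball N) \<inter> ((\<lambda>y. w + y) ` unit_ball N) = {})}"

definition packing_density :: "(real^'n \<Rightarrow> real) \<Rightarrow> real" where
  "packing_density N = Lim at_top
     (\<lambda>K::real. real (pack_count N K) * measure lebesgue (unit_ball N) / K ^ CARD('n))"

definition H :: "real \<Rightarrow> real" where
  "H x = x * ln x - x + 1"

definition s_param :: "(real^'n \<Rightarrow> real) \<Rightarrow> real \<Rightarrow> real" where
  "s_param \<phi> t = (THE s. s \<ge> 0 \<and> (LINT x|lebesgue. H (exp (s * \<phi> x))) = 1 / t)"

definition xi :: "(real^'n \<Rightarrow> real) \<Rightarrow> real \<Rightarrow> real" where
  "xi \<phi> t = (if (LINT x|lebesgue. \<phi> x) = 0 then 0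
     else LINT x|lebesgue. \<phi> x * exp (s_param \<phi> t * \<phi> x))"

definition well_spread :: "(real^'n \<Rightarrow> real) \<Rightarrow> (real^'n) set \<Rightarrow> bool" where
  "well_spread N S \<longleftrightarrow> (\<forall>v\<in>S. \<forall>w\<in>S. v \<noteq> w \<longrightarrow> N (v - w) > 1)"

definition feasible :: "(real^'n \<Rightarrow> real) \<Rightarrow> (real^'n \<Rightarrow> real) set" where
  "feasible N = {\<phi>. (\<forall>x. \<phi> x \<ge> 0) \<and> \<phi> \<in> borel_measurable lebesgue \<and>
      (\<forall>S. well_spread N S \<longrightarrow> (\<Sum>\<^sub>\<infinity>v\<in>S. ennreal (\<phi> v)) \<le> 1)}"

definition f_chi :: "(real^'n \<Rightarrow> real) \<Rightarrow> real \<Rightarrow> real" where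
  "f_chi N t = (SUP \<phi>\<in>feasible N. xi \<phi> t)"

definition f_omega :: "(real^'n \<Rightarrow> real) \<Rightarrow> real \<Rightarrow> real" where
  "f_omega N t = xi (indicator (nball N 0 (1/2))) t"

end

theory Submission
  imports Defs
begin

text \<open>
  Write $\tau = 1/t$ and $E(\varphi, s) = \int (e^{s\varphi} - 1)$. Legendre duality between $H$ and
  $e^u - 1$ gives $\xi(\varphi, t) = \min_{s > 0} (\tau + E(\varphi, s)) / s$, so it is enough to compare
  $E(\varphi, s)$ with $v (e^s - 1)$, the value for the indicator function of the ball of radius $1/2$
  and volume $v$.

  Averaging over periodic packings, and testing with normalised indicator functions of cubes, show that
  the packing density exists and equals $v / M$ with $M = \sup_\varphi \int \varphi$. If it is $1$, then
  $M = v$, and the chord bound $e^{s\varphi} - 1 \le (e^s - 1) \varphi$ finishes the proof.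

  For small $t$ the minimising $s$ is large. Points of the level sets $\{\varphi > u\}$ and
  $\{\varphi > 1 - u\}$ are at distance at most $1$, so Brunn--Minkowski forces the surplus of the second
  volume over $v$ to be at most a constant times the deficit of the first one. In the layer cake formula for
  $E(\varphi, s)$ the deficit carries the exponentially larger weight.

  For the monotonicity, $\frac{d}{d\tau} \ln \xi(\varphi, t) = 1 / (s \xi)$, and since
  $H(e^u) / (u e^u)$ increases with $u$, any $\varphi$ whose $\xi$ beats that of the ball has a larger
  $s \xi$. This holds uniformly in $\varphi$ on compact intervals, hence survives the supremum.
\<close>

section \<open>The Brunn--Minkowski inequality\<close>

text \<open>For small t the obstacle is a \<phi> whose supremum p is below 1: the level sets above p
  are empty, so Brunn-Minkowski says nothing about the levels below 1 - p, where the mass may be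
  spread over a large region. Feasibility itself controls that part: a point y with \<phi>(y) close
  to p leaves at most 1 - \<phi>(y) to a well-spread set outside its unit ball, so the low levels
  carry only O(1 - p), and the gap between e^s and e^(s p) pays for this. Brunn-Minkowski is stated
  for any measurable W that contains the sums. This avoids measurability of sum sets and lets a
  slightly larger ball absorb the discretisation error. The supremum that defines
  \<open>f_chi\<close> may fail to be attained, so strict monotonicity requires a growth rate common
  to all \<phi>. It is obtained where the logarithm of the ratio exceeds a fixed positive number;
  the single threshold follows because the set where the ratio is 1 is then an interval.\<close>

text \<open>Half-open boxes are closed under cuts by coordinate hyperplanes and tile space exactly, so no
  null sets have to be discarded.\<close>

definition hbox :: "real^'n \<Rightarrow> real^'n \<Rightarrow> (real^'n) set" where
  "hbox a b = {x. \<forall>i. a $ i \<le> x $ i \<and> x $ i < b $ i}"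

lemma hbox_eq_empty_iff: "hbox a b = {} \<longleftrightarrow> (\<exists>i. b $ i \<le> a $ i)"
proof
  assume "hbox a b = {}"
  hence "a \<notin> hbox a b" by simp
  thus "\<exists>i. b $ i \<le> a $ i" by (auto simp: hbox_def not_less)
next
  assume "\<exists>i. b $ i \<le> a $ i"
  then obtain i where "b $ i \<le> a $ i" by blast
  thus "hbox a b = {}" unfolding hbox_def using le_less_trans not_less by blast
qed

lemma hbox_approx: "negligible (cbox a b - hbox a b)" "hbox a b \<subseteq> cbox a b"
proof -
  show "hbox a b \<subseteq> cbox a b" by (auto simp: hbox_def mem_box_cart less_imp_le)
  have "box a b \<subseteq> hbox a b" by (auto simp: hbox_def mem_box_cart less_imp_le)
  thus "negligible (cbox a b - hbox a b)"
    by (intro negligible_subset[OF negligible_frontier_interval[of a b]]) auto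
qed

lemma hbox_eq_cbox_diff: "hbox a b = cbox a b - (cbox a b - hbox a b)"
  using hbox_approx(2) by blast

lemma lmeasurable_hbox [simp]: "hbox a b \<in> lmeasurable"
  by (subst hbox_eq_cbox_diff, rule fmeasurable.Diff)
     (auto intro: negligible_imp_measurable hbox_approx)

lemma sets_hbox [simp]: "hbox a b \<in> sets lebesgue"
  by (rule fmeasurableD) simp

lemma measure_hbox:
  assumes "\<And>i. a $ i \<le> b $ i"
  shows "measure lebesgue (hbox a b) = (\<Prod>i\<in>UNIV. b $ i - a $ i)"
proof -
  have "measure lebesgue (hbox a b) = measure lebesgue (cbox a b)"
    by (rule measure_negligible_symdiff[symmetric])
       (use hbox_approx[of a b] in \<open>auto simp: Un_absorb1 Diff_eq_empty_iff\<close>)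
  also have "\<dots> = (\<Prod>i\<in>UNIV. b $ i - a $ i)"
    using assms by (simp add: content_cbox_cart interval_ne_empty_cart)
  finally show ?thesis .
qed

lemma measure_hbox_pos:
  assumes "hbox a b \<noteq> {}" shows "measure lebesgue (hbox a b) > 0"
proof -
  have "a $ i < b $ i" for i using assms by (auto simp: hbox_eq_empty_iff not_le)
  thus ?thesis by (subst measure_hbox) (auto intro: less_imp_le prod_pos)
qed

lemma hbox_cut:
  "hbox a b \<inter> {x. x $ i < h} = hbox a (\<chi> j. if j = i then min (b $ i) h else b $ j)"
  "hbox a b \<inter> {x. h \<le> x $ i} = hbox (\<chi> j. if j = i then max (a $ i) h else a $ j) b"
proof -
  have "x \<in> hbox a b \<inter> {x. x $ i < h} \<longleftrightarrow> x \<in> hbox a (\<chi> j. if j = i then min (b $ i) h else b $ j)" for x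
    unfolding hbox_def by (simp, metis)
  thus "hbox a b \<inter> {x. x $ i < h} = hbox a (\<chi> j. if j = i then min (b $ i) h else b $ j)" by blast
  have "x \<in> hbox a b \<inter> {x. h \<le> x $ i} \<longleftrightarrow> x \<in> hbox (\<chi> j. if j = i then max (a $ i) h else a $ j) b" for x
    unfolding hbox_def by (simp, metis)
  thus "hbox a b \<inter> {x. h \<le> x $ i} = hbox (\<chi> j. if j = i then max (a $ i) h else a $ j) b" by blast
qed

lemma hbox_separated:
  assumes "hbox a b \<noteq> {}" "hbox c d \<noteq> {}" "hbox a b \<inter> hbox c d = {}"
  shows "\<exists>i. b $ i \<le> c $ i \<or> d $ i \<le> a $ i"
proof (rule ccontr)
  assume "\<nexists>i. b $ i \<le> c $ i \<or> d $ i \<le> a $ i"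
  hence *: "c $ i < b $ i" "a $ i < d $ i" for i by (auto simp: not_le)
  have **: "a $ i < b $ i" "c $ i < d $ i" for i
    using assms(1,2) by (auto simp: hbox_eq_empty_iff not_le)
  have "(\<chi> i. max (a $ i) (c $ i)) \<in> hbox a b \<inter> hbox c d"
    using * ** by (auto simp: hbox_def)
  thus False using assms(3) by blast
qed

section \<open>Finite disjoint families of half-open boxes, cut by coordinate hyperplanes\<close>

definition box_family :: "(real^'n) set set \<Rightarrow> bool" where
  "box_family P \<longleftrightarrow> finite P \<and> disjoint P \<and> (\<forall>R\<in>P. R \<noteq> {} \<and> (\<exists>a b. R = hbox a b))"

definition cut_family :: "(real^'n) set set \<Rightarrow> (real^'n) set \<Rightarrow> (real^'n) set set" where
  "cut_family P S = (\<lambda>R. R \<inter> S) ` P - {{}}"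

lemma Union_cut_family: "\<Union>(cut_family P S) = \<Union>P \<inter> S"
  by (auto simp: cut_family_def)

lemma card_cut_family: "finite P \<Longrightarrow> card (cut_family P S) \<le> card P"
  unfolding cut_family_def by (meson card_Diff1_le card_image_le finite_imageI le_trans)

lemma card_cut_family_less:
  assumes "finite P" "R \<in> P" "R \<inter> S = {}" shows "card (cut_family P S) < card P"
proof -
  have "cut_family P S \<subseteq> (\<lambda>R. R \<inter> S) ` (P - {R})" using assms by (auto simp: cut_family_def)
  hence "card (cut_family P S) \<le> card (P - {R})"
    using assms by (meson card_image_le card_mono finite_Diff finite_imageI le_trans)
  also have "\<dots> < card P" using assms by (intro card_Diff1_less)
  finally show ?thesis .
qed

lemma box_family_cut:
  assumes "box_family P" "S = {x. x $ i < h} \<or> S = {x. h \<le> x $ i}"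
  shows "box_family (cut_family P S)"
proof -
  have "disjoint ((\<lambda>R. R \<inter> S) ` P)"
    using assms(1) unfolding box_family_def disjoint_def by blast
  hence "disjoint (cut_family P S)" unfolding cut_family_def by (rule pairwise_subset) auto
  moreover have "\<exists>a b. R = hbox a b" if RP: "R \<in> cut_family P S" for R
  proof -
    obtain T where "T \<in> P" and R: "R = T \<inter> S" using RP by (auto simp: cut_family_def)
    then obtain a b where T: "T = hbox a b" using assms(1) unfolding box_family_def by meson
    show ?thesis using assms(2) hbox_cut(1)[of a b i h] hbox_cut(2)[of a b h i] unfolding R T by blast
  qed
  ultimately show ?thesis using assms(1) by (auto simp: box_family_def cut_family_def)
qed

lemma lmeasurable_box_family: "box_family P \<Longrightarrow> \<Union>P \<in> lmeasurable"
  unfolding box_family_def by (intro fmeasurable.finite_Union) auto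

lemma measure_box_family_pos:
  assumes "box_family P" "\<Union>P \<noteq> {}" shows "measure lebesgue (\<Union>P) > 0"
proof -
  obtain R where R: "R \<in> P" using assms(2) by blast
  hence "measure lebesgue R > 0" using assms(1) measure_hbox_pos unfolding box_family_def by metis
  moreover have "R \<in> lmeasurable" using R assms(1) unfolding box_family_def by fastforce
  moreover have "measure lebesgue R \<le> measure lebesgue (\<Union>P)"
    using R calculation(2) assms(1) by (intro measure_mono_fmeasurable lmeasurable_box_family) auto
  ultimately show ?thesis by linarith
qed

lemma sets_halfspaces [measurable, simp]:
  "{x::real^'n. x $ i < h} \<in> sets lebesgue" "{x::real^'n. h \<le> x $ i} \<in> sets lebesgue"
  using open_halfspace_component_lt_cart[of i h] closed_halfspace_component_ge_cart[of h i]
  by (auto simp: borel_open borel_closed)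

lemma measure_split:
  fixes A :: "(real^'n) set"
  assumes "A \<in> lmeasurable"
  shows "measure lebesgue A = measure lebesgue (A \<inter> {x. x $ i < h}) + measure lebesgue (A \<inter> {x. h \<le> x $ i})"
proof -
  have "A = (A \<inter> {x. x $ i < h}) \<union> (A \<inter> {x. h \<le> x $ i})" by auto
  moreover have "measure lebesgue \<dots> = measure lebesgue (A \<inter> {x. x $ i < h}) + measure lebesgue (A \<inter> {x. h \<le> x $ i})"
    using assms by (intro measure_Un_AE) (auto intro: fmeasurable_Int_fmeasurable)
  ultimately show ?thesis by simp
qed

lemma box_family_bounded: "box_family P \<Longrightarrow> bounded (\<Union>P)"
  unfolding box_family_def by (auto intro!: bounded_Union intro: bounded_subset[OF bounded_cbox hbox_approx(2)])

text \<open>The volume below height h is Lipschitz in h, since a slab of a bounded set lies in a box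
  whose volume is proportional to its thickness. The intermediate value theorem does the
  rest.\<close>

lemma measure_cut_ivt:
  fixes A :: "(real^'n) set"
  assumes "bounded A" "A \<in> lmeasurable" "0 < c" "c < measure lebesgue A"
  shows "\<exists>h. measure lebesgue (A \<inter> {x. x $ i < h}) = c"
proof -
  obtain r where r: "r > 0" "\<And>x. x \<in> A \<Longrightarrow> norm x \<le> r" using assms(1) by (auto simp: bounded_pos)
  have bd: "\<bar>x $ j\<bar> \<le> r" if "x \<in> A" for x j
    using r(2)[OF that] component_le_norm_cart[of x j] by linarith
  let ?f = "\<lambda>h. measure lebesgue (A \<inter> {x. x $ i < h})"
  \<comment> \<open>The side \<open>2 * r + 1\<close> instead of \<open>2 * r\<close> leaves room
    for points with a coordinate equal to \<open>r\<close>, which a half-open box ending at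
    \<open>r\<close> would miss.\<close>
  define K where "K = (\<Prod>j\<in>UNIV - {i}. 2 * r + 1)"
  have K0: "K \<ge> 0" using r unfolding K_def by (intro prod_nonneg) auto
  have lip: "\<bar>?f h2 - ?f h1\<bar> \<le> K * \<bar>h2 - h1\<bar>" if "h1 \<le> h2" for h1 h2
  proof -
    let ?a = "(\<chi> j. if j = i then h1 else -r) :: real^'n"
    let ?b = "(\<chi> j. if j = i then h2 else r + 1) :: real^'n"
    have m: "A \<inter> {x. x $ i < h2} \<in> lmeasurable" using assms by (intro fmeasurable_Int_fmeasurable) auto
    have "?f h2 = measure lebesgue (A \<inter> {x. x $ i < h2} \<inter> {x. x $ i < h1}) + measure lebesgue (A \<inter> {x. x $ i < h2} \<inter> {x. h1 \<le> x $ i})"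
      by (rule measure_split[OF m])
    also have "A \<inter> {x. x $ i < h2} \<inter> {x. x $ i < h1} = A \<inter> {x. x $ i < h1}" using that by auto
    finally have 1: "?f h2 - ?f h1 = measure lebesgue (A \<inter> {x. x $ i < h2} \<inter> {x. h1 \<le> x $ i})" by simp
    have "\<dots> \<le> measure lebesgue (hbox ?a ?b)"
    proof (intro measure_mono_fmeasurable)
      show "A \<inter> {x. x $ i < h2} \<inter> {x. h1 \<le> x $ i} \<subseteq> hbox ?a ?b"
      proof
        fix x assume x: "x \<in> A \<inter> {x. x $ i < h2} \<inter> {x. h1 \<le> x $ i}"
        hence "\<bar>x $ j\<bar> \<le> r" for j using bd by blast
        hence "- r \<le> x $ j \<and> x $ j < r + 1" for j by (smt (verit))
        thus "x \<in> hbox ?a ?b" using x by (auto simp: hbox_def)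
      qed
      show "A \<inter> {x. x $ i < h2} \<inter> {x. h1 \<le> x $ i} \<in> sets lebesgue"
        using assms(2) by (auto simp: fmeasurable_def)
    qed auto
    also have "\<dots> = (\<Prod>j\<in>UNIV. ?b $ j - ?a $ j)" using r that by (intro measure_hbox) auto
    also have "\<dots> = (h2 - h1) * (\<Prod>j\<in>UNIV-{i}. ?b $ j - ?a $ j)"
      by (subst prod.remove[of _ i]) auto
    also have "(\<Prod>j\<in>UNIV-{i}. ?b $ j - ?a $ j) = K" unfolding K_def by (intro prod.cong) auto
    finally show ?thesis using 1 that by (simp add: mult.commute)
  qed
  have "K-lipschitz_on UNIV ?f"
  proof (rule lipschitz_onI)
    fix x y :: real
    show "dist (?f x) (?f y) \<le> K * dist x y"
      using lip[of x y] lip[of y x] by (cases "x \<le> y") (auto simp: dist_real_def abs_minus_commute)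
  qed (rule K0)
  hence cont: "continuous_on UNIV ?f" by (rule lipschitz_on_continuous_on)
  have bd': "- r \<le> x $ j \<and> x $ j < r + 1" if "x \<in> A" for x j using bd[OF that, of j] by linarith
  have e: "A \<inter> {x. x $ i < -r} = {}" "A \<inter> {x. x $ i < r + 1} = A"
    using bd' by (auto simp: not_less[symmetric])
  have "?f (-r) \<le> c" "c \<le> ?f (r+1)" using assms unfolding e by auto
  hence "\<exists>h\<ge>-r. h \<le> r + 1 \<and> ?f h = c"
    using r by (intro IVT' continuous_on_subset[OF cont]) auto
  thus ?thesis by blast
qed

text \<open>Brunn-Minkowski for boxes with side lengths \<open>a\<close> and \<open>b\<close>. The
  arithmetic-geometric mean inequality is applied to the ratios a/(a+b) and to b/(a+b); the two
  arithmetic means add up to 1.\<close>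

lemma prod_root_add:
  fixes a b :: "'n::finite \<Rightarrow> real"
  assumes "\<And>i. a i > 0" "\<And>i. b i > 0"
  shows "(root CARD('n) (\<Prod>i\<in>UNIV. a i) + root CARD('n) (\<Prod>i\<in>UNIV. b i)) ^ CARD('n) \<le> (\<Prod>i\<in>UNIV. a i + b i)"
proof -
  let ?d = "CARD('n)"
  have mean: "root ?d (\<Prod>i\<in>UNIV. x i / (x i + y i)) \<le> (\<Sum>i\<in>UNIV. x i / (x i + y i)) / ?d"
    if "\<And>i. x i > 0" "\<And>i. y i > 0" for x y :: "'n \<Rightarrow> real"
  proof -
    have pos: "x i / (x i + y i) > 0" for i using that[of i] by simp
    hence "(\<Prod>i\<in>UNIV. x i / (x i + y i)) powr (1 / ?d) \<le> (\<Sum>i\<in>UNIV. x i / (x i + y i) / ?d)"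
      by (intro arith_geom_mean) (auto intro: less_imp_le)
    moreover have "(\<Prod>i\<in>UNIV. x i / (x i + y i)) > 0" using pos by (intro prod_pos) auto
    ultimately show ?thesis
      by (simp add: root_powr_inverse sum_divide_distrib)
  qed
  let ?C = "\<Prod>i\<in>UNIV. a i + b i"
  have C: "?C > 0" using assms by (intro prod_pos) (auto intro: add_pos_pos)
  have d: "?d > 0" by simp
  have 1: "root ?d (\<Prod>i\<in>UNIV. a i) / root ?d ?C \<le> (\<Sum>i\<in>UNIV. a i / (a i + b i)) / ?d"
    using mean[of a b] assms d by (simp add: prod_dividef real_root_divide)
  have 2: "root ?d (\<Prod>i\<in>UNIV. b i) / root ?d ?C \<le> (\<Sum>i\<in>UNIV. b i / (a i + b i)) / ?d"
    using mean[of b a] assms d by (simp add: prod_dividef real_root_divide add.commute)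
  have "(\<Sum>i\<in>UNIV. a i / (a i + b i)) + (\<Sum>i\<in>UNIV. b i / (a i + b i)) = (\<Sum>i\<in>(UNIV::'n set). 1)"
    unfolding sum.distrib[symmetric]
  proof (rule sum.cong)
    fix x show "a x / (a x + b x) + b x / (a x + b x) = 1"
      using assms[of x] by (simp add: add_divide_distrib[symmetric])
  qed simp
  hence "(\<Sum>i\<in>UNIV. a i / (a i + b i)) / ?d + (\<Sum>i\<in>UNIV. b i / (a i + b i)) / ?d = 1"
    by (simp add: add_divide_distrib[symmetric])
  hence "(root ?d (\<Prod>i\<in>UNIV. a i) + root ?d (\<Prod>i\<in>UNIV. b i)) / root ?d ?C \<le> 1"
    using 1 2 by (simp add: add_divide_distrib)
  hence "root ?d (\<Prod>i\<in>UNIV. a i) + root ?d (\<Prod>i\<in>UNIV. b i) \<le> root ?d ?C"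
    using C d by (simp add: divide_le_eq real_root_gt_zero)
  hence "(root ?d (\<Prod>i\<in>UNIV. a i) + root ?d (\<Prod>i\<in>UNIV. b i)) ^ ?d \<le> root ?d ?C ^ ?d"
    using assms by (intro power_mono add_nonneg_nonneg real_root_ge_zero prod_nonneg) (auto intro: less_imp_le)
  thus ?thesis using C d by (simp add: real_root_pow_pos)
qed


text \<open>The sum of two boxes is the box with added corners: a point of the latter is split into
  two points that have the same relative position \<open>l i\<close> in each coordinate of their
  boxes.\<close>

lemma brunn_minkowski_hbox:
  fixes a b c e :: "real^'n"
  assumes "hbox a b \<noteq> {}" "hbox c e \<noteq> {}" "W \<in> lmeasurable"
    and sub: "\<And>x y. x \<in> hbox a b \<Longrightarrow> y \<in> hbox c e \<Longrightarrow> x + y \<in> W"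
  shows "(root CARD('n) (measure lebesgue (hbox a b)) + root CARD('n) (measure lebesgue (hbox c e))) ^ CARD('n)
           \<le> measure lebesgue W"
proof -
  have ab: "a $ i < b $ i" and ce: "c $ i < e $ i" for i
    using assms(1,2) by (auto simp: hbox_eq_empty_iff not_le)
  have "hbox (a + c) (b + e) \<subseteq> W"
  proof
    fix z assume "z \<in> hbox (a + c) (b + e)"
    hence z: "a $ i + c $ i \<le> z $ i" "z $ i < b $ i + e $ i" for i by (auto simp: hbox_def)
    define l where "l i = (z $ i - (a $ i + c $ i)) / (b $ i + e $ i - (a $ i + c $ i))" for i
    have l: "0 \<le> l i" "l i < 1" for i
      using z[of i] ab[of i] ce[of i] by (auto simp: l_def)
    define x where "x = (\<chi> i. a $ i + l i * (b $ i - a $ i))"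
    define y where "y = (\<chi> i. c $ i + l i * (e $ i - c $ i))"
    have bd: "p \<le> p + l i * (q - p) \<and> p + l i * (q - p) < q" if "p < q" for p q i
    proof -
      have "l i * (q - p) < q - p" using mult_strict_right_mono[of "l i" 1 "q - p"] l[of i] that by simp
      moreover have "0 \<le> l i * (q - p)" using l[of i] that by simp
      ultimately show ?thesis by (intro conjI) linarith+
    qed
    have "x \<in> hbox a b" "y \<in> hbox c e"
      unfolding hbox_def x_def y_def using bd ab ce by auto
    moreover have "x + y = z"
    proof -
      have "(a $ i + l i * (b $ i - a $ i)) + (c $ i + l i * (e $ i - c $ i)) = z $ i" for i
      proof -
        have "l i * (b $ i + e $ i - (a $ i + c $ i)) = z $ i - (a $ i + c $ i)"
          using ab[of i] ce[of i] by (simp add: l_def)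
        thus ?thesis by (simp add: algebra_simps)
      qed
      thus ?thesis by (simp add: vec_eq_iff x_def y_def)
    qed
    ultimately show "z \<in> W" using sub by blast
  qed
  hence "measure lebesgue (hbox (a + c) (b + e)) \<le> measure lebesgue W"
    using assms(3) by (intro measure_mono_fmeasurable) auto
  moreover have "measure lebesgue (hbox (a + c) (b + e)) = (\<Prod>i\<in>UNIV. (b $ i - a $ i) + (e $ i - c $ i))"
    using ab ce by (subst measure_hbox) (simp_all add: add_mono less_imp_le algebra_simps)
  ultimately show ?thesis
    using prod_root_add[of "\<lambda>i. b $ i - a $ i" "\<lambda>i. e $ i - c $ i"] ab ce
    by (simp add: measure_hbox less_imp_le)
qed

text \<open>The Hadwiger--Ohmann step: a coordinate hyperplane separates two boxes of $P$, a parallel one cuts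
  $Q$ in the same ratio, and the sums of corresponding halves lie on different sides of a third one.\<close>

lemma brunn_minkowski_cut:
  fixes P Q :: "(real^'n) set set"
  assumes P: "box_family P" and Q: "box_family Q" and card: "card P \<ge> 2" and "Q \<noteq> {}" and W: "W \<in> lmeasurable"
    and sub: "\<And>x y. x \<in> \<Union>P \<Longrightarrow> y \<in> \<Union>Q \<Longrightarrow> x + y \<in> W"
    and IH: "\<And>(P' :: (real^'n) set set) Q' W'. \<lbrakk>box_family P'; box_family Q'; P' \<noteq> {}; Q' \<noteq> {}; W' \<in> lmeasurable; card P' + card Q' < card P + card Q;
        \<And>x y. x \<in> \<Union>P' \<Longrightarrow> y \<in> \<Union>Q' \<Longrightarrow> x + y \<in> W'\<rbrakk> \<Longrightarrow>
        (root CARD('n) (measure lebesgue (\<Union>P')) + root CARD('n) (measure lebesgue (\<Union>Q'))) ^ CARD('n) \<le> measure lebesgue W'"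
  shows "(root CARD('n) (measure lebesgue (\<Union>P)) + root CARD('n) (measure lebesgue (\<Union>Q))) ^ CARD('n)
           \<le> measure lebesgue W"
proof -
  let ?d = "CARD('n)" and ?\<mu> = "measure lebesgue"
  obtain R1 R2 where R: "R1 \<in> P" "R2 \<in> P" "R1 \<noteq> R2"
    using card by (metis card_le_Suc0_iff_eq P box_family_def not_less_eq_eq numeral_2_eq_2)
  obtain a b c e where R12: "R1 = hbox a b" "R2 = hbox c e" using R P unfolding box_family_def by meson
  have "R1 \<noteq> {}" "R2 \<noteq> {}" "R1 \<inter> R2 = {}"
    using R P by (auto simp: box_family_def disjoint_def)
  then obtain i where i: "b $ i \<le> c $ i \<or> e $ i \<le> a $ i" using hbox_separated R12 by metis
  \<comment> \<open>One box on each side of the cut: either half of \<open>P\<close> loses a box,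
    while cutting \<open>Q\<close> never increases its cardinality. This makes the induction measure
    drop.\<close>
  have "\<exists>S1\<in>P. \<exists>S2\<in>P. \<exists>h. S1 \<subseteq> {x. x $ i < h} \<and> S2 \<subseteq> {x. h \<le> x $ i}"
  proof (cases "b $ i \<le> c $ i")
    case True
    hence "R1 \<subseteq> {x. x $ i < c $ i}" "R2 \<subseteq> {x. c $ i \<le> x $ i}"
      unfolding R12 hbox_def using order.strict_trans2 by blast+
    thus ?thesis using R by blast
  next
    case False
    hence "R2 \<subseteq> {x. x $ i < a $ i}" "R1 \<subseteq> {x. a $ i \<le> x $ i}"
      using i unfolding R12 hbox_def using order.strict_trans2 by blast+
    thus ?thesis using R by blast
  qed
  then obtain S1 S2 h where S: "S1 \<in> P" "S2 \<in> P" "S1 \<subseteq> {x. x $ i < h}" "S2 \<subseteq> {x. h \<le> x $ i}" by blast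
  have Sne: "S1 \<noteq> {}" "S2 \<noteq> {}" using S P by (auto simp: box_family_def)
  define lo where "lo h = {x::real^'n. x $ i < h}" for h
  define up where "up h = {x::real^'n. h \<le> x $ i}" for h
  have fin: "finite P" "finite Q" using P Q by (auto simp: box_family_def)
  have hf: "box_family (cut_family X (lo t))" "box_family (cut_family X (up t))" if "box_family X" for X t
    using box_family_cut[OF that] unfolding lo_def up_def by blast+
  have cl: "card (cut_family P (lo h)) < card P"
    using S by (intro card_cut_family_less[of _ S2]) (use fin in \<open>auto simp: lo_def\<close>)
  have cu: "card (cut_family P (up h)) < card P"
    using S by (intro card_cut_family_less[of _ S1]) (use fin in \<open>auto simp: up_def\<close>)
  have ne: "\<Union>(cut_family P (lo h)) \<noteq> {}" "\<Union>(cut_family P (up h)) \<noteq> {}"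
  proof -
    obtain x1 x2 where "x1 \<in> S1" "x2 \<in> S2" using Sne by blast
    hence "x1 \<in> \<Union>P \<inter> lo h" "x2 \<in> \<Union>P \<inter> up h" using S by (auto simp: lo_def up_def)
    thus "\<Union>(cut_family P (lo h)) \<noteq> {}" "\<Union>(cut_family P (up h)) \<noteq> {}" unfolding Union_cut_family by auto
  qed
  let ?A = "?\<mu> (\<Union>P)" and ?B = "?\<mu> (\<Union>Q)"
  have A1: "?\<mu> (\<Union>P \<inter> lo h) > 0" and A2: "?\<mu> (\<Union>P \<inter> up h) > 0"
    using measure_box_family_pos[OF hf(1)[OF P] ne(1)] measure_box_family_pos[OF hf(2)[OF P] ne(2)]
    by (simp_all add: Union_cut_family)
  have split: "?\<mu> (\<Union>X) = ?\<mu> (\<Union>X \<inter> lo t) + ?\<mu> (\<Union>X \<inter> up t)" if "box_family X" for X t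
    unfolding lo_def up_def by (rule measure_split[OF lmeasurable_box_family[OF that]])
  have "\<Union>Q \<noteq> {}" using Q \<open>Q \<noteq> {}\<close> by (auto simp: box_family_def)
  hence B: "?B > 0" using Q by (rule measure_box_family_pos[rotated])
  have A: "?A > 0" using A1 A2 split[OF P, of h] by linarith
  define \<alpha> where "\<alpha> = ?\<mu> (\<Union>P \<inter> lo h) / ?A"
  have \<alpha>: "0 < \<alpha>" "\<alpha> < 1" using A A1 A2 split[OF P, of h] by (auto simp: \<alpha>_def)
  have PA: "?\<mu> (\<Union>P \<inter> lo h) = \<alpha> * ?A" using A by (simp add: \<alpha>_def)
  hence PA': "?\<mu> (\<Union>P \<inter> up h) = (1 - \<alpha>) * ?A" using split[OF P, of h] by (simp add: algebra_simps)
  have "0 < \<alpha> * ?B" "\<alpha> * ?B < ?B" using \<alpha> B by auto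
  then obtain k where QB: "?\<mu> (\<Union>Q \<inter> lo k) = \<alpha> * ?B"
    using measure_cut_ivt[OF box_family_bounded[OF Q] lmeasurable_box_family[OF Q], of "\<alpha> * ?B" i] unfolding lo_def by blast
  hence QB': "?\<mu> (\<Union>Q \<inter> up k) = (1 - \<alpha>) * ?B" using split[OF Q, of k] by (simp add: algebra_simps)
  have neQ: "cut_family Q (lo k) \<noteq> {}" "cut_family Q (up k) \<noteq> {}"
  proof -
    have "\<Union>(cut_family Q (lo k)) \<noteq> {}" unfolding Union_cut_family using QB \<alpha> B by (metis less_irrefl measure_empty mult_pos_pos)
    moreover have "\<Union>(cut_family Q (up k)) \<noteq> {}" unfolding Union_cut_family using QB' \<alpha> B
      by (metis diff_gt_0_iff_gt less_irrefl measure_empty mult_pos_pos)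
    ultimately show "cut_family Q (lo k) \<noteq> {}" "cut_family Q (up k) \<noteq> {}" by auto
  qed
  \<comment> \<open>The bound is homogeneous of degree one in the pair of volumes. As both families
    are cut in the ratio \<alpha> to 1 - \<alpha>, the bounds for the two halves add up to the bound
    for the whole.\<close>
  have sc: "(root ?d (t * ?A) + root ?d (t * ?B)) ^ ?d = t * (root ?d ?A + root ?d ?B) ^ ?d" if "t > 0" for t
    using that by (simp add: real_root_mult distrib_left[symmetric] power_mult_distrib real_root_pow_pos)
  have W1: "W \<inter> lo (h + k) \<in> lmeasurable" and W2: "W \<inter> up (h + k) \<in> lmeasurable"
    using W unfolding lo_def up_def by (auto intro: fmeasurable_Int_fmeasurable)
  have "(root ?d (?\<mu> (\<Union>(cut_family P (lo h)))) + root ?d (?\<mu> (\<Union>(cut_family Q (lo k))))) ^ ?d \<le> ?\<mu> (W \<inter> lo (h + k))"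
  proof (rule IH)
    show "card (cut_family P (lo h)) + card (cut_family Q (lo k)) < card P + card Q"
      using cl card_cut_family[OF fin(2), of "lo k"] by linarith
    show "x + y \<in> W \<inter> lo (h + k)" if "x \<in> \<Union>(cut_family P (lo h))" "y \<in> \<Union>(cut_family Q (lo k))" for x y
      using that sub[of x y] unfolding Union_cut_family by (auto simp: lo_def)
  qed (use hf P Q neQ W1 ne in auto)
  hence 1: "\<alpha> * (root ?d ?A + root ?d ?B) ^ ?d \<le> ?\<mu> (W \<inter> lo (h + k))"
    using sc[OF \<alpha>(1)] by (simp add: Union_cut_family PA QB)
  have "(root ?d (?\<mu> (\<Union>(cut_family P (up h)))) + root ?d (?\<mu> (\<Union>(cut_family Q (up k))))) ^ ?d \<le> ?\<mu> (W \<inter> up (h + k))"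
  proof (rule IH)
    show "card (cut_family P (up h)) + card (cut_family Q (up k)) < card P + card Q"
      using cu card_cut_family[OF fin(2), of "up k"] by linarith
    show "x + y \<in> W \<inter> up (h + k)" if "x \<in> \<Union>(cut_family P (up h))" "y \<in> \<Union>(cut_family Q (up k))" for x y
      using that sub[of x y] unfolding Union_cut_family by (auto simp: up_def)
  qed (use hf P Q neQ W2 ne in auto)
  hence 2: "(1 - \<alpha>) * (root ?d ?A + root ?d ?B) ^ ?d \<le> ?\<mu> (W \<inter> up (h + k))"
    using sc[of "1 - \<alpha>"] \<alpha> by (simp add: Union_cut_family PA' QB')
  have "?\<mu> W = ?\<mu> (W \<inter> lo (h + k)) + ?\<mu> (W \<inter> up (h + k))"
    unfolding lo_def up_def by (rule measure_split[OF W])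
  thus ?thesis using 1 2 by (simp add: algebra_simps)
qed

text \<open>Induction on the total number of boxes; whichever family has at least two boxes is the
  one separated by a hyperplane, and two single boxes are the base case.\<close>

lemma brunn_minkowski_box_family:
  fixes P Q :: "(real^'n) set set"
  assumes "box_family P" "box_family Q" "P \<noteq> {}" "Q \<noteq> {}" "W \<in> lmeasurable"
    and "\<And>x y. x \<in> \<Union>P \<Longrightarrow> y \<in> \<Union>Q \<Longrightarrow> x + y \<in> W"
  shows "(root CARD('n) (measure lebesgue (\<Union>P)) + root CARD('n) (measure lebesgue (\<Union>Q))) ^ CARD('n)
           \<le> measure lebesgue W"
  using assms
proof (induction "card P + card Q" arbitrary: P Q W rule: less_induct)
  case less
  note IH = less.hyps
  have fin: "finite P" "finite Q" using less.prems by (auto simp: box_family_def)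
  have pos: "card P > 0" "card Q > 0" using fin less.prems by (auto simp: card_gt_0_iff)
  consider "card P \<ge> 2" | "card Q \<ge> 2" | "card P = 1" "card Q = 1" using pos by linarith
  thus ?case
  proof cases
    case 1
    show ?thesis
      by (rule brunn_minkowski_cut[OF less.prems(1,2) 1 less.prems(4,5,6)]) (assumption | rule IH | blast)+
  next
    case 2
    have "(root CARD('n) (measure lebesgue (\<Union>Q)) + root CARD('n) (measure lebesgue (\<Union>P))) ^ CARD('n) \<le> measure lebesgue W"
    proof (rule brunn_minkowski_cut[OF less.prems(2,1) 2 less.prems(3,5)])
      show "x + y \<in> W" if "x \<in> \<Union>Q" "y \<in> \<Union>P" for x y
        using less.prems(6)[OF that(2,1)] by (simp add: add.commute)
      fix P' Q' :: "(real^'n) set set" and W' :: "(real^'n) set"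
      assume h: "box_family P'" "box_family Q'" "P' \<noteq> {}" "Q' \<noteq> {}" "W' \<in> lmeasurable" "card P' + card Q' < card Q + card P"
        "\<And>x y. x \<in> \<Union>P' \<Longrightarrow> y \<in> \<Union>Q' \<Longrightarrow> x + y \<in> W'"
      show "(root CARD('n) (measure lebesgue (\<Union>P')) + root CARD('n) (measure lebesgue (\<Union>Q'))) ^ CARD('n) \<le> measure lebesgue W'"
        by (rule IH) (use h in \<open>auto simp: add.commute\<close>)
    qed
    thus ?thesis by (simp add: add.commute)
  next
    case 3
    then obtain R S where RS: "P = {R}" "Q = {S}" by (auto simp: card_1_singleton_iff)
    then obtain a b c e where "R = hbox a b" "S = hbox c e" "R \<noteq> {}" "S \<noteq> {}"
      using less.prems(1,2) unfolding box_family_def by (metis insertI1)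
    thus ?thesis using brunn_minkowski_hbox[of a b c e W] less.prems RS by simp
  qed
qed


section \<open>Grid approximation, from box families to bounded measurable sets\<close>

definition grid_cell :: "real \<Rightarrow> int^'n \<Rightarrow> (real^'n) set" where
  "grid_cell \<epsilon> z = hbox (\<chi> i. \<epsilon> * of_int (z $ i)) (\<chi> i. \<epsilon> * (of_int (z $ i) + 1))"

lemma mem_grid_cell:
  assumes "\<epsilon> > 0" shows "x \<in> grid_cell \<epsilon> z \<longleftrightarrow> z = (\<chi> i. \<lfloor>x $ i / \<epsilon>\<rfloor>)"
proof -
  have "\<epsilon> * of_int k \<le> y \<and> y < \<epsilon> * (of_int k + 1) \<longleftrightarrow> \<lfloor>y / \<epsilon>\<rfloor> = k" for k and y :: real
    using assms by (simp add: floor_eq_iff pos_le_divide_eq pos_divide_less_eq mult.commute)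
  thus ?thesis by (auto simp: grid_cell_def hbox_def vec_eq_iff)
qed

lemma grid_cell_disjoint: "\<epsilon> > 0 \<Longrightarrow> z \<noteq> w \<Longrightarrow> grid_cell \<epsilon> z \<inter> grid_cell \<epsilon> w = {}"
  by (auto simp: mem_grid_cell)

lemma finite_int_box: "finite {z::int^'n. \<forall>i. \<bar>z $ i\<bar> \<le> m}"
proof (rule finite_subset)
  show "{z::int^'n. \<forall>i. \<bar>z $ i\<bar> \<le> m} \<subseteq> vec_lambda ` (UNIV \<rightarrow>\<^sub>E {-m..m})"
  proof
    fix z :: "int^'n" assume "z \<in> {z. \<forall>i. \<bar>z $ i\<bar> \<le> m}"
    hence "z $ i \<in> {-m..m}" for i by (auto simp: abs_le_iff minus_le_iff)
    hence "($) z \<in> UNIV \<rightarrow>\<^sub>E {-m..m}" by auto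
    thus "z \<in> vec_lambda ` (UNIV \<rightarrow>\<^sub>E {-m..m})" by (metis image_eqI vec_nth_inverse)
  qed
qed (intro finite_imageI finite_PiE, auto)

text \<open>Only cells that meet \<open>A\<close> are taken, so each point of the cover shares a
  cell of side \<epsilon> with a point of \<open>A\<close>.\<close>

lemma grid_cover:
  fixes A :: "(real^'n) set"
  assumes "bounded A" "A \<noteq> {}" "\<epsilon> > 0"
  shows "\<exists>P. box_family P \<and> P \<noteq> {} \<and> A \<subseteq> \<Union>P \<and> (\<forall>x\<in>\<Union>P. \<exists>y\<in>A. \<forall>i. \<bar>x $ i - y $ i\<bar> \<le> \<epsilon>)"
proof -
  define Z where "Z = (\<lambda>x::real^'n. (\<chi> i. \<lfloor>x $ i / \<epsilon>\<rfloor>) :: int^'n) ` A"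
  define P where "P = grid_cell \<epsilon> ` Z"
  obtain r where r: "r > 0" "\<And>x. x \<in> A \<Longrightarrow> norm x \<le> r" using assms(1) by (auto simp: bounded_pos)
  have "\<bar>\<lfloor>x $ i / \<epsilon>\<rfloor>\<bar> \<le> \<lceil>r / \<epsilon>\<rceil> + 1" if "x \<in> A" for x i
  proof -
    have "\<bar>x $ i\<bar> \<le> r" using component_le_norm_cart[of x i] r(2)[OF that] by linarith
    hence "\<bar>x $ i\<bar> / \<epsilon> \<le> r / \<epsilon>" using assms(3) by (intro divide_right_mono) auto
    hence "\<bar>x $ i / \<epsilon>\<bar> \<le> r / \<epsilon>" using assms(3) by simp
    thus ?thesis by linarith
  qed
  hence "Z \<subseteq> {z. \<forall>i. \<bar>z $ i\<bar> \<le> \<lceil>r / \<epsilon>\<rceil> + 1}" unfolding Z_def by auto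
  hence "finite Z" by (rule finite_subset) (rule finite_int_box)
  moreover have "disjoint P" unfolding P_def disjoint_def
    using grid_cell_disjoint[OF assms(3)] by (metis (no_types, lifting) imageE)
  moreover have "R \<noteq> {} \<and> (\<exists>a b. R = hbox a b)" if "R \<in> P" for R
  proof -
    obtain x :: "real^'n" where "R = grid_cell \<epsilon> (\<chi> i. \<lfloor>x $ i / \<epsilon>\<rfloor>)" using \<open>R \<in> P\<close> unfolding P_def Z_def by blast
    moreover have "x \<in> grid_cell \<epsilon> (\<chi> i. \<lfloor>x $ i / \<epsilon>\<rfloor>)" by (simp add: mem_grid_cell[OF assms(3)])
    ultimately show ?thesis unfolding grid_cell_def by blast
  qed
  ultimately have "box_family P" by (auto simp: box_family_def P_def)
  moreover have "P \<noteq> {}" using assms(2) by (auto simp: P_def Z_def)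
  moreover have "A \<subseteq> \<Union>P"
  proof
    fix x assume "x \<in> A"
    moreover have "x \<in> grid_cell \<epsilon> (\<chi> i. \<lfloor>x $ i / \<epsilon>\<rfloor>)" by (simp add: mem_grid_cell[OF assms(3)])
    ultimately show "x \<in> \<Union>P" by (auto simp: P_def Z_def)
  qed
  moreover have "\<exists>y\<in>A. \<forall>i. \<bar>x $ i - y $ i\<bar> \<le> \<epsilon>" if x: "x \<in> \<Union>P" for x
  proof -
    obtain y where y: "y \<in> A" "x \<in> grid_cell \<epsilon> (\<chi> i. \<lfloor>y $ i / \<epsilon>\<rfloor>)"
      using x by (auto simp: P_def Z_def)
    have "y \<in> grid_cell \<epsilon> (\<chi> i. \<lfloor>y $ i / \<epsilon>\<rfloor>)" by (simp add: mem_grid_cell[OF assms(3)])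
    hence "\<epsilon> * of_int \<lfloor>y $ i / \<epsilon>\<rfloor> \<le> w $ i \<and> w $ i < \<epsilon> * of_int \<lfloor>y $ i / \<epsilon>\<rfloor> + \<epsilon>" if "w \<in> {x, y}" for w i
      using y(2) that unfolding grid_cell_def hbox_def by (auto simp: distrib_left)
    hence "\<bar>x $ i - y $ i\<bar> \<le> \<epsilon>" for i
      by (smt (verit, best) insertCI)
    thus ?thesis using y(1) by blast
  qed
  ultimately show ?thesis by blast
qed

text \<open>Covering each set by grid cells costs \<epsilon> per coordinate, hence 2 \<epsilon> for
  the sum. \<open>W\<close> has to contain this fattened sum, so no limit is taken here.\<close>

lemma brunn_minkowski_approx:
  fixes A B :: "(real^'n) set"
  assumes "bounded A" "bounded B" "A \<noteq> {}" "B \<noteq> {}" "A \<in> sets lebesgue" "B \<in> sets lebesgue"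
    and W: "W \<in> lmeasurable" and "\<epsilon> > 0"
    and sub: "\<And>x y u. x \<in> A \<Longrightarrow> y \<in> B \<Longrightarrow> (\<And>i. \<bar>u $ i\<bar> \<le> 2 * \<epsilon>) \<Longrightarrow> x + y + u \<in> W"
  shows "(root CARD('n) (measure lebesgue A) + root CARD('n) (measure lebesgue B)) ^ CARD('n) \<le> measure lebesgue W"
proof -
  obtain P where P: "box_family P" "P \<noteq> {}" "A \<subseteq> \<Union>P" "\<And>x. x \<in> \<Union>P \<Longrightarrow> \<exists>y\<in>A. \<forall>i. \<bar>x $ i - y $ i\<bar> \<le> \<epsilon>"
    using grid_cover[OF assms(1,3,8)] by blast
  obtain Q where Q: "box_family Q" "Q \<noteq> {}" "B \<subseteq> \<Union>Q" "\<And>x. x \<in> \<Union>Q \<Longrightarrow> \<exists>y\<in>B. \<forall>i. \<bar>x $ i - y $ i\<bar> \<le> \<epsilon>"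
    using grid_cover[OF assms(2,4,8)] by blast
  have mA: "measure lebesgue A \<le> measure lebesgue (\<Union>P)"
    using P(1,3) assms(5) by (intro measure_mono_fmeasurable lmeasurable_box_family) auto
  have mB: "measure lebesgue B \<le> measure lebesgue (\<Union>Q)"
    using Q(1,3) assms(6) by (intro measure_mono_fmeasurable lmeasurable_box_family) auto
  have "(root CARD('n) (measure lebesgue A) + root CARD('n) (measure lebesgue B)) ^ CARD('n)
      \<le> (root CARD('n) (measure lebesgue (\<Union>P)) + root CARD('n) (measure lebesgue (\<Union>Q))) ^ CARD('n)"
    using mA mB by (intro power_mono add_mono) auto
  also have "\<dots> \<le> measure lebesgue W"
  proof (rule brunn_minkowski_box_family[OF P(1) Q(1) P(2) Q(2) W])
    fix x y assume "x \<in> \<Union>P" "y \<in> \<Union>Q"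
    then obtain x' y' where x': "x' \<in> A" "\<And>i. \<bar>x $ i - x' $ i\<bar> \<le> \<epsilon>" and y': "y' \<in> B" "\<And>i. \<bar>y $ i - y' $ i\<bar> \<le> \<epsilon>"
      using P(4) Q(4) by meson
    have "\<bar>(x - x' + (y - y')) $ i\<bar> \<le> 2 * \<epsilon>" for i using x'(2)[of i] y'(2)[of i] by simp
    from sub[OF x'(1) y'(1) this] show "x + y \<in> W" by (simp add: algebra_simps)
  qed
  finally show ?thesis .
qed

section \<open>The weighted integral\<close>

definition Hexp :: "real \<Rightarrow> real" where "Hexp u = u * exp u - exp u + 1"

lemma H_exp_eq: "H (exp u) = Hexp u" by (simp add: H_def Hexp_def mult.commute)

lemma Hexp_0 [simp]: "Hexp 0 = 0" by (simp add: Hexp_def)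

lemma DERIV_Hexp: "(Hexp has_real_derivative u * exp u) (at u)"
  unfolding Hexp_def by (auto intro!: derivative_eq_intros simp: algebra_simps)

text \<open>The derivative u e^u dominates u. After integration this makes the entropy strictly
  increasing and unbounded in s, at a rate governed by the integral of \<phi>^2.\<close>

lemma Hexp_diff_ge:
  assumes "0 \<le> u" "u \<le> w" shows "(w\<^sup>2 - u\<^sup>2) / 2 \<le> Hexp w - Hexp u"
proof -
  have "Hexp u - u\<^sup>2 / 2 \<le> Hexp w - w\<^sup>2 / 2"
  proof (rule DERIV_nonneg_imp_nondecreasing[OF assms(2)])
    fix x assume x: "u \<le> x" "x \<le> w"
    have "((\<lambda>u. Hexp u - u\<^sup>2 / 2) has_real_derivative x * exp x - x) (at x)"
      by (auto intro!: derivative_eq_intros DERIV_Hexp)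
    moreover have "x * exp x - x \<ge> 0"
    proof -
      have "x * 1 \<le> x * exp x" using x assms by (intro mult_left_mono) auto
      thus ?thesis by simp
    qed
    ultimately show "\<exists>y. ((\<lambda>u. Hexp u - u\<^sup>2 / 2) has_real_derivative y) (at x) \<and> y \<ge> 0" by blast
  qed
  thus ?thesis by (simp add: field_simps)
qed

lemma Hexp_diff_le:
  assumes "0 \<le> u" "u \<le> w" shows "Hexp w - Hexp u \<le> (w - u) * (w * exp w)"
proof (cases "u = w")
  case False
  hence "u < w" using assms by simp
  from MVT2[OF this, of Hexp "\<lambda>x. x * exp x"] DERIV_Hexp
  obtain z where z: "z > u" "z < w" "Hexp w - Hexp u = (w - u) * (z * exp z)" by blast
  have "z * exp z \<le> w * exp w" using z assms by (intro mult_mono) auto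
  thus ?thesis using z assms by (auto intro: mult_left_mono)
qed simp

text \<open>The fraction of $u e^u$ that is spent on entropy; its monotonicity is what makes the
  indicator function the extremal weight at equal parameter.\<close>

definition entropy_share :: "real \<Rightarrow> real" where "entropy_share u = Hexp u / (u * exp u)"

lemma entropy_share_eq: "u > 0 \<Longrightarrow> entropy_share u = 1 - (1 - exp (- u)) / u"
  unfolding entropy_share_def Hexp_def by (simp add: field_simps exp_minus)

text \<open>In the closed form 1 - (1 - e^(-u))/u, positivity of the derivative amounts to e^x > 1 +
  x.\<close>

lemma entropy_share_strict_mono:
  assumes "0 < u" "u < w" shows "entropy_share u < entropy_share w"
proof -
  have "1 - (1 - exp (- u)) / u < 1 - (1 - exp (- w)) / w"
  proof (rule DERIV_pos_imp_increasing[OF assms(2)])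
    fix x assume x: "u \<le> x" "x \<le> w"
    hence x0: "x > 0" using assms by simp
    have "((\<lambda>u. 1 - (1 - exp (- u)) / u) has_real_derivative - (exp (-x) * x - (1 - exp (-x))) / x\<^sup>2) (at x)"
      using x0 by (auto intro!: derivative_eq_intros simp: power2_eq_square field_simps)
    moreover have "- (exp (-x) * x - (1 - exp (-x))) / x\<^sup>2 > 0"
    proof -
      have "exp (ln (1 + x)) < exp x" using ln_add_one_self_less_self[OF x0] unfolding exp_less_cancel_iff .
      moreover have "exp (ln (1 + x)) = 1 + x" using x0 by (subst exp_ln) auto
      ultimately have "exp x > 1 + x" by argo
      hence "exp (-x) * (1 + x) < 1" by (simp add: exp_minus field_simps)
      thus ?thesis using x0 by (simp add: algebra_simps)
    qed
    ultimately show "\<exists>y. ((\<lambda>u. 1 - (1 - exp (- u)) / u) has_real_derivative y) (at x) \<and> y > 0" by blast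
  qed
  thus ?thesis using assms by (simp add: entropy_share_eq)
qed

lemma entropy_share_pos: assumes "u > 0" shows "entropy_share u > 0"
proof -
  have "0 < u\<^sup>2 / 2" using assms by simp
  also have "\<dots> \<le> Hexp u" using Hexp_diff_ge[of 0 u] assms by simp
  finally show ?thesis using assms by (simp add: entropy_share_def)
qed

lemma continuous_on_entropy_share: "continuous_on {0<..} entropy_share"
  unfolding entropy_share_def Hexp_def by (auto intro!: continuous_intros)

section \<open>The weighted integral of a fixed function, as a minimum over s\<close>

locale weight =
  fixes \<phi> :: "real^'n \<Rightarrow> real"
  assumes meas [measurable]: "\<phi> \<in> borel_measurable lebesgue"
    and nonneg: "\<And>x. 0 \<le> \<phi> x" and le1: "\<And>x. \<phi> x \<le> 1"
    and int: "integrable lebesgue \<phi>" and pos: "0 < (LINT x|lebesgue. \<phi> x)"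
begin

text \<open>As functions of s, \<open>moment_at\<close> is formally the derivative of
  \<open>energy\<close>, and \<open>entropy_at\<close> is the Legendre combination s * moment -
  energy, see \<open>entropy_at_eq\<close>.\<close>

definition energy :: "real \<Rightarrow> real" where "energy s = (LINT x|lebesgue. exp (s * \<phi> x) - 1)"
definition entropy_at :: "real \<Rightarrow> real" where "entropy_at s = (LINT x|lebesgue. Hexp (s * \<phi> x))"
definition moment_at :: "real \<Rightarrow> real" where "moment_at s = (LINT x|lebesgue. \<phi> x * exp (s * \<phi> x))"

lemma exp_le: "0 \<le> s \<Longrightarrow> exp (s * \<phi> x) \<le> exp s"
  using le1[of x] mult_left_le[of "\<phi> x" s] nonneg[of x] by simp

text \<open>Convexity of exp on [0, s]. Equality holds for the values 0 and 1, that is, for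
  indicator functions.\<close>

lemma exp_chord: "exp (s * \<phi> x) - 1 \<le> (exp s - 1) * \<phi> x"
proof -
  have "exp ((1 - \<phi> x) *\<^sub>R 0 + \<phi> x *\<^sub>R s) \<le> (1 - \<phi> x) * exp 0 + \<phi> x * exp s"
    using nonneg[of x] le1[of x] exp_convex by (intro convex_onD[of UNIV exp]) auto
  thus ?thesis by (simp add: algebra_simps)
qed

lemma integrable_moment: assumes "0 \<le> s" shows "integrable lebesgue (\<lambda>x. \<phi> x * exp (s * \<phi> x))"
proof (rule Bochner_Integration.integrable_bound)
  show "integrable lebesgue (\<lambda>x. exp s * \<phi> x)" using int by simp
  show "AE x in lebesgue. norm (\<phi> x * exp (s * \<phi> x)) \<le> norm (exp s * \<phi> x)"
  proof (rule AE_I2)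
    fix x
    have "\<phi> x * exp (s * \<phi> x) \<le> \<phi> x * exp s" by (intro mult_left_mono exp_le assms nonneg)
    thus "norm (\<phi> x * exp (s * \<phi> x)) \<le> norm (exp s * \<phi> x)" using nonneg[of x] by (simp add: abs_mult mult.commute)
  qed
qed measurable

lemma integrable_energy: assumes "0 \<le> s" shows "integrable lebesgue (\<lambda>x. exp (s * \<phi> x) - 1)"
proof (rule Bochner_Integration.integrable_bound)
  show "integrable lebesgue (\<lambda>x. (exp s - 1) * \<phi> x)" using int by simp
  show "AE x in lebesgue. norm (exp (s * \<phi> x) - 1) \<le> norm ((exp s - 1) * \<phi> x)"
    using exp_chord[of s] nonneg assms by auto
qed measurable

lemma integrable_entropy: assumes "0 \<le> s" shows "integrable lebesgue (\<lambda>x. Hexp (s * \<phi> x))"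
proof -
  have "integrable lebesgue (\<lambda>x. s * (\<phi> x * exp (s * \<phi> x)) - (exp (s * \<phi> x) - 1))"
    by (intro Bochner_Integration.integrable_diff integrable_mult_right integrable_moment integrable_energy assms)
  thus ?thesis by (simp add: Hexp_def algebra_simps)
qed

lemma entropy_at_eq: assumes "0 \<le> s" shows "entropy_at s = s * moment_at s - energy s"
proof -
  have "entropy_at s = (LINT x|lebesgue. s * (\<phi> x * exp (s * \<phi> x)) - (exp (s * \<phi> x) - 1))"
    unfolding entropy_at_def Hexp_def by (simp add: algebra_simps)
  also have "\<dots> = s * moment_at s - energy s"
    unfolding moment_at_def energy_def
    by (subst Bochner_Integration.integral_diff) (auto intro!: integrable_mult_right integrable_moment integrable_energy assms)
  finally show ?thesis .
qed

lemma sq_pos: "(LINT x|lebesgue. (\<phi> x)\<^sup>2) > 0" and integrable_sq: "integrable lebesgue (\<lambda>x. (\<phi> x)\<^sup>2)"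
proof -
  show i: "integrable lebesgue (\<lambda>x. (\<phi> x)\<^sup>2)"
  proof (rule Bochner_Integration.integrable_bound[OF int])
    show "AE x in lebesgue. norm ((\<phi> x)\<^sup>2) \<le> norm (\<phi> x)"
      using nonneg le1 by (auto simp: power2_eq_square intro!: mult_left_le)
  qed measurable
  have "(LINT x|lebesgue. (\<phi> x)\<^sup>2) \<noteq> 0"
  proof
    assume "(LINT x|lebesgue. (\<phi> x)\<^sup>2) = 0"
    hence "AE x in lebesgue. (\<phi> x)\<^sup>2 = 0" using integral_nonneg_eq_0_iff_AE[OF i] by simp
    hence "AE x in lebesgue. \<phi> x = 0" by simp
    hence "(LINT x|lebesgue. \<phi> x) = 0" by (subst integral_cong_AE[where g="\<lambda>_. 0"]) auto
    thus False using pos by simp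
  qed
  moreover have "(LINT x|lebesgue. (\<phi> x)\<^sup>2) \<ge> 0" by simp
  ultimately show "(LINT x|lebesgue. (\<phi> x)\<^sup>2) > 0" by linarith
qed

lemma entropy_at_diff_ge:
  assumes "0 \<le> s" "s \<le> r" shows "entropy_at r - entropy_at s \<ge> (r\<^sup>2 - s\<^sup>2) / 2 * (LINT x|lebesgue. (\<phi> x)\<^sup>2)"
proof -
  have "entropy_at r - entropy_at s = (LINT x|lebesgue. Hexp (r * \<phi> x) - Hexp (s * \<phi> x))"
    unfolding entropy_at_def using assms by (simp add: integrable_entropy)
  also have "\<dots> \<ge> (LINT x|lebesgue. (r\<^sup>2 - s\<^sup>2) / 2 * (\<phi> x)\<^sup>2)"
  proof (rule integral_mono)
    fix x
    show "(r\<^sup>2 - s\<^sup>2) / 2 * (\<phi> x)\<^sup>2 \<le> Hexp (r * \<phi> x) - Hexp (s * \<phi> x)"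
      using Hexp_diff_ge[of "s * \<phi> x" "r * \<phi> x"] assms nonneg[of x]
      by (simp add: mult_right_mono power_mult_distrib algebra_simps)
  qed (use assms integrable_entropy integrable_sq in auto)
  finally show ?thesis by simp
qed

lemma entropy_at_strict_mono: assumes "0 \<le> s" "s < r" shows "entropy_at s < entropy_at r"
proof -
  have "s\<^sup>2 < r\<^sup>2" using assms by (intro power_strict_mono) auto
  hence "(r\<^sup>2 - s\<^sup>2) / 2 * (LINT x|lebesgue. (\<phi> x)\<^sup>2) > 0" using sq_pos by simp
  thus ?thesis using entropy_at_diff_ge[of s r] assms by simp
qed

lemma entropy_at_0 [simp]: "entropy_at 0 = 0" by (simp add: entropy_at_def)

lemma entropy_at_lipschitz:
  assumes "0 \<le> s" "s \<le> r" "r \<le> R"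
  shows "entropy_at r - entropy_at s \<le> (r - s) * (R * exp R * (LINT x|lebesgue. \<phi> x))"
proof -
  have "entropy_at r - entropy_at s = (LINT x|lebesgue. Hexp (r * \<phi> x) - Hexp (s * \<phi> x))"
    unfolding entropy_at_def using assms by (simp add: integrable_entropy)
  also have "\<dots> \<le> (LINT x|lebesgue. (r - s) * (R * exp R) * \<phi> x)"
  proof (rule integral_mono)
    fix x
    have "r * \<phi> x \<le> R * 1" using assms nonneg[of x] le1[of x] by (intro mult_mono) auto
    hence "(r * \<phi> x) * exp (r * \<phi> x) \<le> R * exp R"
      using assms nonneg[of x] by (intro mult_mono) auto
    hence "(r * \<phi> x - s * \<phi> x) * ((r * \<phi> x) * exp (r * \<phi> x)) \<le> (r * \<phi> x - s * \<phi> x) * (R * exp R)"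
      using assms nonneg[of x] by (intro mult_left_mono) (auto intro: mult_right_mono)
    moreover have "Hexp (r * \<phi> x) - Hexp (s * \<phi> x) \<le> (r * \<phi> x - s * \<phi> x) * ((r * \<phi> x) * exp (r * \<phi> x))"
      using assms nonneg[of x] by (intro Hexp_diff_le) (auto intro: mult_right_mono)
    ultimately show "Hexp (r * \<phi> x) - Hexp (s * \<phi> x) \<le> (r - s) * (R * exp R) * \<phi> x"
      by (simp add: algebra_simps)
  qed (use assms integrable_entropy int in auto)
  finally show ?thesis by simp
qed

lemma continuous_on_entropy_at: "continuous_on {0..R} entropy_at"
proof (cases "R \<ge> 0")
  case True
  let ?K = "R * exp R * (LINT x|lebesgue. \<phi> x)"
  have "?K-lipschitz_on {0..R} entropy_at"
  proof (rule lipschitz_onI)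
    fix x y assume "x \<in> {0..R}" "y \<in> {0..R}"
    thus "dist (entropy_at x) (entropy_at y) \<le> ?K * dist x y"
      using entropy_at_lipschitz[of x y R] entropy_at_lipschitz[of y x R] entropy_at_strict_mono[of x y] entropy_at_strict_mono[of y x]
      by (cases x y rule: linorder_cases) (auto simp: dist_real_def abs_real_def mult.commute)
  next
    show "?K \<ge> 0" using True pos by simp
  qed
  thus ?thesis by (rule lipschitz_on_continuous_on)
qed simp

lemma isCont_entropy_at: assumes "s > 0" shows "isCont entropy_at s"
proof -
  have "continuous_on {0<..<s+1} entropy_at" by (rule continuous_on_subset[OF continuous_on_entropy_at[of "s+1"]]) auto
  thus ?thesis using assms by (simp add: continuous_on_eq_continuous_at)
qed

lemma entropy_at_surj: assumes "\<tau> > 0" shows "\<exists>s>0. entropy_at s = \<tau>"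
proof -
  let ?q = "LINT x|lebesgue. (\<phi> x)\<^sup>2"
  \<comment> \<open>The point at which the quadratic lower bound for the entropy reaches
    \<tau>.\<close>
  define R where "R = sqrt (2 * \<tau> / ?q)"
  have R: "R \<ge> 0" "R\<^sup>2 = 2 * \<tau> / ?q" using sq_pos assms by (auto simp: R_def)
  have "entropy_at R - entropy_at 0 \<ge> (R\<^sup>2 - 0\<^sup>2) / 2 * ?q" by (rule entropy_at_diff_ge) (use R in auto)
  hence "entropy_at R \<ge> \<tau>" unfolding R(2) using sq_pos by simp
  hence "\<exists>s\<ge>0. s \<le> R \<and> entropy_at s = \<tau>" using assms R by (intro IVT' continuous_on_entropy_at) auto
  then obtain s where "s \<ge> 0" "entropy_at s = \<tau>" by blast
  moreover have "s \<noteq> 0" using calculation assms by auto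
  ultimately show ?thesis by (intro exI[of _ s]) auto
qed

definition tilt :: "real \<Rightarrow> real" where "tilt \<tau> = s_param \<phi> (1 / \<tau>)"
definition xi_at :: "real \<Rightarrow> real" where "xi_at \<tau> = xi \<phi> (1 / \<tau>)"

text \<open>Strict monotonicity of the entropy supplies the uniqueness that the definite description
  in \<open>s_param\<close> requires.\<close>

lemma tilt_entropy_at: assumes "s > 0" shows "tilt (entropy_at s) = s"
  unfolding tilt_def s_param_def H_exp_eq
proof (rule the_equality)
  show "0 \<le> s \<and> (LINT x|lebesgue. Hexp (s * \<phi> x)) = 1 / (1 / entropy_at s)" using assms by (simp add: entropy_at_def)
  fix r assume "0 \<le> r \<and> (LINT x|lebesgue. Hexp (r * \<phi> x)) = 1 / (1 / entropy_at s)"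
  hence "0 \<le> r" "entropy_at r = entropy_at s" by (auto simp: entropy_at_def)
  thus "r = s" using assms entropy_at_strict_mono[of r s] entropy_at_strict_mono[of s r] by (cases r s rule: linorder_cases) auto
qed

lemma tilt_pos: "\<tau> > 0 \<Longrightarrow> tilt \<tau> > 0" and entropy_at_tilt: "\<tau> > 0 \<Longrightarrow> entropy_at (tilt \<tau>) = \<tau>"
  using entropy_at_surj tilt_entropy_at by metis+

lemma tilt_mono: assumes "0 < \<tau>" "\<tau> < \<rho>" shows "tilt \<tau> < tilt \<rho>"
  using assms entropy_at_tilt[of \<tau>] entropy_at_tilt[of \<rho>] entropy_at_strict_mono[of "tilt \<rho>" "tilt \<tau>"] tilt_pos[of \<tau>] tilt_pos[of \<rho>]
  by (cases "tilt \<tau>" "tilt \<rho>" rule: linorder_cases) auto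

lemma isCont_tilt: assumes "\<tau> > 0" shows "isCont tilt \<tau>"
proof -
  have "isCont tilt (entropy_at (tilt \<tau>))"
    by (rule isCont_inverse_function2[of "tilt \<tau> / 2" "tilt \<tau>" "2 * tilt \<tau>"])
       (use tilt_pos[OF assms] in \<open>auto intro!: tilt_entropy_at isCont_entropy_at\<close>)
  thus ?thesis by (simp add: entropy_at_tilt assms)
qed

lemma xi_at_eq_moment: "\<tau> > 0 \<Longrightarrow> xi_at \<tau> = moment_at (tilt \<tau>)"
  unfolding xi_at_def xi_def moment_at_def tilt_def using pos by simp

lemma tilt_xi_at: assumes "\<tau> > 0" shows "tilt \<tau> * xi_at \<tau> = \<tau> + energy (tilt \<tau>)"
  using entropy_at_eq[of "tilt \<tau>"] entropy_at_tilt[OF assms] tilt_pos[OF assms] by (simp add: xi_at_eq_moment assms)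

lemma xi_at_eq: assumes "\<tau> > 0" shows "xi_at \<tau> = (\<tau> + energy (tilt \<tau>)) / tilt \<tau>"
  using tilt_xi_at[OF assms] tilt_pos[OF assms] by (simp add: field_simps)

text \<open>Young's inequality, taken pointwise: it is the tangent bound for exp at r \<phi>(x),
  where r is the tilt of \<tau>. By \<open>xi_at_eq\<close> there is equality at s = r, so \<xi> is
  a minimum of affine functions of \<tau>, and any s may be tested.\<close>

lemma xi_at_le: assumes "\<tau> > 0" "s > 0" shows "xi_at \<tau> \<le> (\<tau> + energy s) / s"
proof -
  let ?r = "tilt \<tau>"
  have r: "?r > 0" using tilt_pos assms by simp
  have "s * xi_at \<tau> = (LINT x|lebesgue. s * (\<phi> x * exp (?r * \<phi> x)))"
    using assms by (simp add: xi_at_eq_moment moment_at_def)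
  also have "\<dots> \<le> (LINT x|lebesgue. Hexp (?r * \<phi> x) + (exp (s * \<phi> x) - 1))"
  proof (rule integral_mono)
    fix x
    have "exp (?r * \<phi> x) * (1 + (s * \<phi> x - ?r * \<phi> x)) \<le> exp (?r * \<phi> x) * exp (s * \<phi> x - ?r * \<phi> x)"
      by (intro mult_left_mono exp_ge_add_one_self) auto
    also have "\<dots> = exp (s * \<phi> x)" by (simp add: exp_diff)
    finally show "s * (\<phi> x * exp (?r * \<phi> x)) \<le> Hexp (?r * \<phi> x) + (exp (s * \<phi> x) - 1)"
      by (simp add: Hexp_def algebra_simps)
  qed (use r assms in \<open>auto intro!: integrable_mult_right integrable_moment Bochner_Integration.integrable_add integrable_entropy integrable_energy\<close>)
  also have "\<dots> = entropy_at ?r + energy s"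
    unfolding entropy_at_def energy_def using r assms by (intro Bochner_Integration.integral_add integrable_entropy integrable_energy) auto
  finally show ?thesis using assms entropy_at_tilt by (simp add: field_simps)
qed

lemma xi_at_ge_integral: assumes "\<tau> > 0" shows "(LINT x|lebesgue. \<phi> x) \<le> xi_at \<tau>"
  unfolding xi_at_eq_moment[OF assms] moment_at_def
proof (rule integral_mono[OF int integrable_moment])
  show "0 \<le> tilt \<tau>" using tilt_pos[OF assms] by simp
  fix x show "\<phi> x \<le> \<phi> x * exp (tilt \<tau> * \<phi> x)"
    using mult_left_mono[of 1 "exp (tilt \<tau> * \<phi> x)" "\<phi> x"] nonneg[of x] tilt_pos[OF assms] by simp
qed

lemma xi_at_pos: "\<tau> > 0 \<Longrightarrow> xi_at \<tau> > 0"
  using xi_at_ge_integral pos by (meson less_le_trans)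

lemma energy_nonneg: "0 \<le> s \<Longrightarrow> 0 \<le> energy s"
  unfolding energy_def using nonneg by (intro integral_nonneg_AE) auto

lemma xi_at_mono: assumes "0 < \<tau>" "\<tau> \<le> \<rho>" shows "xi_at \<tau> \<le> xi_at \<rho>"
proof -
  have "xi_at \<tau> \<le> (\<tau> + energy (tilt \<rho>)) / tilt \<rho>" using assms tilt_pos by (intro xi_at_le) auto
  also have "\<dots> \<le> xi_at \<rho>" using assms tilt_pos[of \<rho>] by (simp add: xi_at_eq divide_right_mono)
  finally show ?thesis .
qed

text \<open>The affine functions in the minimum formula have nonnegative intercept. Together with
  monotonicity this bound passes to suprema over \<phi>, and the two yield continuity of
  \<open>f_chi\<close>.\<close>

lemma xi_at_scale: assumes "0 < \<tau>" "0 < c" "c \<le> 1" shows "c * xi_at \<tau> \<le> xi_at (c * \<tau>)"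
proof -
  let ?s = "tilt (c * \<tau>)"
  have s: "?s > 0" using assms tilt_pos by simp
  have "c * xi_at \<tau> \<le> c * ((\<tau> + energy ?s) / ?s)" using assms s by (intro mult_left_mono xi_at_le) auto
  also have "\<dots> \<le> (c * \<tau> + energy ?s) / ?s"
  proof -
    have "c * energy ?s \<le> 1 * energy ?s" using assms s energy_nonneg[of ?s] by (intro mult_right_mono) auto
    thus ?thesis using s by (simp add: field_simps)
  qed
  also have "\<dots> = xi_at (c * \<tau>)" using assms by (simp add: xi_at_eq)
  finally show ?thesis .
qed

text \<open>Envelope argument: each of the two optimal parameters is tested in the minimum formula
  at the other point, so every difference quotient lies between 1/s at its two ends. Continuity of
  the tilt closes the sandwich.\<close>

lemma DERIV_xi_at: assumes "\<tau> > 0" shows "(xi_at has_real_derivative 1 / tilt \<tau>) (at \<tau>)"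
proof -
  have slope: "xi_at \<rho> \<le> xi_at \<sigma> + (\<rho> - \<sigma>) / tilt \<sigma>" if "\<rho> > 0" "\<sigma> > 0" for \<rho> \<sigma>
  proof -
    have "xi_at \<rho> \<le> (\<rho> + energy (tilt \<sigma>)) / tilt \<sigma>" using that tilt_pos by (intro xi_at_le) auto
    also have "\<dots> = xi_at \<sigma> + (\<rho> - \<sigma>) / tilt \<sigma>" using that by (simp add: xi_at_eq diff_divide_distrib add_divide_distrib)
    finally show ?thesis .
  qed
  have inv: "isCont (\<lambda>\<rho>. 1 / tilt \<rho>) \<tau>"
    using isCont_tilt[OF assms] tilt_pos[OF assms] by (intro continuous_intros) auto
  have *: "((\<lambda>\<rho>. 1 / tilt \<rho>) \<longlongrightarrow> 1 / tilt \<tau>) (at \<tau>)" using inv by (simp add: isCont_def)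
  have ev: "\<forall>\<^sub>F \<rho> in at \<tau>. \<rho> > 0 \<and> \<rho> \<noteq> \<tau>"
    using eventually_at_in_open[of "{0<..}" \<tau>] assms by (auto elim!: eventually_mono)
  have bd: "min (1 / tilt \<rho>) (1 / tilt \<tau>) \<le> (xi_at \<rho> - xi_at \<tau>) / (\<rho> - \<tau>) \<and> (xi_at \<rho> - xi_at \<tau>) / (\<rho> - \<tau>) \<le> max (1 / tilt \<rho>) (1 / tilt \<tau>)"
    if "\<rho> > 0" "\<rho> \<noteq> \<tau>" for \<rho>
  proof -
    have 1: "xi_at \<rho> - xi_at \<tau> \<le> (\<rho> - \<tau>) * (1 / tilt \<tau>)" "xi_at \<tau> - xi_at \<rho> \<le> (\<tau> - \<rho>) * (1 / tilt \<rho>)"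
      using slope[of \<rho> \<tau>] slope[of \<tau> \<rho>] assms that by auto
    have gen: "D / h \<le> a \<and> b \<le> D / h" if "D \<le> h * a" "h * b \<le> D" "h > 0" for D h a b :: real
      using that by (simp add: pos_divide_le_eq pos_le_divide_eq mult.commute)
    show ?thesis
    proof (cases "\<rho> > \<tau>")
      case True
      have "(\<rho> - \<tau>) * (1 / tilt \<rho>) \<le> xi_at \<rho> - xi_at \<tau>" using 1(2) by (auto simp only: left_diff_distrib)
      from gen[OF 1(1) this] True show ?thesis by (simp add: min_le_iff_disj le_max_iff_disj)
    next
      case False
      hence less: "\<tau> - \<rho> > 0" using that by simp
      have "(\<tau> - \<rho>) * (1 / tilt \<tau>) \<le> xi_at \<tau> - xi_at \<rho>" using 1(1) by (auto simp only: left_diff_distrib)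
      from gen[OF 1(2) this less]
      have "(xi_at \<tau> - xi_at \<rho>) / (\<tau> - \<rho>) \<le> 1 / tilt \<rho>" "1 / tilt \<tau> \<le> (xi_at \<tau> - xi_at \<rho>) / (\<tau> - \<rho>)" by auto
      moreover have "(xi_at \<tau> - xi_at \<rho>) / (\<tau> - \<rho>) = (xi_at \<rho> - xi_at \<tau>) / (\<rho> - \<tau>)"
        by (metis minus_diff_eq minus_divide_divide)
      ultimately show ?thesis by (simp add: min_le_iff_disj le_max_iff_disj)
    qed
  qed
  have mn: "((\<lambda>\<rho>. min (1 / tilt \<rho>) (1 / tilt \<tau>)) \<longlongrightarrow> 1 / tilt \<tau>) (at \<tau>)"
    using tendsto_min[OF * tendsto_const[of "1 / tilt \<tau>"]] by simp
  have mx: "((\<lambda>\<rho>. max (1 / tilt \<rho>) (1 / tilt \<tau>)) \<longlongrightarrow> 1 / tilt \<tau>) (at \<tau>)"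
    using tendsto_max[OF * tendsto_const[of "1 / tilt \<tau>"]] by simp
  have "((\<lambda>\<rho>. (xi_at \<rho> - xi_at \<tau>) / (\<rho> - \<tau>)) \<longlongrightarrow> 1 / tilt \<tau>) (at \<tau>)"
  proof (rule tendsto_sandwich[OF _ _ mn mx])
    show "\<forall>\<^sub>F \<rho> in at \<tau>. min (1 / tilt \<rho>) (1 / tilt \<tau>) \<le> (xi_at \<rho> - xi_at \<tau>) / (\<rho> - \<tau>)"
      using ev by eventually_elim (use bd in blast)
    show "\<forall>\<^sub>F \<rho> in at \<tau>. (xi_at \<rho> - xi_at \<tau>) / (\<rho> - \<tau>) \<le> max (1 / tilt \<rho>) (1 / tilt \<tau>)"
      using ev by eventually_elim (use bd in blast)
  qed
  thus ?thesis by (simp add: has_field_derivative_iff)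
qed

text \<open>Since \<phi> is at most 1, the share at s \<phi>(x) is at most the share at s;
  integrating against s \<phi> e^(s \<phi>) gives the bound.\<close>

lemma tau_le_entropy_share: assumes "\<tau> > 0" shows "\<tau> \<le> entropy_share (tilt \<tau>) * (tilt \<tau> * xi_at \<tau>)"
proof -
  let ?s = "tilt \<tau>"
  have s: "?s > 0" using tilt_pos assms by simp
  have "\<tau> = (LINT x|lebesgue. Hexp (?s * \<phi> x))" using entropy_at_tilt[OF assms] by (simp add: entropy_at_def)
  also have "\<dots> \<le> (LINT x|lebesgue. entropy_share ?s * ?s * (\<phi> x * exp (?s * \<phi> x)))"
  proof (rule integral_mono)
    fix x
    show "Hexp (?s * \<phi> x) \<le> entropy_share ?s * ?s * (\<phi> x * exp (?s * \<phi> x))"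
    proof (cases "\<phi> x = 0")
      case False
      hence p: "?s * \<phi> x > 0" using s nonneg[of x] by simp
      have "entropy_share (?s * \<phi> x) \<le> entropy_share ?s"
      proof (cases "\<phi> x = 1")
        case False
        hence "?s * \<phi> x < ?s" using s le1[of x] by simp
        thus ?thesis using entropy_share_strict_mono[OF p] by fastforce
      qed simp
      hence "entropy_share (?s * \<phi> x) * ((?s * \<phi> x) * exp (?s * \<phi> x)) \<le> entropy_share ?s * ((?s * \<phi> x) * exp (?s * \<phi> x))"
        using p by (intro mult_right_mono) auto
      moreover have "entropy_share (?s * \<phi> x) * ((?s * \<phi> x) * exp (?s * \<phi> x)) = Hexp (?s * \<phi> x)"
        using p by (simp add: entropy_share_def)
      ultimately show ?thesis by (simp only: mult.assoc)
    qed simp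
  qed (use s in \<open>auto intro!: integrable_mult_right integrable_moment integrable_entropy\<close>)
  also have "\<dots> = entropy_share ?s * (?s * xi_at \<tau>)" using assms by (simp add: xi_at_eq_moment moment_at_def)
  finally show ?thesis .
qed

end

section \<open>Feasible functions and the packing density\<close>

lemma lebesgue_translation:
  fixes a :: "'a::euclidean_space"
  shows measurable_lebesgue_translation [measurable]: "(\<lambda>x. x + a) \<in> lebesgue \<rightarrow>\<^sub>M lebesgue"
    and lebesgue_distr_translation: "lebesgue = distr lebesgue lebesgue (\<lambda>x. x + a)"
proof -
  have *: "(\<lambda>x. a + (\<Sum>j\<in>Basis. (1 * (x \<bullet> j)) *\<^sub>R j)) = (\<lambda>x. x + a)"
    by (simp add: euclidean_representation add.commute)
  show "(\<lambda>x. x + a) \<in> lebesgue \<rightarrow>\<^sub>M lebesgue"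
    using lebesgue_affine_measurable[of "\<lambda>_. 1" a] unfolding * by simp
  show "lebesgue = distr lebesgue lebesgue (\<lambda>x. x + a)"
    using lebesgue_affine_euclidean[of "\<lambda>_. 1" a] unfolding * by (simp add: density_1)
qed

lemma nn_integral_lebesgue_translation:
  fixes a :: "'a::euclidean_space"
  assumes [measurable]: "f \<in> borel_measurable lebesgue"
  shows "(\<integral>\<^sup>+x. f (x + a) \<partial>lebesgue) = (\<integral>\<^sup>+x. f x \<partial>lebesgue)"
  by (subst (2) lebesgue_distr_translation[of a], subst nn_integral_distr) auto

definition lattice_point :: "real \<Rightarrow> int^'n \<Rightarrow> real^'n" where
  "lattice_point L z = (\<chi> i. L * of_int (z $ i))"

lemma grid_cell_translate: "x + lattice_point L z \<in> grid_cell L z \<longleftrightarrow> x \<in> grid_cell L 0"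
  by (simp add: grid_cell_def hbox_def lattice_point_def distrib_left add.commute)

lemma sets_grid_cell [measurable, simp]: "grid_cell L z \<in> sets lebesgue"
  by (simp add: grid_cell_def)

lemma emeasure_grid_cell_0:
  assumes "L > 0" shows "emeasure lebesgue (grid_cell L (0::int^'n)) = ennreal (L ^ CARD('n))"
proof -
  have "measure lebesgue (grid_cell L (0::int^'n)) = L ^ CARD('n)"
    unfolding grid_cell_def using assms by (subst measure_hbox) auto
  moreover have "grid_cell L (0::int^'n) \<in> lmeasurable" by (simp add: grid_cell_def)
  ultimately show ?thesis by (metis emeasure_eq_measure2)
qed

text \<open>The translates of the cell tile space, so the integral over one cell of the sum over all
  lattice translates and all of \<open>C\<close> is \<open>card C\<close> times the full integral.
  The integrals are extended nonnegative because the bound is what proves integrability of feasible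
  functions.\<close>

lemma periodization_bound:
  fixes f :: "real^'n \<Rightarrow> ennreal"
  assumes f [measurable]: "f \<in> borel_measurable lebesgue" and L: "L > 0" and C: "finite C"
    and bd: "\<And>x Z. finite Z \<Longrightarrow> (\<Sum>z\<in>Z. \<Sum>c\<in>C. f (x + lattice_point L z + c)) \<le> 1"
  shows "of_nat (card C) * (\<integral>\<^sup>+x. f x \<partial>lebesgue) \<le> ennreal (L ^ CARD('n))"
proof -
  have inf: "infinite (UNIV :: (int^'n) set)"
  proof
    assume "finite (UNIV :: (int^'n) set)"
    moreover have "inj (\<lambda>k. vec k :: int^'n)" by (auto simp: inj_def vec_eq_iff)
    ultimately have "finite (UNIV :: int set)" by (meson finite_imageD finite_subset subset_UNIV)
    thus False by simp
  qed
  define e :: "nat \<Rightarrow> int^'n" where "e = from_nat_into UNIV"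
  have e: "bij e" unfolding e_def by (rule bij_betw_from_nat_into) (use inf in auto)
  have one: "(\<Sum>n. f (x + c) * indicator (grid_cell L (e n)) x) = f (x + c)" for x c
  proof -
    define m where "m = inv e (\<chi> i. \<lfloor>x $ i / L\<rfloor>)"
    have m: "x \<in> grid_cell L (e n) \<longleftrightarrow> n = m" for n
      unfolding mem_grid_cell[OF L] m_def using e by (metis bij_inv_eq_iff)
    have "(\<Sum>n. f (x + c) * indicator (grid_cell L (e n)) x) = (\<Sum>n\<in>{m}. f (x + c) * indicator (grid_cell L (e n)) x)"
      by (intro suminf_finite) (auto simp: m indicator_def)
    thus ?thesis by (simp add: m)
  qed
  have per: "(\<integral>\<^sup>+x. f x \<partial>lebesgue) = (\<Sum>n. \<integral>\<^sup>+x. f (x + lattice_point L (e n) + c) * indicator (grid_cell L 0) x \<partial>lebesgue)" for c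
  proof -
    have "(\<integral>\<^sup>+x. f x \<partial>lebesgue) = (\<integral>\<^sup>+x. f (x + c) \<partial>lebesgue)"
      by (rule nn_integral_lebesgue_translation[symmetric]) simp
    also have "\<dots> = (\<integral>\<^sup>+x. (\<Sum>n. f (x + c) * indicator (grid_cell L (e n)) x) \<partial>lebesgue)"
      unfolding one ..
    also have "\<dots> = (\<Sum>n. \<integral>\<^sup>+x. f (x + c) * indicator (grid_cell L (e n)) x \<partial>lebesgue)"
      by (rule nn_integral_suminf) measurable
    also have "\<dots> = (\<Sum>n. \<integral>\<^sup>+x. f (x + lattice_point L (e n) + c) * indicator (grid_cell L (e n)) (x + lattice_point L (e n)) \<partial>lebesgue)"
    proof (rule suminf_cong)
      fix n
      have "(\<lambda>x. f (x + c) * indicator (grid_cell L (e n)) x) \<in> borel_measurable lebesgue" by measurable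
      from nn_integral_lebesgue_translation[OF this, of "lattice_point L (e n)"]
      show "(\<integral>\<^sup>+x. f (x + c) * indicator (grid_cell L (e n)) x \<partial>lebesgue) =
        (\<integral>\<^sup>+x. f (x + lattice_point L (e n) + c) * indicator (grid_cell L (e n)) (x + lattice_point L (e n)) \<partial>lebesgue)" by simp
    qed
    also have "\<dots> = (\<Sum>n. \<integral>\<^sup>+x. f (x + lattice_point L (e n) + c) * indicator (grid_cell L 0) x \<partial>lebesgue)"
      by (simp add: indicator_def grid_cell_translate)
    finally show ?thesis .
  qed
  have me [measurable]: "(\<lambda>x. f (x + a + c)) \<in> borel_measurable lebesgue" for a c
    using measurable_compose[OF measurable_lebesgue_translation[of "a + c"] f] by (simp add: add.assoc)
  have "of_nat (card C) * (\<integral>\<^sup>+x. f x \<partial>lebesgue) = (\<Sum>c\<in>C. \<integral>\<^sup>+x. f x \<partial>lebesgue)" by simp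
  also have "\<dots> = (\<Sum>c\<in>C. \<Sum>n. \<integral>\<^sup>+x. f (x + lattice_point L (e n) + c) * indicator (grid_cell L 0) x \<partial>lebesgue)"
    by (rule sum.cong[OF refl per])
  also have "\<dots> = (\<Sum>n. \<Sum>c\<in>C. \<integral>\<^sup>+x. f (x + lattice_point L (e n) + c) * indicator (grid_cell L 0) x \<partial>lebesgue)"
    by (rule suminf_sum[symmetric]) simp
  also have "\<dots> = (\<Sum>n. \<integral>\<^sup>+x. (\<Sum>c\<in>C. f (x + lattice_point L (e n) + c) * indicator (grid_cell L 0) x) \<partial>lebesgue)"
    by (intro suminf_cong nn_integral_sum[symmetric]) measurable
  also have "\<dots> = (\<integral>\<^sup>+x. (\<Sum>n. \<Sum>c\<in>C. f (x + lattice_point L (e n) + c) * indicator (grid_cell L 0) x) \<partial>lebesgue)"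
    by (intro nn_integral_suminf[symmetric]) measurable
  also have "\<dots> \<le> (\<integral>\<^sup>+x. indicator (grid_cell L (0::int^'n)) x \<partial>lebesgue)"
  proof (rule nn_integral_mono)
    fix x :: "real^'n"
    show "(\<Sum>n. \<Sum>c\<in>C. f (x + lattice_point L (e n) + c) * indicator (grid_cell L 0) x) \<le> indicator (grid_cell L 0) x"
    proof (cases "x \<in> grid_cell L 0")
      case True
      \<comment> \<open>The hypothesis on finite \<open>Z\<close> bounds each partial sum, hence the
        series.\<close>
      have "(\<Sum>n. \<Sum>c\<in>C. f (x + lattice_point L (e n) + c)) \<le> 1"
      proof (rule suminf_le_const)
        fix m
        have "inj_on e {..<m}" using e by (meson bij_is_inj inj_on_subset subset_UNIV)
        hence "(\<Sum>n<m. \<Sum>c\<in>C. f (x + lattice_point L (e n) + c)) = (\<Sum>z\<in>e ` {..<m}. \<Sum>c\<in>C. f (x + lattice_point L z + c))"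
          by (simp add: sum.reindex)
        also have "\<dots> \<le> 1" by (rule bd) simp
        finally show "(\<Sum>n<m. \<Sum>c\<in>C. f (x + lattice_point L (e n) + c)) \<le> 1" .
      qed simp
      thus ?thesis using True by simp
    qed simp
  qed
  also have "\<dots> = ennreal (L ^ CARD('n))" using emeasure_grid_cell_0[OF L] by simp
  finally show ?thesis .
qed

section \<open>Comparison of the norm with coordinates, and volumes of its balls\<close>

locale finite_dim_norm =
  fixes N :: "real^'n \<Rightarrow> real"
  assumes N: "is_norm N"
begin

lemma N_eq_0: "N x = 0 \<longleftrightarrow> x = 0" and N_triangle: "N (x + y) \<le> N x + N y"
  and N_scale: "N (c *\<^sub>R x) = \<bar>c\<bar> * N x"
  using N unfolding is_norm_def by blast+

lemma N_0 [simp]: "N 0 = 0" by (simp add: N_eq_0)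

lemma N_minus [simp]: "N (- x) = N x" using N_scale[of "-1" x] by simp

lemma N_minus_commute: "N (x - y) = N (y - x)" using N_minus[of "x - y"] by simp

lemma N_nonneg: "0 \<le> N x" using N_triangle[of x "- x"] by simp

lemma N_diff_le: "\<bar>N x - N y\<bar> \<le> N (x - y)"
  using N_triangle[of "x - y" y] N_triangle[of "y - x" x] N_minus_commute[of x y] by simp

lemma N_sum_le: "N (\<Sum>i\<in>I. f i) \<le> (\<Sum>i\<in>I. N (f i))"
  by (induction I rule: infinite_finite_induct) (auto intro: order_trans[OF N_triangle])

lemma N_le_coord: "\<exists>K>0. \<forall>x b. (\<forall>i. \<bar>x $ i\<bar> \<le> b) \<longrightarrow> N x \<le> K * b"
proof -
  define K where "K = (\<Sum>i\<in>UNIV. N (axis i 1)) + 1"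
  have K: "K > 0" unfolding K_def by (intro add_nonneg_pos sum_nonneg N_nonneg) auto
  have "N x \<le> K * b" if b: "\<And>i. \<bar>x $ i\<bar> \<le> b" for x b
  proof -
    have "b \<ge> 0" using b[of undefined] by linarith
    have "N x = N (\<Sum>i\<in>UNIV. (x $ i) *\<^sub>R axis i 1)" by (simp add: scalar_mult_eq_scaleR[symmetric] basis_expansion)
    also have "\<dots> \<le> (\<Sum>i\<in>UNIV. \<bar>x $ i\<bar> * N (axis i 1))" using N_sum_le by (simp add: N_scale[symmetric])
    also have "\<dots> \<le> (\<Sum>i\<in>UNIV. b * N (axis i 1))" using b by (intro sum_mono mult_right_mono N_nonneg)
    also have "\<dots> \<le> K * b" using \<open>b \<ge> 0\<close> unfolding K_def by (simp add: sum_distrib_left[symmetric] algebra_simps)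
    finally show ?thesis .
  qed
  thus ?thesis using K by blast
qed

lemma N_le_norm: "\<exists>K>0. \<forall>x. N x \<le> K * norm x"
  using N_le_coord component_le_norm_cart by metis

lemma continuous_on_N: "continuous_on UNIV N"
proof -
  obtain K where K: "K > 0" "\<And>x. N x \<le> K * norm x" using N_le_norm by blast
  have "K-lipschitz_on UNIV N"
  proof (rule lipschitz_onI)
    fix x y
    show "dist (N x) (N y) \<le> K * dist x y"
      using N_diff_le[of x y] K(2)[of "x - y"] by (simp add: dist_norm)
  qed (use K in simp)
  thus ?thesis by (rule lipschitz_on_continuous_on)
qed

text \<open>The constant is the minimum of \<open>N\<close> on the Euclidean unit sphere, positive
  by compactness.\<close>

lemma norm_le_N: "\<exists>m>0. \<forall>x. m * norm x \<le> N x"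
proof -
  let ?S = "sphere (0::real^'n) 1"
  have "?S \<noteq> {}" using vector_choose_size[of 1] by (auto simp: dist_norm)
  then obtain u where u: "u \<in> ?S" "\<And>y. y \<in> ?S \<Longrightarrow> N u \<le> N y"
    using continuous_attains_inf[of ?S N] continuous_on_subset[OF continuous_on_N] by auto
  have "u \<noteq> 0" using u by auto
  hence "N u > 0" using N_nonneg[of u] N_eq_0[of u] by linarith
  moreover have "N u * norm x \<le> N x" for x
  proof (cases "x = 0")
    case False
    have "N u \<le> N ((1 / norm x) *\<^sub>R x)" using False by (intro u(2)) auto
    also have "\<dots> = N x / norm x" by (simp add: N_scale)
    finally show ?thesis using False by (simp add: field_simps)
  qed simp
  ultimately show ?thesis by blast
qed

lemma coord_le_N: "\<exists>c>0. \<forall>x i. \<bar>x $ i\<bar> \<le> c * N x"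
proof -
  obtain m where m: "m > 0" "\<And>x. m * norm x \<le> N x" using norm_le_N by blast
  have "\<bar>x $ i\<bar> \<le> (1/m) * N x" for x i
    using component_le_norm_cart[of x i] m(2)[of x] m(1) by (simp add: field_simps) (smt (verit) mult_left_mono)
  thus ?thesis using m(1) by (intro exI[of _ "1/m"]) auto
qed

lemma open_nball: "open (nball N x \<rho>)"
proof -
  have "continuous_on UNIV (\<lambda>y. N (x - y))"
    by (rule continuous_on_compose2[OF continuous_on_N]) (auto intro!: continuous_intros)
  from open_Collect_less[OF this continuous_on_const[of _ \<rho>]] show ?thesis by (simp add: nball_def)
qed

lemma bounded_nball: "bounded (nball N 0 \<rho>)"
proof -
  obtain m where m: "m > 0" "\<And>x. m * norm x \<le> N x" using norm_le_N by blast
  have "norm x \<le> \<rho> / m" if "x \<in> nball N 0 \<rho>" for x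
    using that m(2)[of x] m(1) by (simp add: nball_def field_simps)
  thus ?thesis by (auto simp: bounded_iff)
qed

lemma lmeasurable_nball: "nball N 0 \<rho> \<in> lmeasurable"
  using bounded_nball open_nball lmeasurable_open by blast

lemma unit_ball_eq: "unit_ball N = nball N 0 1"
  by (simp add: unit_ball_def nball_def)

lemma measure_nball: 
  assumes "\<rho> > 0" shows "measure lebesgue (nball N 0 \<rho>) = \<rho> ^ CARD('n) * measure lebesgue (unit_ball N)"
proof -
  have "nball N 0 \<rho> = (\<lambda>x. \<rho> *\<^sub>R x + 0) ` unit_ball N"
  proof
    show "nball N 0 \<rho> \<subseteq> (\<lambda>x. \<rho> *\<^sub>R x + 0) ` unit_ball N"
    proof
      fix x assume "x \<in> nball N 0 \<rho>"
      hence "x = \<rho> *\<^sub>R ((1/\<rho>) *\<^sub>R x) + 0" "(1/\<rho>) *\<^sub>R x \<in> unit_ball N"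
        using assms by (auto simp: nball_def unit_ball_def N_scale)
      thus "x \<in> (\<lambda>x. \<rho> *\<^sub>R x + 0) ` unit_ball N" by blast
    qed
    show "(\<lambda>x. \<rho> *\<^sub>R x + 0) ` unit_ball N \<subseteq> nball N 0 \<rho>"
      using assms by (auto simp: nball_def unit_ball_def N_scale scaleR_minus_right[symmetric] simp del: scaleR_minus_right)
  qed
  thus ?thesis using measure_lebesgue_affine[of \<rho> "0::real^'n" "unit_ball N"] assms by simp
qed

definition vol :: real where "vol = measure lebesgue (nball N 0 (1/2))"

lemma vol_pos: "vol > 0"
proof -
  have "0 \<in> nball N 0 (1/2)" by (simp add: nball_def)
  hence "\<not> negligible (nball N 0 (1/2))" using open_nball open_not_negligible by blast
  thus ?thesis unfolding vol_def using lmeasurable_nball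
    by (metis measure_nonneg negligible_iff_measure order_le_less)
qed

lemma measure_nball_vol: "\<rho> > 0 \<Longrightarrow> measure lebesgue (nball N 0 \<rho>) = (2 * \<rho>) ^ CARD('n) * vol"
  unfolding vol_def by (simp add: measure_nball power_mult_distrib power_divide)

section \<open>Feasible functions and their maximal mass\<close>

lemma feasible_le_1: assumes "\<phi> \<in> feasible N" shows "\<phi> x \<le> 1"
proof -
  have "well_spread N {x}" by (simp add: well_spread_def)
  hence "(\<Sum>\<^sub>\<infinity>v\<in>{x}. ennreal (\<phi> v)) \<le> 1" using assms unfolding feasible_def by blast
  thus ?thesis by simp
qed

lemma feasible_sum_le:
  assumes "\<phi> \<in> feasible N" "finite S" "well_spread N S" shows "(\<Sum>v\<in>S. \<phi> v) \<le> 1"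
proof -
  have "(\<Sum>\<^sub>\<infinity>v\<in>S. ennreal (\<phi> v)) \<le> 1" using assms unfolding feasible_def by blast
  hence "(\<Sum>v\<in>S. ennreal (\<phi> v)) \<le> 1" using assms by simp
  also have "(\<Sum>v\<in>S. ennreal (\<phi> v)) = ennreal (\<Sum>v\<in>S. \<phi> v)"
    using assms by (intro sum_ennreal) (auto simp: feasible_def)
  finally show ?thesis by simp
qed

lemma feasibleI:
  assumes "\<And>x. 0 \<le> \<phi> x" "\<phi> \<in> borel_measurable lebesgue"
    and "\<And>S. finite S \<Longrightarrow> well_spread N S \<Longrightarrow> (\<Sum>v\<in>S. \<phi> v) \<le> 1"
  shows "\<phi> \<in> feasible N"
proof -
  have "(\<Sum>\<^sub>\<infinity>v\<in>S. ennreal (\<phi> v)) \<le> 1" if S: "well_spread N S" for S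
  proof (rule infsum_le_finite_sums[OF nonneg_summable_on_complete])
    fix F assume F: "finite F" "F \<subseteq> S"
    hence "well_spread N F" using S by (auto simp: well_spread_def)
    hence "(\<Sum>v\<in>F. \<phi> v) \<le> 1" using F assms by blast
    moreover have "(\<Sum>v\<in>F. ennreal (\<phi> v)) = ennreal (\<Sum>v\<in>F. \<phi> v)" using assms by (intro sum_ennreal) auto
    ultimately show "(\<Sum>v\<in>F. ennreal (\<phi> v)) \<le> 1" by simp
  qed simp
  thus ?thesis using assms by (simp add: feasible_def)
qed

definition cube :: "real \<Rightarrow> (real^'n) set" where "cube a = {x. \<forall>i. 0 < x $ i \<and> x $ i < a}"

text \<open>The constant \<open>c\<close> is the width of the margin between neighbouring copies of
  the cube. It is common to all \<phi>, \<open>C\<close> and \<open>a\<close>, so it becomes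
  negligible for large cubes.\<close>

definition gap :: "real \<Rightarrow> bool" where
  "gap c \<longleftrightarrow> (\<forall>\<phi> C a. \<phi> \<in> feasible N \<longrightarrow> finite C \<longrightarrow> 0 < a \<longrightarrow> well_spread N C \<longrightarrow> C \<subseteq> cube a \<longrightarrow>
       real (card C) * (LINT x|lebesgue. \<phi> x) \<le> (a + c) ^ CARD('n))"

text \<open>A packing of a cube, repeated periodically with a gap wide enough to separate
  neighbouring copies, is well-spread under every translation.\<close>

lemma gap_and_integrable: "\<exists>c>0. gap c \<and> (\<forall>\<phi>\<in>feasible N. integrable lebesgue \<phi>)"
proof -
  obtain c where c: "c > 0" "\<And>x i. \<bar>x $ i\<bar> \<le> c * N x" using coord_le_N by blast
  have main: "of_nat (card C) * (\<integral>\<^sup>+x. ennreal (\<phi> x) \<partial>lebesgue) \<le> ennreal ((a + c) ^ CARD('n))"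
    if phi: "\<phi> \<in> feasible N" and C: "finite C" "0 < a" "well_spread N C" "C \<subseteq> {x. \<forall>i. 0 < x $ i \<and> x $ i < a}" for \<phi> C a
  proof (rule periodization_bound)
    show "(\<lambda>x. ennreal (\<phi> x)) \<in> borel_measurable lebesgue" using phi by (auto simp: feasible_def)
    fix x :: "real^'n" and Z :: "(int^'n) set" assume Z: "finite Z"
    let ?L = "a + c"
    have sep: "N (lattice_point ?L z + v - (lattice_point ?L w + u)) > 1" if h: "v \<in> C" "u \<in> C" "z \<noteq> w" for z w :: "int^'n" and v u
    proof -
      obtain i where i: "z $ i \<noteq> w $ i" using h(3) by (auto simp: vec_eq_iff)
      have "\<bar>real_of_int (z $ i) - of_int (w $ i)\<bar> \<ge> 1" using i by linarith
      hence "?L * 1 \<le> ?L * \<bar>real_of_int (z $ i) - of_int (w $ i)\<bar>" using c C by (intro mult_left_mono) auto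
      also have "\<dots> = \<bar>?L * of_int (z $ i) - ?L * of_int (w $ i)\<bar>"
        using c C by (simp add: abs_mult right_diff_distrib[symmetric])
      finally have "?L \<le> \<bar>?L * of_int (z $ i) - ?L * of_int (w $ i)\<bar>" by simp
      moreover have "\<bar>v $ i - u $ i\<bar> < a"
      proof -
        have "0 < v $ i" "v $ i < a" "0 < u $ i" "u $ i < a" using h C(4) by auto
        thus ?thesis by linarith
      qed
      ultimately have "c < \<bar>(lattice_point ?L z + v - (lattice_point ?L w + u)) $ i\<bar>" by (simp add: lattice_point_def)
      also have "\<dots> \<le> c * N (lattice_point ?L z + v - (lattice_point ?L w + u))" by (rule c(2))
      finally show ?thesis using c(1) by simp
    qed
    let ?g = "\<lambda>(z, v). x + lattice_point ?L z + v"
    have dist: "N (?g p - ?g q) > 1" if "p \<in> Z \<times> C" "q \<in> Z \<times> C" "p \<noteq> q" for p q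
    proof (cases "fst p = fst q")
      case True
      hence "snd p \<noteq> snd q" using that by (auto simp: prod_eq_iff)
      thus ?thesis using C(3) that True by (auto simp: well_spread_def case_prod_beta)
    next
      case False
      thus ?thesis using sep[of "snd p" "snd q" "fst p" "fst q"] that by (auto simp: case_prod_beta algebra_simps)
    qed
    have inj: "inj_on ?g (Z \<times> C)"
    proof (rule inj_onI, rule ccontr)
      fix p q assume "p \<in> Z \<times> C" "q \<in> Z \<times> C" "?g p = ?g q" "p \<noteq> q"
      thus False using dist[of p q] by simp
    qed
    have "well_spread N (?g ` (Z \<times> C))" unfolding well_spread_def
    proof (intro ballI impI)
      fix v w assume "v \<in> ?g ` (Z \<times> C)" "w \<in> ?g ` (Z \<times> C)" "v \<noteq> w"
      then obtain p q where "p \<in> Z \<times> C" "q \<in> Z \<times> C" "v = ?g p" "w = ?g q" "p \<noteq> q" by (elim imageE) blast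
      thus "1 < N (v - w)" using dist by blast
    qed
    hence "(\<Sum>v\<in>?g ` (Z \<times> C). \<phi> v) \<le> 1" using Z C phi by (intro feasible_sum_le) auto
    hence "(\<Sum>z\<in>Z. \<Sum>v\<in>C. \<phi> (x + lattice_point ?L z + v)) \<le> 1"
      unfolding sum.reindex[OF inj] by (simp add: sum.cartesian_product case_prod_beta comp_def)
    moreover have "(\<Sum>z\<in>Z. \<Sum>v\<in>C. ennreal (\<phi> (x + lattice_point ?L z + v))) = ennreal (\<Sum>z\<in>Z. \<Sum>v\<in>C. \<phi> (x + lattice_point ?L z + v))"
      using phi by (simp add: sum_ennreal feasible_def sum_nonneg)
    ultimately show "(\<Sum>z\<in>Z. \<Sum>v\<in>C. ennreal (\<phi> (x + lattice_point ?L z + v))) \<le> 1" by simp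
  qed (use c C in auto)
  have int: "integrable lebesgue \<phi>" if phi: "\<phi> \<in> feasible N" for \<phi>
  proof -
    \<comment> \<open>A single point in the unit cube already yields a finite bound on the
      mass.\<close>
    have "of_nat (card {(\<chi> i. 1 / 2) :: real^'n}) * (\<integral>\<^sup>+x. ennreal (\<phi> x) \<partial>lebesgue) \<le> ennreal ((1 + c) ^ CARD('n))"
      by (rule main[OF phi]) (auto simp: well_spread_def)
    hence "(\<integral>\<^sup>+x. ennreal (\<phi> x) \<partial>lebesgue) < \<infinity>" using le_less_trans[OF _ ennreal_less_top] by simp
    thus ?thesis using phi by (intro integrableI_nonneg) (auto simp: feasible_def)
  qed
  have bound: "real (card C) * (LINT x|lebesgue. \<phi> x) \<le> (a + c) ^ CARD('n)"
    if phi: "\<phi> \<in> feasible N" and C: "finite C" "0 < a" "well_spread N C" "C \<subseteq> {x. \<forall>i. 0 < x $ i \<and> x $ i < a}" for \<phi> C a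
  proof -
    have "(\<integral>\<^sup>+x. ennreal (\<phi> x) \<partial>lebesgue) = ennreal (LINT x|lebesgue. \<phi> x)"
      using phi int[OF phi] by (intro nn_integral_eq_integral) (auto simp: feasible_def)
    hence "ennreal (real (card C) * (LINT x|lebesgue. \<phi> x)) \<le> ennreal ((a + c) ^ CARD('n))"
      using main[OF phi C] by (simp add: ennreal_mult' ennreal_of_nat_eq_real_of_nat)
    thus ?thesis using c C by (subst (asm) ennreal_le_iff) auto
  qed
  hence "gap c" unfolding gap_def cube_def by blast
  thus ?thesis using c(1) int by blast
qed

lemma feasible_integrable: "\<phi> \<in> feasible N \<Longrightarrow> integrable lebesgue \<phi>"
  using gap_and_integrable by blast

lemma gap_exists: "\<exists>c>0. gap c"
  using gap_and_integrable by blast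

lemma bdd_above_feasible: "bdd_above ((\<lambda>\<phi>. LINT x|lebesgue. \<phi> x) ` feasible N)"
proof -
  obtain c where c: "gap c" using gap_exists by blast
  have "(LINT x|lebesgue. \<phi> x) \<le> (1 + c) ^ CARD('n)" if "\<phi> \<in> feasible N" for \<phi>
    using c[unfolded gap_def, rule_format, OF that, of "{\<chi> i. 1 / 2}" 1] by (simp add: well_spread_def cube_def)
  thus ?thesis by (auto simp: bdd_above_def)
qed

definition max_mass :: real where "max_mass = (SUP \<phi>\<in>feasible N. LINT x|lebesgue. \<phi> x)"

lemma integral_le_max_mass: "\<phi> \<in> feasible N \<Longrightarrow> (LINT x|lebesgue. \<phi> x) \<le> max_mass"
  unfolding max_mass_def by (rule cSUP_upper[OF _ bdd_above_feasible])

lemma card_le_1_if_close: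
  assumes "well_spread N S" "\<And>v w. v \<in> S \<Longrightarrow> w \<in> S \<Longrightarrow> N (v - w) \<le> 1" "finite S"
  shows "card S \<le> 1"
proof -
  have "v = w" if "v \<in> S" "w \<in> S" for v w
    using that assms(1) assms(2)[of v w] unfolding well_spread_def by (meson leD)
  thus ?thesis using assms(3) by (simp add: card_le_Suc0_iff_eq)
qed

lemma indicator_feasible: "indicator (nball N 0 (1/2)) \<in> feasible N"
proof (rule feasibleI)
  fix S assume S: "finite S" "well_spread N S"
  have "card (S \<inter> nball N 0 (1/2)) \<le> 1"
  proof (rule card_le_1_if_close)
    show "well_spread N (S \<inter> nball N 0 (1/2))" using S by (auto simp: well_spread_def)
    fix v w assume "v \<in> S \<inter> nball N 0 (1/2)" "w \<in> S \<inter> nball N 0 (1/2)"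
    thus "N (v - w) \<le> 1" using N_triangle[of v "- w"] by (auto simp: nball_def)
  qed (use S in auto)
  thus "(\<Sum>v\<in>S. indicator (nball N 0 (1/2)) v) \<le> (1::real)" using S by (simp add: sum.If_cases indicator_def if_distrib Int_def)
qed (use lmeasurable_nball in \<open>auto intro!: borel_measurable_indicator fmeasurableD\<close>)

lemma integral_indicator_nball: "(LINT x|lebesgue. indicator (nball N 0 (1/2)) x) = vol"
  unfolding vol_def using lmeasurable_nball by simp

lemma vol_le_max_mass: "vol \<le> max_mass"
  using integral_le_max_mass[OF indicator_feasible] integral_indicator_nball by simp

section \<open>Packings of cubes and the density\<close>

definition packs :: "real \<Rightarrow> (real^'n) set set" where
  "packs K = {C. finite C \<and> C \<subseteq> cube K \<and> (\<forall>v\<in>C. \<forall>w\<in>C. v \<noteq> w \<longrightarrow> 2 \<le> N (v - w))}"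

text \<open>If the centres are closer than 2, their midpoint lies in both open balls; otherwise the
  triangle inequality excludes a common point.\<close>

lemma disjoint_translates_iff:
  "((\<lambda>y. v + y) ` unit_ball N) \<inter> ((\<lambda>y. w + y) ` unit_ball N) = {} \<longleftrightarrow> 2 \<le> N (v - w)"
proof
  assume *: "((\<lambda>y. v + y) ` unit_ball N) \<inter> ((\<lambda>y. w + y) ` unit_ball N) = {}"
  show "2 \<le> N (v - w)"
  proof (rule ccontr)
    assume "\<not> 2 \<le> N (v - w)"
    hence "N ((1/2) *\<^sub>R (v - w)) < 1" by (simp add: N_scale)
    moreover have "N ((1/2) *\<^sub>R (w - v)) = N ((1/2) *\<^sub>R (v - w))" by (simp add: N_scale N_minus_commute)
    ultimately have "v + (1/2) *\<^sub>R (w - v) \<in> (\<lambda>y. v + y) ` unit_ball N" "w + (1/2) *\<^sub>R (v - w) \<in> (\<lambda>y. w + y) ` unit_ball N"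
      by (auto simp: unit_ball_def)
    moreover have "v + (1/2) *\<^sub>R (w - v) = w + (1/2) *\<^sub>R (v - w)"
      by (simp add: vec_eq_iff field_simps)
    ultimately show False using * by auto
  qed
next
  assume *: "2 \<le> N (v - w)"
  have False if "x \<in> unit_ball N" "y \<in> unit_ball N" "v + x = w + y" for x y
  proof -
    have "v - w = y + - x" using that(3) by (simp add: algebra_simps)
    hence "N (v - w) \<le> N y + N x" using N_triangle[of y "- x"] by simp
    thus False using that * by (simp add: unit_ball_def)
  qed
  thus "((\<lambda>y. v + y) ` unit_ball N) \<inter> ((\<lambda>y. w + y) ` unit_ball N) = {}" by blast
qed

lemma pack_count_eq: "pack_count N K = Sup (card ` packs K)"
  unfolding pack_count_def packs_def cube_def disjoint_translates_iff by (rule arg_cong[where f=Sup]) auto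

definition pack_gap :: "real \<Rightarrow> bool" where
  "pack_gap c \<longleftrightarrow> (\<forall>\<phi> K C. \<phi> \<in> feasible N \<longrightarrow> K > 0 \<longrightarrow> C \<in> packs K \<longrightarrow>
       real (card C) * (LINT x|lebesgue. \<phi> x) \<le> (K / 2 + c) ^ CARD('n))"

text \<open>Halving a packing gives distances at least 1, while well-spread sets need distances
  above 1. Shrinking by a factor slightly above 1/2 repairs this.\<close>

lemma pack_gap_exists: "\<exists>c>0. pack_gap c"
proof -
  obtain c where c0: "c > 0" and c: "gap c" using gap_exists by blast
  have bound: "real (card C) * (LINT x|lebesgue. \<phi> x) \<le> (K / 2 + (c + 1/2)) ^ CARD('n)"
    if phi: "\<phi> \<in> feasible N" and K: "K > 0" and C: "C \<in> packs K" for \<phi> K C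
  proof -
    \<comment> \<open>The excess over 1/2 is inversely proportional to \<open>K\<close>, so the cube
      grows only by 1/2, which is added to the constant \<open>c\<close>.\<close>
    define r where "r = (1 + 1 / K) / 2"
    have r: "r > 1/2" "r * K = K / 2 + 1/2" using K by (auto simp: r_def field_simps)
    have inj: "inj_on (\<lambda>x. r *\<^sub>R x) C" using r by (auto simp: inj_on_def)
    have "real (card ((\<lambda>x. r *\<^sub>R x) ` C)) * (LINT x|lebesgue. \<phi> x) \<le> (r * K + c) ^ CARD('n)"
    proof (rule c[unfolded gap_def, rule_format, OF phi])
      show "well_spread N ((\<lambda>x. r *\<^sub>R x) ` C)" unfolding well_spread_def
      proof (intro ballI impI)
        fix v w assume "v \<in> (\<lambda>x. r *\<^sub>R x) ` C" "w \<in> (\<lambda>x. r *\<^sub>R x) ` C" "v \<noteq> w"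
        then obtain x y where xy: "x \<in> C" "y \<in> C" "v = r *\<^sub>R x" "w = r *\<^sub>R y" "x \<noteq> y" by blast
        hence "2 \<le> N (x - y)" using C by (auto simp: packs_def)
        hence "r * 2 \<le> r * N (x - y)" using r by (intro mult_left_mono) auto
        also have "\<dots> = N (v - w)" using r by (simp add: xy scaleR_right_diff_distrib[symmetric] N_scale)
        finally show "1 < N (v - w)" using r by simp
      qed
      show "(\<lambda>x. r *\<^sub>R x) ` C \<subseteq> cube (r * K)"
      proof (intro subsetI)
        fix y assume "y \<in> (\<lambda>x. r *\<^sub>R x) ` C"
        then obtain x where x: "x \<in> cube K" "y = r *\<^sub>R x" using C by (auto simp: packs_def)
        have "r * (x $ i) < r * K" for i using x r by (intro mult_strict_left_mono) (auto simp: cube_def)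
        thus "y \<in> cube (r * K)" using x r by (auto simp: cube_def)
      qed
    qed (use C K r in \<open>auto simp: packs_def\<close>)
    thus ?thesis using r inj by (simp add: card_image ac_simps)
  qed
  hence "pack_gap (c + 1/2)" unfolding pack_gap_def by blast
  thus ?thesis using c0 by (intro exI[of _ "c + 1/2"]) auto
qed

text \<open>Testing with the indicator of the ball bounds the size of a packing. This makes the
  \<open>Sup\<close> in \<open>pack_count\<close> an attained maximum.\<close>

lemma finite_card_packs: assumes "K > 0" shows "finite (card ` packs K)"
proof -
  obtain c where c: "pack_gap c" using pack_gap_exists by blast
  have "real (card C) * vol \<le> (K / 2 + c) ^ CARD('n)" if "C \<in> packs K" for C
    using c[unfolded pack_gap_def, rule_format, OF indicator_feasible assms that] integral_indicator_nball by simp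
  hence "real (card C) \<le> (K / 2 + c) ^ CARD('n) / vol" if "C \<in> packs K" for C
    using that vol_pos by (simp add: pos_le_divide_eq)
  hence "card C \<le> nat \<lfloor>(K / 2 + c) ^ CARD('n) / vol\<rfloor>" if "C \<in> packs K" for C
    using that by (simp add: le_nat_floor)
  hence "card ` packs K \<subseteq> {..nat \<lfloor>(K / 2 + c) ^ CARD('n) / vol\<rfloor>}" by auto
  thus ?thesis by (rule finite_subset) simp
qed

lemma card_le_pack_count: "K > 0 \<Longrightarrow> C \<in> packs K \<Longrightarrow> card C \<le> pack_count N K"
  unfolding pack_count_eq by (intro cSup_upper) (auto intro: bdd_above_finite finite_card_packs)

lemma pack_count_attained: assumes "K > 0" shows "\<exists>C\<in>packs K. card C = pack_count N K"
proof -
  have "{} \<in> packs K" by (simp add: packs_def)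
  hence "Sup (card ` packs K) \<in> card ` packs K"
    using finite_card_packs[OF assms] by (metis cSup_eq_Max Max_in empty_is_image empty_iff)
  thus ?thesis unfolding pack_count_eq by auto
qed

lemma pack_count_pos: assumes "K > 0" shows "pack_count N K > 0"
proof -
  have "{\<chi> i. K / 2} \<in> packs K" using assms by (simp add: packs_def cube_def)
  from card_le_pack_count[OF assms this] show ?thesis by simp
qed

lemma cube_eq_box: "cube a = box 0 (\<chi> i. a)"
  by (auto simp: cube_def mem_box_cart)

lemma measure_cube: "a > 0 \<Longrightarrow> measure lebesgue (cube a) = a ^ CARD('n)"
  using content_cbox_cart[of "0::real^'n" "\<chi> i. a"]
  by (simp add: cube_eq_box measure_lborel_box_eq measure_lborel_cbox_eq interval_ne_empty_cart less_imp_le)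

text \<open>Doubling the part of a well-spread set that lies in the cube produces a packing of the
  cube of twice the side, so its cardinality is at most the normalising constant.\<close>

lemma cube_indicator_feasible:
  assumes "a > 0" shows "(\<lambda>x. indicator (cube a) x / pack_count N (2 * a)) \<in> feasible N"
proof (rule feasibleI)
  show "(\<lambda>x. indicator (cube a) x / real (pack_count N (2 * a))) \<in> borel_measurable lebesgue"
    unfolding cube_eq_box by (intro borel_measurable_divide borel_measurable_indicator) auto
  fix S assume S: "finite S" "well_spread N S"
  let ?T = "(\<lambda>x. 2 *\<^sub>R x) ` (S \<inter> cube a)"
  have "?T \<in> packs (2 * a)" unfolding packs_def
  proof (intro CollectI conjI ballI impI)
    fix v w assume "v \<in> ?T" "w \<in> ?T" "v \<noteq> w"
    then obtain x y where xy: "x \<in> S" "y \<in> S" "v = 2 *\<^sub>R x" "w = 2 *\<^sub>R y" "x \<noteq> y" by blast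
    have "N (x - y) > 1" using S xy by (auto simp: well_spread_def)
    moreover have "N (v - w) = 2 * N (x - y)" by (simp add: xy scaleR_right_diff_distrib[symmetric] N_scale)
    ultimately show "2 \<le> N (v - w)" by simp
  qed (use S in \<open>auto simp: cube_def\<close>)
  hence "card ?T \<le> pack_count N (2 * a)" using assms by (intro card_le_pack_count) auto
  moreover have "card ?T = card (S \<inter> cube a)" by (intro card_image) (auto simp: inj_on_def)
  ultimately have "real (card (S \<inter> cube a)) \<le> pack_count N (2 * a)" by simp
  moreover have "(\<Sum>v\<in>S. indicator (cube a) v) = real (card (S \<inter> cube a))"
    using S by (simp add: sum.If_cases indicator_def if_distrib Int_def)
  ultimately show "(\<Sum>v\<in>S. indicator (cube a) v / real (pack_count N (2 * a))) \<le> 1"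
    using pack_count_pos[of "2 * a"] assms by (simp add: sum_divide_distrib[symmetric] divide_le_eq)
qed simp

text \<open>The product of \<open>pack_count N K\<close> and \<open>max_mass\<close> lies between
  (K/2)^d and (K/2 + c)^d: packings tested against all feasible functions give the upper bound, cube
  indicators the lower one. This shows that the limit exists and finds its value.\<close>

lemma packing_density_eq: "packing_density N = vol / max_mass"
proof -
  let ?d = "CARD('n)"
  have M: "max_mass > 0" using vol_pos vol_le_max_mass by linarith
  obtain c where c: "c > 0" "pack_gap c" using pack_gap_exists by blast
  have up: "real (pack_count N K) * max_mass \<le> (K / 2 + c) ^ ?d" if K: "K > 0" for K
  proof -
    obtain C where C: "C \<in> packs K" "card C = pack_count N K" using pack_count_attained[OF K] by blast
    have pc: "real (pack_count N K) > 0" using pack_count_pos[OF K] by simp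
    have "max_mass \<le> (K / 2 + c) ^ ?d / pack_count N K" unfolding max_mass_def
    proof (rule cSUP_least)
      fix \<phi> assume "\<phi> \<in> feasible N"
      thus "(LINT x|lebesgue. \<phi> x) \<le> (K / 2 + c) ^ ?d / pack_count N K"
        using c(2)[unfolded pack_gap_def, rule_format, OF _ K C(1)] C(2) pc by (simp add: pos_le_divide_eq mult.commute)
    qed (use indicator_feasible in blast)
    thus ?thesis using pc by (simp add: pos_le_divide_eq mult.commute)
  qed
  have lo: "(K / 2) ^ ?d \<le> real (pack_count N K) * max_mass" if K: "K > 0" for K
  proof -
    have pc: "real (pack_count N K) > 0" using pack_count_pos[OF K] by simp
    have "cube (K/2) \<in> lmeasurable" unfolding cube_eq_box by simp
    hence "(LINT x|lebesgue. indicator (cube (K/2)) x / real (pack_count N K)) = (K/2) ^ ?d / pack_count N K"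
      using measure_cube[of "K/2"] K by simp
    moreover have "(LINT x|lebesgue. indicator (cube (K/2)) x / real (pack_count N K)) \<le> max_mass"
      using cube_indicator_feasible[of "K/2"] K by (intro integral_le_max_mass) auto
    ultimately show ?thesis using pc by (simp add: pos_divide_le_eq mult.commute)
  qed
  let ?f = "\<lambda>K. real (pack_count N K) * measure lebesgue (unit_ball N) / K ^ ?d"
  have vu: "measure lebesgue (unit_ball N) = 2 ^ ?d * vol"
    using measure_nball_vol[of 1] by (simp add: unit_ball_eq)
  have "(?f \<longlongrightarrow> vol / max_mass) at_top"
  proof (rule tendsto_sandwich)
    show "((\<lambda>K. vol / max_mass) \<longlongrightarrow> vol / max_mass) at_top" by simp
    have "((\<lambda>K::real. vol / max_mass * (1 + 2 * c / K) ^ ?d) \<longlongrightarrow> vol / max_mass * (1 + 0) ^ ?d) at_top"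
      by (intro tendsto_intros tendsto_divide_0[OF tendsto_const] filterlim_at_top_imp_at_infinity filterlim_ident)
    thus "((\<lambda>K::real. vol / max_mass * (1 + 2 * c / K) ^ ?d) \<longlongrightarrow> vol / max_mass) at_top" by simp
    show "\<forall>\<^sub>F K in at_top. vol / max_mass \<le> ?f K"
      using eventually_gt_at_top[of 0]
    proof eventually_elim
      case (elim K)
      have "(K / 2) ^ ?d * (2 ^ ?d * vol) \<le> real (pack_count N K) * max_mass * (2 ^ ?d * vol)"
        using lo[OF elim] vol_pos by (intro mult_right_mono) auto
      hence "K ^ ?d * vol \<le> real (pack_count N K) * (2 ^ ?d * vol) * max_mass"
        by (simp add: power_divide mult.assoc mult.left_commute mult.commute)
      thus ?case using elim M unfolding vu by (simp add: field_simps)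
    qed
    show "\<forall>\<^sub>F K in at_top. ?f K \<le> vol / max_mass * (1 + 2 * c / K) ^ ?d"
      using eventually_gt_at_top[of 0]
    proof eventually_elim
      case (elim K)
      have "(K / 2 + c) = (K / 2) * (1 + 2 * c / K)" using elim by (simp add: field_simps)
      hence e: "(K / 2 + c) ^ ?d * 2 ^ ?d = K ^ ?d * (1 + 2 * c / K) ^ ?d"
        by (simp only: power_mult_distrib power_divide) simp
      have "real (pack_count N K) * max_mass * (2 ^ ?d * vol) \<le> (K / 2 + c) ^ ?d * (2 ^ ?d * vol)"
        using up[OF elim] vol_pos by (intro mult_right_mono) auto
      also have "\<dots> = K ^ ?d * (1 + 2 * c / K) ^ ?d * vol" using e by (simp add: mult.assoc[symmetric])
      finally have "real (pack_count N K) * max_mass * (2 ^ ?d * vol) \<le> K ^ ?d * (1 + 2 * c / K) ^ ?d * vol" .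
      hence "real (pack_count N K) * (2 ^ ?d * vol) / K ^ ?d * max_mass \<le> (1 + 2 * c / K) ^ ?d * vol"
        using elim by (simp add: pos_divide_le_eq mult.assoc mult.left_commute mult.commute)
      hence "real (pack_count N K) * (2 ^ ?d * vol) / K ^ ?d \<le> (1 + 2 * c / K) ^ ?d * vol / max_mass"
        using M by (subst pos_le_divide_eq) auto
      thus ?case unfolding vu by (simp add: mult.commute)
    qed
  qed
  thus ?thesis unfolding packing_density_def by (intro tendsto_Lim) auto
qed

end

section \<open>Small values of the parameter\<close>

lemma sigma_finite_lebesgue: "sigma_finite_measure (lebesgue :: 'a::euclidean_space measure)"
proof
  let ?A = "range (\<lambda>n. ball (0::'a) (real n))"
  have "\<Union>?A = space lebesgue" using reals_Archimedean2 by auto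
  moreover have "\<forall>a\<in>?A. emeasure lebesgue a \<noteq> \<infinity>"
    using fmeasurableD2[OF lmeasurable_ball] by auto
  ultimately show "\<exists>A. countable A \<and> A \<subseteq> sets lebesgue \<and> \<Union>A = space lebesgue \<and> (\<forall>a\<in>A. emeasure (lebesgue :: 'a measure) a \<noteq> \<infinity>)"
    by (intro exI[of _ ?A]) auto
qed

lemma sets_level: "\<phi> \<in> borel_measurable lebesgue \<Longrightarrow> {x. r < \<phi> x} \<in> sets lebesgue" for r :: real
  using measurable_sets[of \<phi> lebesgue borel "{r<..}"] by (simp add: vimage_def)

lemma lmeasurable_level:
  fixes r :: real
  assumes "integrable lebesgue \<phi>" "\<And>x. 0 \<le> \<phi> x" "r > 0" shows "{x. r < \<phi> x} \<in> lmeasurable"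
proof -
  have s: "{x. r < \<phi> x} \<in> sets lebesgue" by (rule sets_level) (use assms in simp)
  have s2: "{x\<in>space lebesgue. r \<le> \<phi> x} \<in> sets lebesgue"
    using borel_measurable_integrable[OF assms(1)] by measurable
  have "emeasure lebesgue {x. r < \<phi> x} \<le> emeasure lebesgue {x\<in>space lebesgue. r \<le> \<phi> x}"
    using s2 by (intro emeasure_mono) auto
  also have "\<dots> \<le> ennreal (1 / r * (LINT x|lebesgue. \<phi> x))"
    using assms by (intro integral_Markov_inequality) auto
  also have "\<dots> < \<infinity>" by simp
  finally show ?thesis using s by (simp add: fmeasurable_def)
qed

lemma layer_cake:
  fixes \<phi> :: "real^'n \<Rightarrow> real"
  assumes [measurable]: "\<phi> \<in> borel_measurable lebesgue" "k \<in> borel_measurable lborel"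
  shows "(\<integral>\<^sup>+x. (\<integral>\<^sup>+u. k u * indicator {0<..<\<phi> x} u \<partial>lborel) \<partial>lebesgue)
     = (\<integral>\<^sup>+u. k u * emeasure lebesgue {x. u < \<phi> x} * indicator {0<..} u \<partial>lborel)"
proof -
  interpret pair_sigma_finite "lebesgue :: (real^'n) measure" "lborel :: real measure"
    using sigma_finite_lebesgue sigma_finite_lborel by (simp add: pair_sigma_finite_def)
  have [measurable]: "(\<lambda>(x, u). k u * indicator {0<..<\<phi> x} u) \<in> borel_measurable (lebesgue \<Otimes>\<^sub>M lborel)"
    unfolding greaterThanLessThan_iff indicator_def by measurable
  have "(\<integral>\<^sup>+x. (\<integral>\<^sup>+u. k u * indicator {0<..<\<phi> x} u \<partial>lborel) \<partial>lebesgue)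
      = (\<integral>\<^sup>+u. (\<integral>\<^sup>+x. k u * indicator {0<..<\<phi> x} u \<partial>lebesgue) \<partial>lborel)"
    by (rule Fubini'[symmetric]) measurable
  also have "\<dots> = (\<integral>\<^sup>+u. k u * emeasure lebesgue {x. u < \<phi> x} * indicator {0<..} u \<partial>lborel)"
  proof (rule nn_integral_cong)
    fix u :: real
    have "(\<integral>\<^sup>+x. k u * indicator {0<..<\<phi> x} u \<partial>lebesgue) = (\<integral>\<^sup>+x. (k u * indicator {0<..} u) * indicator {x. u < \<phi> x} x \<partial>lebesgue)"
      by (intro nn_integral_cong) (auto simp: indicator_def)
    also have "\<dots> = (k u * indicator {0<..} u) * emeasure lebesgue {x. u < \<phi> x}"
      by (rule nn_integral_cmult_indicator) (rule sets_level, simp)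
    finally show "(\<integral>\<^sup>+x. k u * indicator {0<..<\<phi> x} u \<partial>lebesgue) = k u * emeasure lebesgue {x. u < \<phi> x} * indicator {0<..} u"
      by (simp add: ac_simps)
  qed
  finally show ?thesis .
qed

lemma nn_integral_exp_Ioo:
  assumes "0 \<le> y" "0 \<le> s"
  shows "(\<integral>\<^sup>+u. ennreal (s * exp (s * u)) * indicator {0<..<y} u \<partial>lborel) = ennreal (exp (s * y) - 1)"
proof -
  have "(\<integral>\<^sup>+u. ennreal (s * exp (s * u)) * indicator {0<..<y} u \<partial>lborel) = (\<integral>\<^sup>+u. ennreal (s * exp (s * u)) * indicator {0..y} u \<partial>lborel)"
  proof (rule nn_integral_cong_AE)
    have "AE u in lborel. u \<noteq> 0 \<and> u \<noteq> y" using AE_lborel_singleton by (auto simp: AE_conj_iff)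
    thus "AE u in lborel. ennreal (s * exp (s * u)) * indicator {0<..<y} u = ennreal (s * exp (s * u)) * indicator {0..y} u"
      by eventually_elim (auto simp: indicator_def)
  qed
  also have "\<dots> = ennreal (exp (s * y) - exp (s * 0))"
    using assms by (intro nn_integral_FTC_Icc) (auto intro!: derivative_eq_intros)
  finally show ?thesis by simp
qed

text \<open>In the application \<open>a u\<close> is the volume of {\<phi> > u} and \<open>p\<close>
  is the supremum of \<phi>. The levels u and 1 - u are paired for u between 1/2 and p, where the
  deficit at the heavy level u pays for the surplus at the light one. For u between p and 1 the
  heavy level is empty; \<open>low\<close> bounds the total of the light levels there by M (1 - p),
  which the gap e^s - e^(s p) covers.\<close>

lemma exp_weighted_layer_bound:
  fixes a :: "real \<Rightarrow> real" and v C M s p :: real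
  assumes [measurable]: "a \<in> borel_measurable borel"
    and v: "v > 0" and C: "C \<ge> 1" and s: "s > 0" "1 + C \<le> exp (s / 4)" and M: "0 \<le> M" "M \<le> v * exp (s / 2)"
    and p: "3/4 \<le> p" "p \<le> 1" and a0: "\<And>u. 0 \<le> a u"
    and anti: "\<And>u w. 0 < u \<Longrightarrow> u \<le> w \<Longrightarrow> a w \<le> a u"
    and av: "\<And>u. 1/2 \<le> u \<Longrightarrow> u < p \<Longrightarrow> a u \<le> v"
    and trade: "\<And>u. 1/2 \<le> u \<Longrightarrow> u < p \<Longrightarrow> a (1 - u) \<le> v + C * (v - a u)"
    and top: "\<And>u. p < u \<Longrightarrow> a u = 0"
    and low: "(\<integral>\<^sup>+u. ennreal (a u) * indicator {0<..<1 - p} u \<partial>lborel) \<le> ennreal (M * (1 - p))"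
  shows "(\<integral>\<^sup>+u. ennreal (s * exp (s * u) * a u) * indicator {0<..<1} u \<partial>lborel) \<le> ennreal (v * (exp s - 1))"
proof -
  \<comment> \<open>\<open>c\<close> solves e^(s u) = C e^(s (1 - u)): there one unit of deficit
    saves as much as the surplus it permits can cost. \<open>w\<close> is the net saving per unit of
    deficit.\<close>
  define c where "c = 1/2 + ln C / (2 * s)"
  define w where "w u = exp (s * u) - C * exp (s * (1 - u))" for u
  have lnC: "0 \<le> ln C" "ln C < s / 4"
  proof -
    show "0 \<le> ln C" using C by simp
    have "C < exp (s / 4)" using s C by linarith
    hence "ln C < ln (exp (s / 4))" using C by (subst ln_less_cancel_iff) auto
    thus "ln C < s / 4" by simp
  qed
  have c: "1/2 \<le> c" "c < p"
  proof -
    show "1/2 \<le> c" using lnC s by (simp add: c_def)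
    have "ln C / (2 * s) < 1/4" using lnC s by (simp add: field_simps)
    thus "c < p" using p by (simp add: c_def)
  qed
  have sc: "s * c = s / 2 + ln C / 2" "s * (1 - c) = s / 2 - ln C / 2" using s by (auto simp: c_def field_simps)
  have wc: "w c = 0"
  proof -
    have "C * exp (s * (1 - c)) = exp (ln C) * exp (s / 2 - ln C / 2)" using C by (simp add: sc)
    also have "\<dots> = exp (s * c)" unfolding exp_add[symmetric] sc by simp
    finally show ?thesis by (simp add: w_def)
  qed
  have w_mono: "w u1 \<le> w u2" if "u1 \<le> u2" for u1 u2
    unfolding w_def using that s C by (intro diff_mono mult_left_mono) auto
  define x where "x = v - a c"
  have x: "0 \<le> x" "x \<le> v" using av[OF c] a0[of c] by (auto simp: x_def)
  \<comment> \<open>Chebyshev: the deficit $v - a$ increases with $u$, and $c$ is the zero of the increasing weight $w$.\<close>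
  have cheb: "x * w u \<le> (v - a u) * w u" if u: "1/2 \<le> u" "u < p" for u
  proof (cases "u \<le> c")
    case True
    hence "w u \<le> 0" "v - a u \<le> x" using w_mono[of u c] wc anti[of u c] u by (auto simp: x_def)
    thus ?thesis by (intro mult_right_mono_neg) auto
  next
    case False
    hence "0 \<le> w u" "x \<le> v - a u" using w_mono[of c u] wc anti[of c u] c u by (auto simp: x_def)
    thus ?thesis by (intro mult_right_mono) auto
  qed
  \<comment> \<open>The unknown deficit is replaced by its value \<open>x\<close> at
    \<open>c\<close>, which leaves a majorant of the paired integrand with an explicit
    antiderivative.\<close>
  define h where "h u = s * (v * (exp (s * u) + exp (s * (1 - u))) - x * w u)" for u
  define k where "k u = s * exp (s * u) * a u" for u
  have k0: "0 \<le> k u" for u using s a0 by (simp add: k_def)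
  have h0: "0 \<le> h u" for u
  proof -
    have "x * exp (s * u) \<le> v * exp (s * u)" using x by (intro mult_right_mono) auto
    moreover have "0 \<le> v * exp (s * (1 - u))" "0 \<le> x * (C * exp (s * (1 - u)))" using x C v by auto
    moreover have "v * (exp (s * u) + exp (s * (1 - u))) - x * w u
        = (v * exp (s * u) - x * exp (s * u)) + v * exp (s * (1 - u)) + x * (C * exp (s * (1 - u)))"
      by (simp add: w_def algebra_simps)
    ultimately have "0 \<le> v * (exp (s * u) + exp (s * (1 - u))) - x * w u" by linarith
    thus ?thesis using s by (simp add: h_def)
  qed
  have kh: "k u + k (1 - u) \<le> h u" if u: "1/2 \<le> u" "u < p" for u
  proof -
    have "exp (s * (1 - u)) * a (1 - u) \<le> exp (s * (1 - u)) * (v + C * (v - a u))"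
      by (intro mult_left_mono trade u) auto
    hence "exp (s * u) * a u + exp (s * (1 - u)) * a (1 - u) \<le> v * (exp (s * u) + exp (s * (1 - u))) - (v - a u) * w u"
      by (simp add: w_def algebra_simps)
    also have "\<dots> \<le> v * (exp (s * u) + exp (s * (1 - u))) - x * w u" using cheb[OF u] by simp
    finally have "s * (exp (s * u) * a u + exp (s * (1 - u)) * a (1 - u)) \<le> h u"
      unfolding h_def using s by (intro mult_left_mono) auto
    thus ?thesis by (simp add: k_def algebra_simps)
  qed
  have [measurable]: "k \<in> borel_measurable borel" "h \<in> borel_measurable borel" "w \<in> borel_measurable borel"
    unfolding k_def h_def w_def by measurable
  have refl: "(\<integral>\<^sup>+u. f u \<partial>lborel) = (\<integral>\<^sup>+u. f (1 - u) \<partial>lborel)" if "f \<in> borel_measurable borel" for f :: "real \<Rightarrow> ennreal"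
    using nn_integral_real_affine[OF that, of "-1" 1] by simp
  have "(\<integral>\<^sup>+u. ennreal (k u) * indicator {0<..<1} u \<partial>lborel)
     = (\<integral>\<^sup>+u. ennreal (k u) * indicator {1/2<..<1} u + ennreal (k u) * indicator {0<..<1/2} u \<partial>lborel)"
  proof (rule nn_integral_cong_AE)
    show "AE u in lborel. ennreal (k u) * indicator {0<..<1} u = ennreal (k u) * indicator {1/2<..<1} u + ennreal (k u) * indicator {0<..<1/2} u"
      using AE_lborel_singleton[of "1/2"] by eventually_elim (auto simp: indicator_def)
  qed
  also have "\<dots> = (\<integral>\<^sup>+u. ennreal (k u) * indicator {1/2<..<1} u \<partial>lborel) + (\<integral>\<^sup>+u. ennreal (k u) * indicator {0<..<1/2} u \<partial>lborel)"
    by (rule nn_integral_add) measurable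
  also have "(\<integral>\<^sup>+u. ennreal (k u) * indicator {0<..<1/2} u \<partial>lborel) = (\<integral>\<^sup>+u. ennreal (k (1 - u)) * indicator {0<..<1/2} (1 - u) \<partial>lborel)"
    by (rule refl) measurable
  also have "(\<integral>\<^sup>+u. ennreal (k u) * indicator {1/2<..<1} u \<partial>lborel) + \<dots>
      = (\<integral>\<^sup>+u. ennreal (k u) * indicator {1/2<..<1} u + ennreal (k (1 - u)) * indicator {0<..<1/2} (1 - u) \<partial>lborel)"
    by (rule nn_integral_add[symmetric]) measurable
  also have "\<dots> \<le> (\<integral>\<^sup>+u. ennreal (h u) * indicator {1/2..p} u
       + ennreal (s * exp (s / 4)) * (ennreal (a (1 - u)) * indicator {0<..<1 - p} (1 - u)) \<partial>lborel)"
  proof (rule nn_integral_mono_AE)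
    show "AE u in lborel. ennreal (k u) * indicator {1/2<..<1} u + ennreal (k (1 - u)) * indicator {0<..<1/2} (1 - u)
      \<le> ennreal (h u) * indicator {1/2..p} u + ennreal (s * exp (s / 4)) * (ennreal (a (1 - u)) * indicator {0<..<1 - p} (1 - u))"
      using AE_lborel_singleton[of p]
    proof eventually_elim
      case (elim u)
      consider "u \<le> 1/2 \<or> u \<ge> 1" | "1/2 < u" "u < p" | "p < u" "u < 1" using elim by linarith
      thus ?case
      proof cases
        case 1
        thus ?thesis by (auto simp: indicator_def)
      next
        case 2
        hence "ennreal (k u) + ennreal (k (1 - u)) \<le> ennreal (h u)"
          using kh[of u] k0 by (simp add: ennreal_plus[symmetric] ennreal_leI del: ennreal_plus)
        thus ?thesis using 2 p by (simp add: indicator_def)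
      next
        case 3
        have "k (1 - u) \<le> s * exp (s / 4) * a (1 - u)"
        proof -
          have "s * (1 - u) \<le> s * (1/4)" using 3 p s by (intro mult_left_mono) auto
          thus ?thesis unfolding k_def using s a0 by (intro mult_right_mono mult_left_mono) auto
        qed
        hence "ennreal (k (1 - u)) \<le> ennreal (s * exp (s / 4)) * ennreal (a (1 - u))"
          using s a0 by (simp add: ennreal_mult[symmetric])
        moreover have "k u = 0" using top[OF 3(1)] by (simp add: k_def)
        ultimately show ?thesis using 3 p by (simp add: indicator_def)
      qed
    qed
  qed
  also have "\<dots> = (\<integral>\<^sup>+u. ennreal (h u) * indicator {1/2..p} u \<partial>lborel)
      + (\<integral>\<^sup>+u. ennreal (s * exp (s / 4)) * (ennreal (a (1 - u)) * indicator {0<..<1 - p} (1 - u)) \<partial>lborel)"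
    by (rule nn_integral_add) measurable
  also have "(\<integral>\<^sup>+u. ennreal (s * exp (s / 4)) * (ennreal (a (1 - u)) * indicator {0<..<1 - p} (1 - u)) \<partial>lborel)
      = ennreal (s * exp (s / 4)) * (\<integral>\<^sup>+u. ennreal (a (1 - u)) * indicator {0<..<1 - p} (1 - u) \<partial>lborel)"
    by (rule nn_integral_cmult) measurable
  also have "(\<integral>\<^sup>+u. ennreal (a (1 - u)) * indicator {0<..<1 - p} (1 - u) \<partial>lborel) = (\<integral>\<^sup>+u. ennreal (a u) * indicator {0<..<1 - p} u \<partial>lborel)"
    by (rule refl[symmetric]) measurable
  also have "(\<integral>\<^sup>+u. ennreal (h u) * indicator {1/2..p} u \<partial>lborel) =
     ennreal ((v * (exp (s * p) - exp (s * (1 - p))) - x * (exp (s * p) + C * exp (s * (1 - p))))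
        - (v * (exp (s * (1/2)) - exp (s * (1 - 1/2))) - x * (exp (s * (1/2)) + C * exp (s * (1 - 1/2)))))"
  proof (rule nn_integral_FTC_Icc)
    fix u :: real
    show "((\<lambda>u. v * (exp (s * u) - exp (s * (1 - u))) - x * (exp (s * u) + C * exp (s * (1 - u)))) has_real_derivative h u) (at u)"
      by (auto intro!: derivative_eq_intros simp: h_def w_def algebra_simps)
  qed (use h0 p in auto)
  also have "\<dots> = ennreal (v * (exp (s * p) - exp (s * (1 - p))) - x * (exp (s * p) + C * exp (s * (1 - p)) - (1 + C) * exp (s / 2)))"
    by (simp add: algebra_simps)
  also have "\<dots> + ennreal (s * exp (s / 4)) * (\<integral>\<^sup>+u. ennreal (a u) * indicator {0<..<1 - p} u \<partial>lborel)
      \<le> ennreal (v * (exp (s * p) - exp (s * (1 - p)))) + ennreal (s * exp (s / 4)) * ennreal (M * (1 - p))"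
  proof (intro add_mono mult_left_mono low ennreal_leI)
    \<comment> \<open>The whole deficit term may be dropped, as its factor is nonnegative: (1 + C)
      e^(s/2) is at most e^(3s/4), and p is at least 3/4.\<close>
    have "(1 + C) * exp (s / 2) \<le> exp (s / 4) * exp (s / 2)" using s by (intro mult_right_mono) auto
    also have "\<dots> = exp (s * (3/4))" by (simp add: exp_add[symmetric])
    also have "\<dots> \<le> exp (s * p)" using s p by (simp add: mult_left_mono)
    finally have "(1 + C) * exp (s / 2) \<le> exp (s * p)" .
    moreover have "0 \<le> C * exp (s * (1 - p))" using C by simp
    ultimately have "0 \<le> x * (exp (s * p) + C * exp (s * (1 - p)) - (1 + C) * exp (s / 2))"
      using x(1) by (intro mult_nonneg_nonneg) linarith+
    thus "v * (exp (s * p) - exp (s * (1 - p))) - x * (exp (s * p) + C * exp (s * (1 - p)) - (1 + C) * exp (s / 2))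
      \<le> v * (exp (s * p) - exp (s * (1 - p)))" by simp
  qed simp
  also have "\<dots> = ennreal (v * (exp (s * p) - exp (s * (1 - p))) + s * exp (s / 4) * (M * (1 - p)))"
  proof -
    have "0 \<le> v * (exp (s * p) - exp (s * (1 - p)))" using v s p by (intro mult_nonneg_nonneg) auto
    moreover have "0 \<le> s * exp (s / 4) * (M * (1 - p))" using s M p by simp
    ultimately show ?thesis using s M p by (simp add: ennreal_mult[symmetric] ennreal_plus)
  qed
  also have "\<dots> \<le> ennreal (v * (exp s - 1))"
  proof (rule ennreal_leI)
    \<comment> \<open>The gap e^s - e^(s p) is at least s (1 - p) e^(s p), enough for the light
      levels below 1 - p.\<close>
    have "exp (s * p) * (1 + s * (1 - p)) \<le> exp (s * p) * exp (s * (1 - p))"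
      by (intro mult_left_mono exp_ge_add_one_self) auto
    also have "\<dots> = exp s" by (simp add: exp_add[symmetric] algebra_simps)
    finally have 1: "exp (s * p) + s * (1 - p) * exp (s * p) \<le> exp s" by (simp add: algebra_simps)
    have "exp (s / 4) * M \<le> exp (s / 4) * (v * exp (s / 2))" using M by (intro mult_left_mono) auto
    also have "\<dots> = v * exp (s * (3/4))" by (simp add: exp_add[symmetric])
    also have "\<dots> \<le> v * exp (s * p)" using v s p by simp
    finally have "(s * (1 - p)) * (exp (s / 4) * M) \<le> (s * (1 - p)) * (v * exp (s * p))"
      using s p by (intro mult_left_mono) auto
    moreover have "v * (exp (s * p) + s * (1 - p) * exp (s * p)) \<le> v * exp s" using 1 v by (intro mult_left_mono) auto
    moreover have "v * 1 \<le> v * exp (s * (1 - p))" using v s p by (intro mult_left_mono) auto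
    ultimately show "v * (exp (s * p) - exp (s * (1 - p))) + s * exp (s / 4) * (M * (1 - p)) \<le> v * (exp s - 1)"
      by (simp add: algebra_simps)
  qed
  finally show ?thesis by (simp add: k_def)
qed

text \<open>The right-hand side interpolates linearly in t^d between the values at t = 0 and t = 1.
  It turns a bound on d-th roots of volumes into one on volumes.\<close>

lemma two_minus_power_le:
  fixes t :: real assumes "0 \<le> t" "t \<le> 1" shows "(2 - t) ^ d \<le> 2 ^ d - (2 ^ d - 1) * t ^ d"
proof (induction d)
  case (Suc d)
  have "(2 - t) ^ Suc d \<le> (2 - t) * (2 ^ d - (2 ^ d - 1) * t ^ d)"
    using Suc assms by (simp add: mult_left_mono)
  also have "\<dots> \<le> 2 ^ Suc d - (2 ^ Suc d - 1) * t ^ Suc d"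
  proof -
    have "t ^ Suc d \<le> t" "t ^ Suc d \<le> t ^ d"
      using assms power_decreasing[of 1 "Suc d" t] power_decreasing[of d "Suc d" t] by auto
    hence "2 ^ d * t ^ Suc d \<le> 2 ^ d * t" "(2 * 2 ^ d - 2) * t ^ Suc d \<le> (2 * 2 ^ d - 2) * t ^ d"
      by (auto intro!: mult_left_mono)
    thus ?thesis by (simp add: algebra_simps)
  qed
  finally show ?case .
qed simp

section \<open>Level sets of feasible functions\<close>

context finite_dim_norm
begin

lemma feasible_close:
  assumes "\<phi> \<in> feasible N" "\<phi> x + \<phi> y > 1" shows "N (x - y) \<le> 1"
proof (rule ccontr)
  assume "\<not> N (x - y) \<le> 1"
  hence "well_spread N {x, y}" "x \<noteq> y" using N_minus_commute[of x y] by (auto simp: well_spread_def)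
  hence "(\<Sum>v\<in>{x, y}. \<phi> v) \<le> 1" using assms by (intro feasible_sum_le) auto
  thus False using assms(2) \<open>x \<noteq> y\<close> by simp
qed

lemma bounded_N_le: "bounded {x. N (x - y) \<le> r}"
proof -
  obtain m where m: "m > 0" "\<And>x. m * norm x \<le> N x" using norm_le_N by blast
  have "dist y x \<le> r / m" if "N (x - y) \<le> r" for x
    using that m(2)[of "x - y"] m(1) by (simp add: dist_norm norm_minus_commute field_simps)
  thus ?thesis unfolding bounded_def by blast
qed

text \<open>The difference set of \<open>A\<close> and \<open>B\<close> lies in the closed unit
  ball, of volume 2^d \<open>vol\<close>. Brunn-Minkowski is applied to \<open>A\<close> and
  -\<open>B\<close> inside an open ball of radius 1 + \<eta>, with \<eta> arbitrarily small.\<close>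

lemma level_sets_brunn_minkowski:
  fixes A B :: "(real^'n) set"
  assumes ne: "A \<noteq> {}" "B \<noteq> {}" and meas: "A \<in> sets lebesgue" "B \<in> sets lebesgue"
    and close: "\<And>x y. x \<in> A \<Longrightarrow> y \<in> B \<Longrightarrow> N (x - y) \<le> 1"
  shows "root CARD('n) (measure lebesgue A) + root CARD('n) (measure lebesgue B) \<le> 2 * root CARD('n) vol"
proof -
  let ?d = "CARD('n)"
  obtain x0 y0 where xy: "x0 \<in> A" "y0 \<in> B" using ne by blast
  have bA: "bounded A" by (rule bounded_subset[OF bounded_N_le[of y0 1]]) (use close xy in auto)
  have bB: "bounded B" by (rule bounded_subset[OF bounded_N_le[of x0 1]]) (use close[OF xy(1)] N_minus_commute[of _ x0] in auto)
  let ?B = "(\<lambda>x. (-1) *\<^sub>R x + 0) ` B"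
  have mB: "measure lebesgue ?B = measure lebesgue B" using measure_lebesgue_affine[of "-1" 0 B] by simp
  have sB: "?B \<in> sets lebesgue"
  proof -
    have "?B = (*\<^sub>R) (-1) -` B \<inter> space lebesgue" by (force simp: image_iff)
    thus ?thesis using measurable_sets[OF lebesgue_measurable_scaling[of "-1"] meas(2)] by simp
  qed
  obtain K where K: "K > 0" "\<And>x b. (\<And>i. \<bar>x $ i\<bar> \<le> b) \<Longrightarrow> N x \<le> K * b" using N_le_coord by blast
  have "root ?d (measure lebesgue A) + root ?d (measure lebesgue B) \<le> 2 * root ?d vol + e" if e: "e > 0" for e
  proof -
    \<comment> \<open>Chosen so that the enlarged radius costs exactly \<open>e\<close> on the level
      of roots. The mesh \<epsilon> below then keeps the norm of the perturbation at most
      \<eta>/2.\<close>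
    define \<eta> where "\<eta> = e / (2 * root ?d vol)"
    have rv: "root ?d vol > 0" using vol_pos by simp
    have \<eta>: "\<eta> > 0" using e rv by (simp add: \<eta>_def)
    define \<epsilon> where "\<epsilon> = \<eta> / (4 * K)"
    have \<epsilon>: "\<epsilon> > 0" using \<eta> K by (simp add: \<epsilon>_def)
    have "(root ?d (measure lebesgue A) + root ?d (measure lebesgue ?B)) ^ ?d \<le> measure lebesgue (nball N 0 (1 + \<eta>))"
    proof (rule brunn_minkowski_approx[where \<epsilon>=\<epsilon>])
      show "bounded ?B" using bB by (auto simp: bounded_iff)
      fix x y u :: "real^'n" assume h: "x \<in> A" "y \<in> ?B" "\<And>i. \<bar>u $ i\<bar> \<le> 2 * \<epsilon>"
      then obtain z where z: "z \<in> B" "y = - z" by auto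
      have "N u \<le> K * (2 * \<epsilon>)" using h(3) by (rule K(2))
      also have "\<dots> = \<eta> / 2" using K by (simp add: \<epsilon>_def)
      finally have "N u < \<eta>" using \<eta> by simp
      moreover have "N (x + y) \<le> 1" using close[OF h(1) z(1)] z(2) by simp
      ultimately have "N (x + y + u) < 1 + \<eta>" using N_triangle[of "x + y" u] by linarith
      thus "x + y + u \<in> nball N 0 (1 + \<eta>)" using N_minus[of "x + y + u"] by (simp add: nball_def)
    qed (use bA ne meas sB \<epsilon> lmeasurable_nball in auto)
    also have "\<dots> = (2 * (1 + \<eta>) * root ?d vol) ^ ?d"
      using measure_nball_vol[of "1 + \<eta>"] \<eta> vol_pos by (simp add: power_mult_distrib real_root_pow_pos)
    finally have "root ?d (measure lebesgue A) + root ?d (measure lebesgue B) \<le> 2 * (1 + \<eta>) * root ?d vol"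
      unfolding mB using \<eta> rv by (subst (asm) power_mono_iff) auto
    also have "\<dots> = 2 * root ?d vol + e" using rv by (simp add: \<eta>_def field_simps)
    finally show ?thesis .
  qed
  thus ?thesis by (rule field_le_epsilon)
qed

text \<open>As u is at least 1/2, the level set at u lies in the one at 1 - u, so its root is the
  smaller of two with sum at most 2 root(\<open>vol\<close>). With t the quotient of the smaller
  root by root(\<open>vol\<close>), the other is at most (2 - t) root(\<open>vol\<close>); the slope
  2^d - 1 is rounded up to 2^d. An empty level at u would put no constraint on the level at 1 -
  u.\<close>

lemma level_sets_tradeoff:
  assumes phi: "\<phi> \<in> feasible N" and u: "1/2 \<le> u" "u < 1" and ne: "\<exists>x. u < \<phi> x"
  defines "a \<equiv> \<lambda>u. measure lebesgue {x. u < \<phi> x}"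
  shows "a u \<le> vol" "a (1 - u) \<le> vol + 2 ^ CARD('n) * (vol - a u)"
proof -
  let ?d = "CARD('n)"
  have [measurable]: "\<phi> \<in> borel_measurable lebesgue" using phi by (auto simp: feasible_def)
  have s: "{x. r < \<phi> x} \<in> sets lebesgue" for r by (rule sets_level) simp
  have bm: "root ?d (a u) + root ?d (a (1 - u)) \<le> 2 * root ?d vol"
    unfolding a_def
  proof (rule level_sets_brunn_minkowski)
    obtain x where "u < \<phi> x" using ne by blast
    moreover hence "1 - u < \<phi> x" using u by linarith
    ultimately show "{x. u < \<phi> x} \<noteq> {}" "{x. 1 - u < \<phi> x} \<noteq> {}" by blast+
    show "N (x - y) \<le> 1" if "x \<in> {x. u < \<phi> x}" "y \<in> {x. 1 - u < \<phi> x}" for x y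
      using that by (intro feasible_close[OF phi]) auto
  qed (rule s)+
  have lm: "{x. r < \<phi> x} \<in> lmeasurable" if "r > 0" for r
    using phi that by (intro lmeasurable_level feasible_integrable) (auto simp: feasible_def)
  have mono: "a u \<le> a (1 - u)" unfolding a_def
    using u by (intro measure_mono_fmeasurable lm s) auto
  have nn: "0 \<le> a r" for r by (simp add: a_def)
  let ?w = "root ?d vol"
  have w: "?w > 0" "?w ^ ?d = vol" using vol_pos by (auto simp: real_root_pow_pos)
  have ra: "root ?d (a r) ^ ?d = a r" "0 \<le> root ?d (a r)" for r using nn[of r] by (auto simp: real_root_pow_pos2)
  have "root ?d (a u) \<le> root ?d (a (1 - u))" using mono by simp
  hence le: "root ?d (a u) \<le> ?w" using bm by linarith
  hence "root ?d (a u) ^ ?d \<le> ?w ^ ?d" using ra(2) by (intro power_mono) auto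
  thus 1: "a u \<le> vol" by (simp add: ra w)
  define t where "t = root ?d (a u) / ?w"
  have t: "0 \<le> t" "t \<le> 1" using le w ra(2) by (auto simp: t_def)
  have td: "t ^ ?d = a u / vol" by (simp add: t_def power_divide ra w)
  have "root ?d (a (1 - u)) \<le> ?w * (2 - t)"
  proof -
    have "?w * t = root ?d (a u)" using w by (simp add: t_def)
    thus ?thesis using bm by (simp add: right_diff_distrib)
  qed
  hence "root ?d (a (1 - u)) ^ ?d \<le> (?w * (2 - t)) ^ ?d" using ra(2) by (intro power_mono) auto
  hence "a (1 - u) \<le> vol * (2 - t) ^ ?d" by (simp add: ra w power_mult_distrib)
  also have "\<dots> \<le> vol * (2 ^ ?d - (2 ^ ?d - 1) * (a u / vol))"
    using two_minus_power_le[OF t, of ?d] vol_pos unfolding td by (intro mult_left_mono) auto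
  also have "\<dots> = vol + 2 ^ ?d * (vol - a u) - (vol - a u)"
    using vol_pos by (simp add: field_simps)
  finally show "a (1 - u) \<le> vol + 2 ^ CARD('n) * (vol - a u)" using 1 by linarith
qed

text \<open>Off the unit ball around $y$ the function $\varphi / (1 - \varphi(y))$ is again feasible, because $y$ can be
  added to every well-spread set there.\<close>

lemma integral_off_ball_le:
  assumes phi: "\<phi> \<in> feasible N"
  shows "(LINT x|lebesgue. \<phi> x * indicator {x. 1 < N (x - y)} x) \<le> max_mass * (1 - \<phi> y)"
proof -
  let ?\<psi> = "\<lambda>x. \<phi> x * indicator {x. 1 < N (x - y)} x"
  have phi0: "0 \<le> \<phi> x" for x using phi by (simp add: feasible_def)
  have [measurable]: "\<phi> \<in> borel_measurable lebesgue" using phi by (auto simp: feasible_def)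
  have "continuous_on UNIV (\<lambda>x. N (x - y))"
    by (rule continuous_on_compose2[OF continuous_on_N]) (auto intro!: continuous_intros)
  from open_Collect_less[OF continuous_on_const this] have "open {x. 1 < N (x - y)}" .
  hence [measurable]: "{x. 1 < N (x - y)} \<in> sets lebesgue" by (simp add: borel_open)
  have sum: "(\<Sum>v\<in>S. ?\<psi> v) \<le> 1 - \<phi> y" if S: "finite S" "well_spread N S" for S
  proof -
    let ?T = "S \<inter> {x. 1 < N (x - y)}"
    have "y \<notin> ?T" by simp
    moreover have "well_spread N (insert y ?T)"
      using S N_minus_commute[of y] unfolding well_spread_def by auto
    hence "(\<Sum>v\<in>insert y ?T. \<phi> v) \<le> 1" using S phi by (intro feasible_sum_le) auto
    moreover have "(\<Sum>v\<in>S. ?\<psi> v) = (\<Sum>v\<in>?T. \<phi> v)"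
      using S by (intro sum.mono_neutral_cong_right) (auto simp: indicator_def)
    ultimately show ?thesis using S by simp
  qed
  show ?thesis
  \<comment> \<open>Normalising by 1 - \<phi>(y) fails when \<phi>(y) = 1, but then \<phi> vanishes
    off the ball.\<close>
  proof (cases "\<phi> y = 1")
    case True
    have "?\<psi> x = 0" for x
    proof -
      have "?\<psi> x \<le> 0" using sum[of "{x}"] True by (cases "1 < N (x - y)") (auto simp: well_spread_def)
      moreover have "0 \<le> ?\<psi> x" using phi0 by simp
      ultimately show ?thesis by linarith
    qed
    hence "(LINT x|lebesgue. ?\<psi> x) = (LINT x|(lebesgue :: (real^'n) measure). 0)"
      by (intro Bochner_Integration.integral_cong refl)
    thus ?thesis using True by simp
  next
    case False
    hence pos: "1 - \<phi> y > 0" using feasible_le_1[OF phi, of y] by simp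
    have "(\<lambda>x. ?\<psi> x / (1 - \<phi> y)) \<in> feasible N"
    proof (rule feasibleI)
      fix S assume S: "finite S" "well_spread N S"
      show "(\<Sum>v\<in>S. ?\<psi> v / (1 - \<phi> y)) \<le> 1"
        using sum[OF S] pos by (simp add: sum_divide_distrib[symmetric])
    qed (use phi0 pos in auto)
    from integral_le_max_mass[OF this] show ?thesis using pos by (simp add: pos_divide_le_eq)
  qed
qed

lemma emeasure_N_le: "emeasure lebesgue {x. N (x - y) \<le> 1} \<le> ennreal (4 ^ CARD('n) * vol)"
proof -
  have "{x. N (x - y) \<le> 1} \<subseteq> (+) y ` nball N 0 2"
  proof
    fix x assume "x \<in> {x. N (x - y) \<le> 1}"
    hence "x - y \<in> nball N 0 2" using N_minus_commute[of x y] by (simp add: nball_def)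
    thus "x \<in> (+) y ` nball N 0 2" by (metis add_diff_cancel_left' diff_add_cancel image_eqI add.commute)
  qed
  moreover have m: "(+) y ` nball N 0 2 \<in> lmeasurable" using lmeasurable_nball by (simp add: measurable_translation)
  ultimately have "emeasure lebesgue {x. N (x - y) \<le> 1} \<le> emeasure lebesgue ((+) y ` nball N 0 2)"
    by (intro emeasure_mono) auto
  also have "\<dots> = ennreal (measure lebesgue ((+) y ` nball N 0 2))" using m by (simp add: emeasure_eq_measure2)
  also have "\<dots> = ennreal (4 ^ CARD('n) * vol)" by (simp add: measure_translation measure_nball_vol)
  finally show ?thesis .
qed

text \<open>Pick y with \<phi>(y) close to the supremum p. Within distance 1 of y the integrand is
  at most 1 - p on a set of bounded volume; farther out the mass is at most \<open>max_mass\<close>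
  (1 - \<phi>(y)). This feeds the hypothesis \<open>low\<close> of
  \<open>exp_weighted_layer_bound\<close>.\<close>

lemma truncated_integral_le:
  assumes phi: "\<phi> \<in> feasible N" and p: "\<And>x. \<phi> x \<le> p" "\<And>q. q < p \<Longrightarrow> \<exists>x. q < \<phi> x" "p \<le> 1"
  shows "(\<integral>\<^sup>+x. ennreal (min (\<phi> x) (1 - p)) \<partial>lebesgue) \<le> ennreal ((4 ^ CARD('n) * vol + max_mass) * (1 - p))"
proof -
  have phi0: "0 \<le> \<phi> x" for x using phi by (simp add: feasible_def)
  have [measurable]: "\<phi> \<in> borel_measurable lebesgue" using phi by (auto simp: feasible_def)
  have int: "integrable lebesgue \<phi>" by (rule feasible_integrable[OF phi])
  have M: "max_mass > 0" using vol_pos vol_le_max_mass by linarith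
  let ?V = "4 ^ CARD('n) * vol"
  have V: "?V \<ge> 0" using vol_pos by simp
  have step: "(\<integral>\<^sup>+x. ennreal (min (\<phi> x) (1 - p)) \<partial>lebesgue) \<le> ennreal (?V * (1 - p) + max_mass * (1 - \<phi> y))" for y
  proof -
    have m1: "{x. N (x - y) \<le> 1} \<in> sets lebesgue"
    proof -
      have "continuous_on UNIV (\<lambda>x. N (x - y))"
        by (rule continuous_on_compose2[OF continuous_on_N]) (auto intro!: continuous_intros)
      from closed_Collect_le[OF this continuous_on_const] show ?thesis by (simp add: borel_closed)
    qed
    have m2: "{x. 1 < N (x - y)} \<in> sets lebesgue"
    proof -
      have "{x. 1 < N (x - y)} = - {x. N (x - y) \<le> 1}" by auto
      thus ?thesis using m1 by (simp only: Compl_in_sets_lebesgue)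
    qed
    have i2: "integrable lebesgue (\<lambda>x. \<phi> x * indicator {x. 1 < N (x - y)} x)"
      using int m2 by (intro integrable_real_mult_indicator)
    have "(\<integral>\<^sup>+x. ennreal (min (\<phi> x) (1 - p)) \<partial>lebesgue) \<le>
      (\<integral>\<^sup>+x. ennreal (1 - p) * indicator {x. N (x - y) \<le> 1} x + ennreal (\<phi> x * indicator {x. 1 < N (x - y)} x) \<partial>lebesgue)"
      using phi0 p by (intro nn_integral_mono) (auto simp: indicator_def intro!: ennreal_leI)
    also have "\<dots> = (\<integral>\<^sup>+x. ennreal (1 - p) * indicator {x. N (x - y) \<le> 1} x \<partial>lebesgue) + (\<integral>\<^sup>+x. ennreal (\<phi> x * indicator {x. 1 < N (x - y)} x) \<partial>lebesgue)"
      using m1 m2 by (intro nn_integral_add) auto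
    also have "(\<integral>\<^sup>+x. ennreal (1 - p) * indicator {x. N (x - y) \<le> 1} x \<partial>lebesgue) = ennreal (1 - p) * emeasure lebesgue {x. N (x - y) \<le> 1}"
      by (rule nn_integral_cmult_indicator[OF m1])
    also have "(\<integral>\<^sup>+x. ennreal (\<phi> x * indicator {x. 1 < N (x - y)} x) \<partial>lebesgue) = ennreal (LINT x|lebesgue. \<phi> x * indicator {x. 1 < N (x - y)} x)"
      using i2 phi0 by (intro nn_integral_eq_integral) auto
    also have "ennreal (1 - p) * emeasure lebesgue {x. N (x - y) \<le> 1} + \<dots> \<le> ennreal (1 - p) * ennreal ?V + ennreal (max_mass * (1 - \<phi> y))"
      by (intro add_mono mult_left_mono emeasure_N_le ennreal_leI integral_off_ball_le phi) simp
    also have "\<dots> = ennreal (?V * (1 - p) + max_mass * (1 - \<phi> y))"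
      using p(3) V M feasible_le_1[OF phi, of y] by (simp add: ennreal_mult[symmetric] ennreal_plus[symmetric] mult.commute del: ennreal_plus)
    finally show ?thesis .
  qed
  show ?thesis
  proof (rule ennreal_le_epsilon)
    fix e :: real assume e: "e > 0"
    then obtain y where y: "p - e / max_mass < \<phi> y" using p(2)[of "p - e / max_mass"] M by auto
    have "max_mass * (1 - \<phi> y) \<le> max_mass * (1 - p + e / max_mass)" using y M by (intro mult_left_mono) auto
    also have "\<dots> = max_mass * (1 - p) + e" using M by (simp add: field_simps)
    finally have "?V * (1 - p) + max_mass * (1 - \<phi> y) \<le> (?V + max_mass) * (1 - p) + e" by (simp add: distrib_right)
    hence "ennreal (?V * (1 - p) + max_mass * (1 - \<phi> y)) \<le> ennreal ((?V + max_mass) * (1 - p) + e)" by (rule ennreal_leI)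
    also have "\<dots> = ennreal ((?V + max_mass) * (1 - p)) + ennreal e"
      using e V M p(3) by (intro ennreal_plus) auto
    finally show "(\<integral>\<^sup>+x. ennreal (min (\<phi> x) (1 - p)) \<partial>lebesgue) \<le> ennreal ((?V + max_mass) * (1 - p)) + ennreal e"
      using step[of y] by (rule order_trans[rotated])
  qed
qed

lemma feasible_energy_le:
  "\<exists>s0>0. \<forall>\<phi>\<in>feasible N. \<forall>s\<ge>s0. (LINT x|lebesgue. exp (s * \<phi> x) - 1) \<le> vol * (exp s - 1)"
proof -
  let ?d = "CARD('n)"
  have M: "max_mass > 0" using vol_pos vol_le_max_mass by linarith
  define C :: real where "C = 2 ^ ?d"
  define M' where "M' = 4 ^ ?d * vol + max_mass"
  have C: "C \<ge> 1" by (simp add: C_def)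
  have M': "M' \<ge> 0" using vol_pos M by (simp add: M'_def)
  \<comment> \<open>The entries 1 + C and M'/vol serve the layer bound, the last one the case of
    supremum at most 3/4. For s at least 4 ln K, e^(s/4) exceeds all three.\<close>
  define K where "K = max (1 + C) (max (M' / vol) (4/3 * max_mass / vol))"
  define s0 where "s0 = 4 * ln K"
  have K: "K \<ge> 1 + C" "K \<ge> M' / vol" "K \<ge> 4/3 * max_mass / vol" by (auto simp: K_def)
  have s0: "s0 > 0" using K C by (simp add: s0_def)
  have "(LINT x|lebesgue. exp (s * \<phi> x) - 1) \<le> vol * (exp s - 1)" if phi: "\<phi> \<in> feasible N" and ss: "s \<ge> s0" for \<phi> s
  proof -
    have s: "s > 0" using ss s0 by simp
    have "ln K \<le> s / 4" using ss by (simp add: s0_def)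
    hence "exp (ln K) \<le> exp (s / 4)" by simp
    hence eK: "K \<le> exp (s / 4)" using K C by (subst (asm) exp_ln) auto
    have phi0: "0 \<le> \<phi> x" for x using phi by (simp add: feasible_def)
    have phi1: "\<phi> x \<le> 1" for x by (rule feasible_le_1[OF phi])
    have [measurable]: "\<phi> \<in> borel_measurable lebesgue" using phi by (auto simp: feasible_def)
    have int: "integrable lebesgue \<phi>" by (rule feasible_integrable[OF phi])
    define p where "p = (SUP x. \<phi> x)"
    have bdd: "bdd_above (range \<phi>)" using phi1 by (auto simp: bdd_above_def)
    have p1: "\<phi> x \<le> p" for x unfolding p_def by (rule cSUP_upper[OF _ bdd]) simp
    have p2: "\<exists>x. q < \<phi> x" if "q < p" for q
      using that less_cSUP_iff[OF _ bdd] unfolding p_def by auto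
    have p3: "p \<le> 1" unfolding p_def by (rule cSUP_least) (use phi1 in auto)
    show ?thesis
    proof (cases "p \<le> 3/4")
      case True
      \<comment> \<open>With values at most 3/4, the chord of exp over [0, 3/4] gives an energy of
        order e^(3s/4), which is smaller than e^s by the factor e^(s/4).\<close>
      have le: "exp (s * \<phi> x) - 1 \<le> 4/3 * (exp (s * (3/4)) - 1) * \<phi> x" for x
      proof -
        have x34: "\<phi> x \<le> 3/4" using p1[of x] True by simp
        have "exp ((1 - 4/3 * \<phi> x) *\<^sub>R 0 + (4/3 * \<phi> x) *\<^sub>R (s * (3/4))) \<le> (1 - 4/3 * \<phi> x) * exp 0 + 4/3 * \<phi> x * exp (s * (3/4))"
          using phi0[of x] x34 exp_convex by (intro convex_onD[of UNIV exp]) auto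
        thus ?thesis by (simp add: algebra_simps)
      qed
      have "(LINT x|lebesgue. exp (s * \<phi> x) - 1) \<le> (LINT x|lebesgue. 4/3 * (exp (s * (3/4)) - 1) * \<phi> x)"
      proof (rule integral_mono')
        show "integrable lebesgue (\<lambda>x. 4/3 * (exp (s * (3/4)) - 1) * \<phi> x)" using int by simp
        show "0 \<le> 4/3 * (exp (s * (3/4)) - 1) * \<phi> x" for x using s phi0 by simp
      qed (rule le)
      also have "\<dots> = 4/3 * (exp (s * (3/4)) - 1) * (LINT x|lebesgue. \<phi> x)" by simp
      also have "\<dots> \<le> 4/3 * (exp (s * (3/4)) - 1) * max_mass"
        using s by (intro mult_left_mono integral_le_max_mass phi) auto
      also have "\<dots> = (4/3 * max_mass / vol) * (exp (s * (3/4)) - 1) * vol" using vol_pos by simp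
      also have "\<dots> \<le> exp (s / 4) * (exp (s * (3/4)) - 1) * vol"
        using K(3) eK s vol_pos by (intro mult_right_mono) auto
      also have "\<dots> \<le> vol * (exp s - 1)"
      proof -
        have "exp (s / 4) * exp (s * (3/4)) = exp s" by (simp add: exp_add[symmetric])
        hence "exp (s / 4) * (exp (s * (3/4)) - 1) \<le> exp s - 1" using s by (simp add: right_diff_distrib)
        thus ?thesis using vol_pos by (simp add: mult.commute)
      qed
      finally show ?thesis .
    next
      case False
      \<comment> \<open>The cut-off removes the levels at and below 0, whose measure may be
        infinite; above 0 \<open>a u\<close> agrees with the extended measure.\<close>
      define a where "a u = measure lebesgue {x. u < \<phi> x} * indicator {0<..} u" for u
      have lm: "{x. u < \<phi> x} \<in> lmeasurable" if "u > 0" for u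
        by (rule lmeasurable_level[OF int phi0 that])
      have em: "emeasure lebesgue {x. u < \<phi> x} * indicator {0<..} u = ennreal (a u)" for u
        using lm[of u] by (auto simp: a_def indicator_def emeasure_eq_measure2)
      have meas: "a \<in> borel_measurable borel"
      proof -
        interpret sigma_finite_measure "lebesgue :: (real^'n) measure" by (rule sigma_finite_lebesgue)
        have "{(u, x). u < \<phi> x} \<in> sets (lborel \<Otimes>\<^sub>M lebesgue)"
        proof -
          have "{y \<in> space (lborel \<Otimes>\<^sub>M (lebesgue :: (real^'n) measure)). fst y < \<phi> (snd y)} \<in> sets (lborel \<Otimes>\<^sub>M lebesgue)" by measurable
          moreover have "{(u, x). u < \<phi> x} = {y. fst y < \<phi> (snd y)}" by auto
          ultimately show ?thesis by (simp add: space_pair_measure)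
        qed
        from measurable_emeasure_Pair[OF this] have [measurable]: "(\<lambda>u. emeasure lebesgue {x. u < \<phi> x}) \<in> borel_measurable lborel"
          by (simp add: vimage_def)
        have "(\<lambda>u. enn2real (emeasure lebesgue {x. u < \<phi> x}) * indicator {0<..} u) \<in> borel_measurable lborel" by measurable
        moreover have "a = (\<lambda>u. enn2real (emeasure lebesgue {x. u < \<phi> x}) * indicator {0<..} u)"
          by (simp add: a_def measure_def fun_eq_iff)
        ultimately show ?thesis by simp
      qed
      have a_eq: "a u = measure lebesgue {x. u < \<phi> x}" if "u > 0" for u using that by (simp add: a_def)
      have nn: "(\<integral>\<^sup>+x. ennreal (exp (s * \<phi> x) - 1) \<partial>lebesgue) = (\<integral>\<^sup>+u. ennreal (s * exp (s * u) * a u) * indicator {0<..<1} u \<partial>lborel)"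
      proof -
        have "(\<integral>\<^sup>+x. ennreal (exp (s * \<phi> x) - 1) \<partial>lebesgue) = (\<integral>\<^sup>+x. (\<integral>\<^sup>+u. ennreal (s * exp (s * u)) * indicator {0<..<\<phi> x} u \<partial>lborel) \<partial>lebesgue)"
          using s phi0 by (simp add: nn_integral_exp_Ioo)
        also have "\<dots> = (\<integral>\<^sup>+u. ennreal (s * exp (s * u)) * emeasure lebesgue {x. u < \<phi> x} * indicator {0<..} u \<partial>lborel)"
          by (rule layer_cake) measurable
        also have "\<dots> = (\<integral>\<^sup>+u. ennreal (s * exp (s * u)) * ennreal (a u) \<partial>lborel)"
          unfolding em[symmetric] by (simp add: mult.assoc)
        also have "\<dots> = (\<integral>\<^sup>+u. ennreal (s * exp (s * u) * a u) * indicator {0<..<1} u \<partial>lborel)"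
        proof (rule nn_integral_cong)
          fix u :: real
          have "a u = 0" if "u \<notin> {0<..<1}"
          proof (cases "u \<le> 0")
            case False
            hence "u \<ge> 1" using that by auto
            hence "{x. u < \<phi> x} = {}" using phi1 by (auto simp: not_less intro: order_trans)
            thus ?thesis by (simp add: a_def)
          qed (simp add: a_def)
          thus "ennreal (s * exp (s * u)) * ennreal (a u) = ennreal (s * exp (s * u) * a u) * indicator {0<..<1} u"
            using s by (cases "u \<in> {0<..<1}") (auto simp: ennreal_mult' a_def)
        qed
        finally show ?thesis .
      qed
      have "(\<integral>\<^sup>+u. ennreal (s * exp (s * u) * a u) * indicator {0<..<1} u \<partial>lborel) \<le> ennreal (vol * (exp s - 1))"
      proof (rule exp_weighted_layer_bound[OF meas vol_pos C s, where M=M' and p=p])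
        show "1 + C \<le> exp (s / 4)" using K eK by linarith
        show "M' \<le> vol * exp (s / 2)"
        proof -
          have "exp (s / 4) \<le> exp (s / 2)" using s by simp
          hence "M' / vol \<le> exp (s / 2)" using K(2) eK by linarith
          thus ?thesis using vol_pos by (simp add: pos_divide_le_eq mult.commute)
        qed
        show "a w \<le> a u" if "0 < u" "u \<le> w" for u w
          using that lm[of u] lm[of w] by (simp add: a_eq) (intro measure_mono_fmeasurable, auto)
        fix u assume u: "1/2 \<le> u" "u < p"
        show "a u \<le> vol" "a (1 - u) \<le> vol + C * (vol - a u)"
          using level_sets_tradeoff[OF phi u(1) _ p2[OF u(2)]] u p3 by (auto simp: a_eq C_def)
      next
        fix u assume "p < u"
        hence "{x. u < \<phi> x} = {}" using p1 by (auto simp: not_less intro: order_trans less_imp_le)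
        thus "a u = 0" by (simp add: a_def)
      next
        have "(\<integral>\<^sup>+u. ennreal (a u) * indicator {0<..<1 - p} u \<partial>lborel) = (\<integral>\<^sup>+u. indicator {0<..<1 - p} u * emeasure lebesgue {x. u < \<phi> x} * indicator {0<..} u \<partial>lborel)"
          unfolding em[symmetric] by (simp add: mult.assoc mult.commute mult.left_commute)
        also have "\<dots> = (\<integral>\<^sup>+x. (\<integral>\<^sup>+u. indicator {0<..<1 - p} u * indicator {0<..<\<phi> x} u \<partial>lborel) \<partial>lebesgue)"
          by (rule layer_cake[symmetric]) measurable
        also have "\<dots> = (\<integral>\<^sup>+x. ennreal (min (\<phi> x) (1 - p)) \<partial>lebesgue)"
        proof (rule nn_integral_cong)
          fix x
          have "(\<integral>\<^sup>+u. indicator {0<..<1 - p} u * indicator {0<..<\<phi> x} u \<partial>lborel) = (\<integral>\<^sup>+u. indicator {0<..<min (\<phi> x) (1 - p)} u \<partial>lborel)"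
            by (intro nn_integral_cong) (auto simp: indicator_def)
          also have "\<dots> = ennreal (min (\<phi> x) (1 - p))" using phi0[of x] p3 by simp
          finally show "(\<integral>\<^sup>+u. indicator {0<..<1 - p} u * indicator {0<..<\<phi> x} u \<partial>lborel) = ennreal (min (\<phi> x) (1 - p))" .
        qed
        also have "\<dots> \<le> ennreal (M' * (1 - p))"
          unfolding M'_def by (rule truncated_integral_le[OF phi p1 p2 p3])
        finally show "(\<integral>\<^sup>+u. ennreal (a u) * indicator {0<..<1 - p} u \<partial>lborel) \<le> ennreal (M' * (1 - p))" .
      qed (use M' False p3 in \<open>auto simp: a_def\<close>)
      hence le: "(\<integral>\<^sup>+x. ennreal (exp (s * \<phi> x) - 1) \<partial>lebesgue) \<le> ennreal (vol * (exp s - 1))" unfolding nn .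
      have "integrable lebesgue (\<lambda>x. exp (s * \<phi> x) - 1)"
        by (rule integrableI_nonneg) (use s phi0 le le_less_trans[OF le ennreal_less_top] in auto)
      hence "(\<integral>\<^sup>+x. ennreal (exp (s * \<phi> x) - 1) \<partial>lebesgue) = ennreal (LINT x|lebesgue. exp (s * \<phi> x) - 1)"
        using s phi0 by (intro nn_integral_eq_integral) auto
      thus ?thesis using le s vol_pos by (simp add: ennreal_le_iff)
    qed
  qed
  thus ?thesis using s0 by blast
qed

end

section \<open>The ratio\<close>

text \<open>The hypotheses squeeze f y between f x times min 1 (y/x) and f x times max 1 (y/x). Both
  hypotheses are stable under suprema, so this applies to \<open>f_chi\<close>.\<close>

lemma continuous_on_of_scaling:
  fixes f :: "real \<Rightarrow> real"
  assumes nonneg: "\<And>x. 0 < x \<Longrightarrow> 0 \<le> f x" and mono: "\<And>x y. 0 < x \<Longrightarrow> x \<le> y \<Longrightarrow> f x \<le> f y"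
    and scale: "\<And>x c. 0 < x \<Longrightarrow> 0 < c \<Longrightarrow> c \<le> 1 \<Longrightarrow> c * f x \<le> f (c * x)"
  shows "continuous_on {0<..} f"
proof -
  have "isCont f x" if x: "x > 0" for x
  proof -
    have bd: "min 1 (y / x) * f x \<le> f y \<and> f y \<le> max 1 (y / x) * f x" if y: "y > 0" for y
    proof (cases "y \<le> x")
      case True
      have "y / x \<le> 1" using True x by simp
      moreover have "(y / x) * f x \<le> f ((y / x) * x)" using x y True by (intro scale) auto
      ultimately show ?thesis using x y mono[OF y True] by (simp add: min_def max_def)
    next
      case False
      hence yx: "x / y \<le> 1" "1 \<le> y / x" using x y by auto
      have "(x / y) * f y \<le> f ((x / y) * y)" using x y yx by (intro scale) auto
      hence "f y \<le> (y / x) * f x" using x y by (simp add: field_simps)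
      thus ?thesis using yx mono[of x y] x False by (simp add: min_def max_def)
    qed
    have ev: "\<forall>\<^sub>F y in at x. y > 0" using x eventually_at_in_open'[of "{0<..}" x] by auto
    have l: "((\<lambda>y. min 1 (y / x) * f x) \<longlongrightarrow> min 1 (x / x) * f x) (at x)"
      using x by (intro tendsto_intros) auto
    have u: "((\<lambda>y. max 1 (y / x) * f x) \<longlongrightarrow> max 1 (x / x) * f x) (at x)"
      using x by (intro tendsto_intros) auto
    have "(f \<longlongrightarrow> f x) (at x)"
    proof (rule tendsto_sandwich)
      show "\<forall>\<^sub>F y in at x. min 1 (y / x) * f x \<le> f y" using ev by eventually_elim (use bd in blast)
      show "\<forall>\<^sub>F y in at x. f y \<le> max 1 (y / x) * f x" using ev by eventually_elim (use bd in blast)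
    qed (use l u x in auto)
    thus ?thesis by (simp add: isCont_def)
  qed
  thus ?thesis by (auto simp: continuous_on_eq_continuous_at)
qed

text \<open>The slope bound is available only where L is at least e. If L were at most e somewhere,
  then to the right of the last such point L would decrease, which contradicts L b > e; so the bound
  holds on the whole interval.\<close>

lemma decreasing_above_threshold:
  fixes L :: "real \<Rightarrow> real"
  assumes ab: "a < b" and d: "\<And>x. a \<le> x \<Longrightarrow> x \<le> b \<Longrightarrow> (L has_real_derivative L' x) (at x)"
    and slope: "\<And>x. a \<le> x \<Longrightarrow> x \<le> b \<Longrightarrow> L x \<ge> e \<Longrightarrow> L' x \<le> - \<eta>" and \<eta>: "\<eta> > 0" and Lb: "L b > e"
  shows "L b + \<eta> * (b - a) \<le> L a"
proof -
  have above: "L x > e" if x: "a \<le> x" "x \<le> b" for x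
  proof (rule ccontr)
    assume nx: "\<not> e < L x"
    let ?S = "{a..b} \<inter> L -` {..e}"
    have "continuous_on {a..b} L" using d by (auto intro!: continuous_at_imp_continuous_on DERIV_isCont)
    hence "closed ?S" by (intro continuous_closed_preimage) auto
    hence "compact ?S" by (metis compact_Int_closed compact_Icc Int_absorb1 inf_le1 Int_commute inf.absorb_iff2)
    moreover have "?S \<noteq> {}" using nx x by auto
    ultimately obtain m where m: "m \<in> ?S" "\<And>t. t \<in> ?S \<Longrightarrow> t \<le> m" using compact_attains_sup[of ?S] by blast
    have mb: "m < b" using m(1) Lb by (cases "m = b") auto
    have "\<exists>z. m < z \<and> z < b \<and> L b - L m = (b - m) * L' z"
      using mb m(1) by (intro MVT2 d) auto
    then obtain z where z: "m < z" "z < b" "L b - L m = (b - m) * L' z" by blast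
    have "L z > e" using m(2)[of z] z m(1) by (auto simp: not_le[symmetric])
    hence "L' z \<le> - \<eta>" using z m(1) by (intro slope) auto
    hence "(b - m) * L' z \<le> 0" using mb \<eta> by (intro mult_nonneg_nonpos) auto
    thus False using z(3) m(1) Lb by auto
  qed
  have "\<exists>z. a < z \<and> z < b \<and> L b - L a = (b - a) * L' z" using ab by (intro MVT2 d) auto
  then obtain z where z: "a < z" "z < b" "L b - L a = (b - a) * L' z" by blast
  have "(b - a) * L' z \<le> (b - a) * (- \<eta>)" using ab z above[of z] by (intro mult_left_mono slope) auto
  thus ?thesis using z(3) by (simp add: algebra_simps)
qed

section \<open>Comparison of feasible functions with the ball of radius 1/2\<close>

context finite_dim_norm
begin

abbreviation ref :: "real^'n \<Rightarrow> real" where "ref \<equiv> indicator (nball N 0 (1/2))"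

lemma feasible_weight:
  assumes "\<phi> \<in> feasible N" "(LINT x|lebesgue. \<phi> x) \<noteq> 0" shows "weight \<phi>"
proof
  show "0 < (LINT x|lebesgue. \<phi> x)"
  proof -
    have "0 \<le> (LINT x|lebesgue. \<phi> x)" using assms(1) by (intro integral_nonneg_AE) (auto simp: feasible_def)
    thus ?thesis using assms(2) by linarith
  qed
  show "\<phi> \<in> borel_measurable lebesgue" "\<And>x. 0 \<le> \<phi> x" using assms(1) by (auto simp: feasible_def)
qed (rule feasible_le_1[OF assms(1)] feasible_integrable[OF assms(1)])+

sublocale ref: weight ref
  by (rule feasible_weight[OF indicator_feasible]) (use vol_pos integral_indicator_nball in simp)

lemma ref_integral: "(LINT x|lebesgue. g * ref x) = g * vol"
  using integral_indicator_nball by simp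

lemma ref_energy: "ref.energy s = vol * (exp s - 1)"
proof -
  have "ref.energy s = (LINT x|lebesgue. (exp s - 1) * ref x)"
    unfolding ref.energy_def by (intro Bochner_Integration.integral_cong refl) (auto simp: indicator_def)
  thus ?thesis unfolding ref_integral by simp
qed

lemma ref_moment_at: "ref.moment_at s = vol * exp s"
proof -
  have "ref.moment_at s = (LINT x|lebesgue. exp s * ref x)"
    unfolding ref.moment_at_def by (intro Bochner_Integration.integral_cong refl) (auto simp: indicator_def)
  thus ?thesis unfolding ref_integral by simp
qed

lemma ref_entropy_at: "0 \<le> s \<Longrightarrow> ref.entropy_at s = vol * Hexp s"
  by (simp add: ref.entropy_at_eq ref_moment_at ref_energy Hexp_def algebra_simps)

text \<open>The equality case of \<open>tau_le_entropy_share\<close>, as \<open>ref\<close> takes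
  only the values 0 and 1.\<close>

lemma ref_tau: assumes "\<tau> > 0" shows "\<tau> = entropy_share (ref.tilt \<tau>) * (ref.tilt \<tau> * ref.xi_at \<tau>)"
proof -
  have s: "ref.tilt \<tau> > 0" by (rule ref.tilt_pos[OF assms])
  have "entropy_share (ref.tilt \<tau>) * (ref.tilt \<tau> * ref.xi_at \<tau>) = vol * Hexp (ref.tilt \<tau>)"
    using s by (simp add: ref.xi_at_eq_moment[OF assms] ref_moment_at entropy_share_def)
  also have "\<dots> = \<tau>" using ref.entropy_at_tilt[OF assms] ref_entropy_at[of "ref.tilt \<tau>"] s by simp
  finally show ?thesis by simp
qed

lemma f_omega_eq: "f_omega N (1 / \<tau>) = ref.xi_at \<tau>"
  by (simp add: f_omega_def ref.xi_at_def)

lemma energy_le: assumes "\<phi> \<in> feasible N" "weight \<phi>" "0 \<le> s" shows "weight.energy \<phi> s \<le> (exp s - 1) * (LINT x|lebesgue. \<phi> x)"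
proof -
  interpret weight \<phi> by fact
  have "energy s \<le> (LINT x|lebesgue. (exp s - 1) * \<phi> x)"
    unfolding energy_def using int assms(3) by (intro integral_mono integrable_energy exp_chord) auto
  thus ?thesis by simp
qed

text \<open>Functions of zero mass are not a \<open>weight\<close>, but contribute only 0 to the
  supremum.\<close>

lemma xi_cases: assumes "\<phi> \<in> feasible N" obtains "\<And>t. xi \<phi> t = 0" | "weight \<phi>"
  using feasible_weight[OF assms] unfolding xi_def by metis

text \<open>Testing s = 1 in the minimum formula gives a bound independent of \<phi>, without which
  the real supremum would be uninformative.\<close>

lemma bdd_xi: assumes "\<tau> > 0" shows "bdd_above ((\<lambda>\<phi>. xi \<phi> (1 / \<tau>)) ` feasible N)"
proof -
  have "xi \<phi> (1 / \<tau>) \<le> \<tau> + (exp 1 - 1) * max_mass" if phi: "\<phi> \<in> feasible N" for \<phi>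
  proof (rule xi_cases[OF phi])
    assume "\<And>t. xi \<phi> t = 0"
    thus ?thesis using assms vol_pos vol_le_max_mass by simp
  next
    assume w: "weight \<phi>"
    then interpret weight \<phi> .
    have "xi_at \<tau> \<le> \<tau> + energy 1" using xi_at_le[OF assms, of 1] by simp
    also have "energy 1 \<le> (exp 1 - 1) * (LINT x|lebesgue. \<phi> x)" by (rule energy_le[OF phi w]) simp
    also have "\<dots> \<le> (exp 1 - 1) * max_mass" by (intro mult_left_mono integral_le_max_mass phi) simp
    finally show ?thesis by (simp add: xi_at_def)
  qed
  thus ?thesis by (auto simp: bdd_above_def)
qed

lemma xi_le_f_chi: "\<tau> > 0 \<Longrightarrow> \<phi> \<in> feasible N \<Longrightarrow> xi \<phi> (1 / \<tau>) \<le> f_chi N (1 / \<tau>)"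
  unfolding f_chi_def by (rule cSUP_upper[OF _ bdd_xi])

lemma f_chi_least:
  assumes "\<And>\<phi>. \<phi> \<in> feasible N \<Longrightarrow> xi \<phi> t \<le> b" shows "f_chi N t \<le> b"
  unfolding f_chi_def using indicator_feasible by (intro cSUP_least assms) auto

lemma f_omega_le_f_chi: "\<tau> > 0 \<Longrightarrow> ref.xi_at \<tau> \<le> f_chi N (1 / \<tau>)"
  using xi_le_f_chi[OF _ indicator_feasible] by (simp add: ref.xi_at_def)

text \<open>The parameter optimal for the ball is tested in the minimum formula for \<phi>, so
  energies have to be compared at this single s.\<close>

lemma f_chi_eq_f_omega:
  assumes \<tau>: "\<tau> > 0" and energy: "\<And>\<phi>. \<phi> \<in> feasible N \<Longrightarrow> weight \<phi> \<Longrightarrow> weight.energy \<phi> (ref.tilt \<tau>) \<le> vol * (exp (ref.tilt \<tau>) - 1)"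
  shows "f_chi N (1 / \<tau>) = ref.xi_at \<tau>"
proof (rule antisym)
  show "f_chi N (1 / \<tau>) \<le> ref.xi_at \<tau>"
  proof (rule f_chi_least)
    fix \<phi> assume phi: "\<phi> \<in> feasible N"
    show "xi \<phi> (1 / \<tau>) \<le> ref.xi_at \<tau>"
    proof (rule xi_cases[OF phi])
      assume "\<And>t. xi \<phi> t = 0"
      thus ?thesis using ref.xi_at_pos[OF \<tau>] by simp
    next
      assume w: "weight \<phi>"
      then interpret weight \<phi> .
      let ?s = "ref.tilt \<tau>"
      have s: "?s > 0" by (rule ref.tilt_pos[OF \<tau>])
      have "xi_at \<tau> \<le> (\<tau> + energy ?s) / ?s" by (rule xi_at_le[OF \<tau> s])
      also have "\<dots> \<le> (\<tau> + ref.energy ?s) / ?s" using energy[OF phi w] s by (intro divide_right_mono) (auto simp: ref_energy)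
      also have "\<dots> = ref.xi_at \<tau>" by (rule ref.xi_at_eq[OF \<tau>, symmetric])
      finally show ?thesis by (simp add: xi_at_def)
    qed
  qed
qed (rule f_omega_le_f_chi[OF \<tau>])

text \<open>The ratio in the variable \<tau> = 1/t, so that growth in t becomes decrease of
  \<open>F\<close>.\<close>

definition F :: "real \<Rightarrow> real" where "F \<tau> = f_chi N (1 / \<tau>) / ref.xi_at \<tau>"

lemma F_ge_1: "\<tau> > 0 \<Longrightarrow> F \<tau> \<ge> 1"
  using f_omega_le_f_chi[of \<tau>] ref.xi_at_pos[of \<tau>] by (simp add: F_def)

lemma continuous_on_F: "continuous_on {0<..} F"
proof -
  have "continuous_on {0<..} ref.xi_at"
    by (rule continuous_on_of_scaling) (auto intro: ref.xi_at_mono ref.xi_at_scale less_imp_le ref.xi_at_pos)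
  moreover have "continuous_on {0<..} (\<lambda>\<tau>. f_chi N (1 / \<tau>))"
  proof (rule continuous_on_of_scaling)
    show "0 \<le> f_chi N (1 / x)" if "0 < x" for x
      using f_omega_le_f_chi[OF that] ref.xi_at_pos[OF that] by simp
    show "f_chi N (1 / x) \<le> f_chi N (1 / y)" if xy: "0 < x" "x \<le> y" for x y
    proof (rule f_chi_least)
      fix \<phi> assume phi: "\<phi> \<in> feasible N"
      have "xi \<phi> (1 / x) \<le> xi \<phi> (1 / y)"
        by (rule xi_cases[OF phi]) (use weight.xi_at_mono[OF _ xy, of \<phi>] in \<open>auto simp: weight.xi_at_def\<close>)
      also have "\<dots> \<le> f_chi N (1 / y)" using xy by (intro xi_le_f_chi phi) simp
      finally show "xi \<phi> (1 / x) \<le> f_chi N (1 / y)" .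
    qed
    show "c * f_chi N (1 / x) \<le> f_chi N (1 / (c * x))" if x: "0 < x" and c: "0 < c" "c \<le> 1" for x c
    proof -
      have "f_chi N (1 / x) \<le> f_chi N (1 / (c * x)) / c"
      proof (rule f_chi_least)
        fix \<phi> assume phi: "\<phi> \<in> feasible N"
        have "c * xi \<phi> (1 / x) \<le> xi \<phi> (1 / (c * x))"
        proof (rule xi_cases[OF phi])
          assume w: "weight \<phi>"
          show ?thesis using weight.xi_at_scale[OF w x c] by (simp add: weight.xi_at_def[OF w])
        qed simp
        also have "\<dots> \<le> f_chi N (1 / (c * x))" using x c by (intro xi_le_f_chi phi) simp
        finally show "xi \<phi> (1 / x) \<le> f_chi N (1 / (c * x)) / c" using c by (simp add: pos_le_divide_eq mult.commute)
      qed
      thus ?thesis using c by (simp add: pos_le_divide_eq mult.commute)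
    qed
  qed
  ultimately show ?thesis unfolding F_def
    by (intro continuous_on_divide) (auto dest: ref.xi_at_pos)
qed

text \<open>The point is that \<eta> is common to all \<phi>. If the tilt of \<phi> is at least
  \<kappa> times that of the ball, the excess of \<xi> alone makes s \<xi> larger by the factor
  1/\<kappa>. Otherwise \<phi> has a smaller entropy share but must reach the same \<tau>, which
  again forces a larger s \<xi>, uniformly by compactness of the range of tilts.\<close>

lemma log_ratio_growth:
  assumes a: "0 < a" "a < b" and e: "0 < e"
  shows "\<exists>\<eta>>0. \<forall>\<phi> :: real^'n \<Rightarrow> real. weight \<phi> \<longrightarrow> ln (weight.xi_at \<phi> b) - ln (ref.xi_at b) > e \<longrightarrow>
     ln (weight.xi_at \<phi> b) - ln (ref.xi_at b) + \<eta> * (b - a) \<le> ln (weight.xi_at \<phi> a) - ln (ref.xi_at a)"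
proof -
  have b: "b > 0" using a by simp
  \<comment> \<open>Half of the logarithmic excess: \<kappa>^2 e^e = 1, so one factor \<kappa>
    compensates a smaller tilt and the other remains as gain.\<close>
  define \<kappa> where "\<kappa> = exp (- e / 2)"
  have \<kappa>: "0 < \<kappa>" "\<kappa> < 1" using e by (auto simp: \<kappa>_def)
  let ?I = "{ref.tilt a..ref.tilt b}"
  have sga: "ref.tilt a > 0" by (rule ref.tilt_pos[OF a(1)])
  have ne: "?I \<noteq> {}" using ref.tilt_mono[OF a] by simp
  have cont: "continuous_on ?I (\<lambda>s. entropy_share (\<kappa> * s) / entropy_share s)"
  proof (rule continuous_on_divide)
    show "continuous_on ?I (\<lambda>s. entropy_share (\<kappa> * s))"
    proof (rule continuous_on_compose2[OF continuous_on_entropy_share])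
      show "(*) \<kappa> ` ?I \<subseteq> {0<..}"
        using sga \<kappa>(1) by (intro image_subsetI) (metis atLeastAtMost_iff greaterThan_iff less_le_trans mult_pos_pos)
    qed (intro continuous_intros)
    show "continuous_on ?I entropy_share" by (rule continuous_on_subset[OF continuous_on_entropy_share]) (use sga in auto)
    show "\<forall>s\<in>?I. entropy_share s \<noteq> 0"
    proof
      fix s assume "s \<in> ?I"
      hence "entropy_share s > 0" using sga by (intro entropy_share_pos) auto
      thus "entropy_share s \<noteq> 0" by simp
    qed
  qed
  obtain m where m: "m \<in> ?I" "\<And>s. s \<in> ?I \<Longrightarrow> entropy_share (\<kappa> * s) / entropy_share s \<le> entropy_share (\<kappa> * m) / entropy_share m"
    using continuous_attains_sup[OF compact_Icc ne cont] by blast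
  \<comment> \<open>The worse of the gains in the two cases; s \<xi> of the ball is at most q times
    that of \<phi>.\<close>
  define q where "q = max \<kappa> (entropy_share (\<kappa> * m) / entropy_share m)"
  have q: "0 < q" "q < 1"
  proof -
    have m0: "m > 0" using m sga by auto
    have "entropy_share (\<kappa> * m) < entropy_share m" using m0 \<kappa> by (intro entropy_share_strict_mono) auto
    thus "q < 1" "0 < q" using \<kappa> entropy_share_pos[OF m0] by (auto simp: q_def)
  qed
  define \<eta> where "\<eta> = (1 - q) / (ref.tilt b * ref.xi_at b)"
  have \<eta>: "\<eta> > 0" using q ref.tilt_pos[OF b] ref.xi_at_pos[OF b] by (simp add: \<eta>_def)
  have "ln (weight.xi_at \<phi> b) - ln (ref.xi_at b) + \<eta> * (b - a) \<le> ln (weight.xi_at \<phi> a) - ln (ref.xi_at a)"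
    if w: "weight \<phi>" and gt: "ln (weight.xi_at \<phi> b) - ln (ref.xi_at b) > e" for \<phi> :: "real^'n \<Rightarrow> real"
  proof -
    interpret weight \<phi> by (rule w)
    show ?thesis
    proof (rule decreasing_above_threshold[where L = "\<lambda>\<tau>. ln (xi_at \<tau>) - ln (ref.xi_at \<tau>)" and e = e
          and L' = "\<lambda>\<tau>. 1 / (tilt \<tau> * xi_at \<tau>) - 1 / (ref.tilt \<tau> * ref.xi_at \<tau>)"])
      show "a < b" "0 < \<eta>" "e < ln (xi_at b) - ln (ref.xi_at b)" by (fact a(2) \<eta> gt)+
      fix \<tau> assume \<tau>: "a \<le> \<tau>" "\<tau> \<le> b"
      hence \<tau>0: "\<tau> > 0" using a by simp
      have p: "xi_at \<tau> > 0" "ref.xi_at \<tau> > 0" "tilt \<tau> > 0" "ref.tilt \<tau> > 0"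
        by (intro xi_at_pos ref.xi_at_pos tilt_pos ref.tilt_pos \<tau>0)+
      show "((\<lambda>\<tau>. ln (xi_at \<tau>) - ln (ref.xi_at \<tau>)) has_real_derivative 1 / (tilt \<tau> * xi_at \<tau>) - 1 / (ref.tilt \<tau> * ref.xi_at \<tau>)) (at \<tau>)"
        using p by (auto intro!: derivative_eq_intros DERIV_xi_at ref.DERIV_xi_at \<tau>0 simp: field_simps)
      assume ge: "e \<le> ln (xi_at \<tau>) - ln (ref.xi_at \<tau>)"
      have Xge: "exp e * ref.xi_at \<tau> \<le> xi_at \<tau>"
      proof -
        have "exp (e + ln (ref.xi_at \<tau>)) \<le> exp (ln (xi_at \<tau>))" using ge by simp
        thus ?thesis using p by (simp add: exp_add)
      qed
      have key: "ref.tilt \<tau> * ref.xi_at \<tau> \<le> q * (tilt \<tau> * xi_at \<tau>)"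
      proof (cases "\<kappa> * ref.tilt \<tau> \<le> tilt \<tau>")
        case True
        have "\<kappa> * \<kappa> * exp e = 1" by (simp add: \<kappa>_def exp_add[symmetric])
        hence "ref.tilt \<tau> * ref.xi_at \<tau> = \<kappa> * ((\<kappa> * ref.tilt \<tau>) * (exp e * ref.xi_at \<tau>))" by algebra
        also have "\<dots> \<le> \<kappa> * (tilt \<tau> * xi_at \<tau>)"
          using True Xge p \<kappa> by (intro mult_left_mono mult_mono) auto
        also have "\<dots> \<le> q * (tilt \<tau> * xi_at \<tau>)" using p by (intro mult_right_mono) (auto simp: q_def)
        finally show ?thesis .
      next
        case False
        have "entropy_share (ref.tilt \<tau>) * (ref.tilt \<tau> * ref.xi_at \<tau>) = \<tau>" by (rule ref_tau[OF \<tau>0, symmetric])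
        also have "\<dots> \<le> entropy_share (tilt \<tau>) * (tilt \<tau> * xi_at \<tau>)" by (rule tau_le_entropy_share[OF \<tau>0])
        also have "\<dots> \<le> entropy_share (\<kappa> * ref.tilt \<tau>) * (tilt \<tau> * xi_at \<tau>)"
          using False p by (intro mult_right_mono less_imp_le[OF entropy_share_strict_mono]) auto
        finally have "ref.tilt \<tau> * ref.xi_at \<tau> \<le> entropy_share (\<kappa> * ref.tilt \<tau>) / entropy_share (ref.tilt \<tau>) * (tilt \<tau> * xi_at \<tau>)"
          using entropy_share_pos[OF p(4)] by (simp add: pos_le_divide_eq mult.commute)
        also have "\<dots> \<le> q * (tilt \<tau> * xi_at \<tau>)"
        proof (intro mult_right_mono)
          have "ref.tilt a \<le> ref.tilt \<tau>" "ref.tilt \<tau> \<le> ref.tilt b"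
            using ref.tilt_mono[OF a(1), of \<tau>] ref.tilt_mono[OF \<tau>0, of b] \<tau> by (auto simp: le_less)
          thus "entropy_share (\<kappa> * ref.tilt \<tau>) / entropy_share (ref.tilt \<tau>) \<le> q" using m(2)[of "ref.tilt \<tau>"] by (auto simp: q_def)
        qed (use p in auto)
        finally show ?thesis .
      qed
      have "1 / (tilt \<tau> * xi_at \<tau>) \<le> q / (ref.tilt \<tau> * ref.xi_at \<tau>)"
        using key p by (simp add: frac_le_eq divide_le_eq pos_le_divide_eq)
      moreover have "\<eta> \<le> (1 - q) / (ref.tilt \<tau> * ref.xi_at \<tau>)"
      proof -
        have "ref.tilt \<tau> \<le> ref.tilt b" using ref.tilt_mono[OF \<tau>0, of b] \<tau> by (auto simp: le_less)
        hence "ref.tilt \<tau> * ref.xi_at \<tau> \<le> ref.tilt b * ref.xi_at b"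
          using p ref.xi_at_mono[OF \<tau>0 \<tau>(2)] by (intro mult_mono) auto
        thus ?thesis unfolding \<eta>_def using p q by (intro divide_left_mono) (auto intro: mult_pos_pos ref.tilt_pos ref.xi_at_pos b)
      qed
      ultimately show "1 / (tilt \<tau> * xi_at \<tau>) - 1 / (ref.tilt \<tau> * ref.xi_at \<tau>) \<le> - \<eta>" by (simp add: diff_divide_distrib)
    qed
  qed
  thus ?thesis using \<eta> by blast
qed

text \<open>A nearly optimal \<phi> at b gains a fixed \<delta> in the logarithm on the way to a,
  more than it lacked at b.\<close>

lemma F_strict_decreasing:
  assumes a: "0 < a" "a < b" and Fb: "F b > 1" shows "F b < F a"
proof -
  have b: "b > 0" using a by simp
  define e where "e = ln (F b) / 2"
  have e: "e > 0" "ln (F b) = 2 * e" using Fb by (auto simp: e_def)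
  obtain \<eta> where \<eta>: "\<eta> > 0" and grow: "\<And>\<phi> :: real^'n \<Rightarrow> real. weight \<phi> \<Longrightarrow> ln (weight.xi_at \<phi> b) - ln (ref.xi_at b) > e \<Longrightarrow>
     ln (weight.xi_at \<phi> b) - ln (ref.xi_at b) + \<eta> * (b - a) \<le> ln (weight.xi_at \<phi> a) - ln (ref.xi_at a)"
    using log_ratio_growth[OF a e(1)] by blast
  define \<delta> where "\<delta> = \<eta> * (b - a)"
  have \<delta>: "\<delta> > 0" using \<eta> a by (simp add: \<delta>_def)
  \<comment> \<open>Below ln (F b), so a feasible \<phi> exceeds it at b; at least e, so the growth
    lemma applies; and within \<delta>/2 of ln (F b), so the gain overshoots.\<close>
  define \<theta> where "\<theta> = max e (2 * e - \<delta> / 2)"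
  have \<theta>: "\<theta> < 2 * e" "e \<le> \<theta>" "2 * e - \<delta> / 2 \<le> \<theta>" using e \<delta> by (auto simp: \<theta>_def)
  have "exp \<theta> < exp (ln (F b))" using \<theta> e by simp
  hence "exp \<theta> < F b" using Fb by simp
  hence "exp \<theta> * ref.xi_at b < f_chi N (1 / b)"
    using ref.xi_at_pos[OF b] by (simp add: F_def pos_less_divide_eq)
  then obtain \<phi> where phi: "\<phi> \<in> feasible N" "exp \<theta> * ref.xi_at b < xi \<phi> (1 / b)"
    unfolding f_chi_def using less_cSUP_iff[OF _ bdd_xi[OF b]] indicator_feasible by blast
  have w: "weight \<phi>"
  proof (rule xi_cases[OF phi(1)])
    assume "\<And>t. xi \<phi> t = 0"
    thus ?thesis using phi(2) ref.xi_at_pos[OF b] by (simp add: mult_less_0_iff)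
  qed
  then interpret weight \<phi> .
  have pb: "xi_at b > 0" "ref.xi_at b > 0" "xi_at a > 0" "ref.xi_at a > 0" by (intro xi_at_pos ref.xi_at_pos a b)+
  have "ln (exp \<theta> * ref.xi_at b) < ln (xi_at b)" using phi(2) pb by (subst ln_less_cancel_iff) (auto simp: xi_at_def)
  hence L: "\<theta> < ln (xi_at b) - ln (ref.xi_at b)" using pb by (simp add: ln_mult)
  have "ln (xi_at b) - ln (ref.xi_at b) + \<delta> \<le> ln (xi_at a) - ln (ref.xi_at a)"
    unfolding \<delta>_def using L \<theta> by (intro grow[OF w]) linarith
  hence "ln (F b) < ln (xi_at a) - ln (ref.xi_at a)" using L \<theta> \<delta> e by linarith
  also have "\<dots> = ln (xi_at a / ref.xi_at a)" using pb by (simp add: ln_div)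
  finally have "F b < xi_at a / ref.xi_at a" using pb Fb by (subst (asm) ln_less_cancel_iff) auto
  also have "\<dots> \<le> F a" unfolding F_def using xi_le_f_chi[OF a(1) phi(1)] pb
    by (intro divide_right_mono) (auto simp: xi_at_def)
  finally show ?thesis .
qed

text \<open>As \<tau> tends to 0, the weighted integral of the ball tends to its mass, while that of
  \<phi> is never below its own mass. Taking \<tau> = s^2 makes the term \<tau>/s in the minimum
  formula equal to s.\<close>

lemma F_gt_1_exists: assumes "vol < max_mass" shows "\<exists>\<tau>>0. F \<tau> > 1"
proof -
  obtain \<phi> where phi: "\<phi> \<in> feasible N" "vol < (LINT x|lebesgue. \<phi> x)"
    using assms less_cSUP_iff[OF _ bdd_above_feasible] indicator_feasible unfolding max_mass_def by blast
  interpret weight \<phi> by (rule feasible_weight[OF phi(1)]) (use phi vol_pos in simp)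
  let ?m = "LINT x|lebesgue. \<phi> x"
  \<comment> \<open>Makes s (1 + vol) smaller than the surplus of mass; e^s - 1 is at most s + s^2
    because s is at most 1.\<close>
  define s where "s = min 1 ((?m - vol) / (2 * (1 + vol)))"
  have s: "0 < s" "s \<le> 1" using phi vol_pos by (auto simp: s_def)
  have "s \<le> (?m - vol) / (2 * (1 + vol))" by (simp add: s_def)
  hence "s * (2 * (1 + vol)) \<le> ?m - vol" using vol_pos by (simp add: pos_le_divide_eq)
  moreover have "s * (1 + vol) < s * (2 * (1 + vol))" using s vol_pos by simp
  ultimately have sm: "vol + s * (1 + vol) < ?m" by linarith
  have "ref.xi_at (s\<^sup>2) \<le> (s\<^sup>2 + ref.energy s) / s" using s by (intro ref.xi_at_le) auto
  also have "\<dots> \<le> (s\<^sup>2 + vol * (s + s\<^sup>2)) / s"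
    using exp_bound[of s] s vol_pos unfolding ref_energy by (intro divide_right_mono add_left_mono mult_left_mono) auto
  also have "\<dots> = vol + s * (1 + vol)" using s by (simp add: field_simps power2_eq_square)
  also have "\<dots> < ?m" by (rule sm)
  also have "\<dots> \<le> xi_at (s\<^sup>2)" using s by (intro xi_at_ge_integral) simp
  also have "\<dots> \<le> f_chi N (1 / s\<^sup>2)" unfolding xi_at_def using s phi by (intro xi_le_f_chi) auto
  finally have "F (s\<^sup>2) > 1" unfolding F_def using ref.xi_at_pos[of "s\<^sup>2"] s by simp
  thus ?thesis using s by (intro exI[of _ "s\<^sup>2"]) auto
qed

lemma F_eq_1_eventually: "\<exists>\<tau>0>0. \<forall>\<tau>\<ge>\<tau>0. F \<tau> = 1"
proof -
  obtain s0 where s0: "s0 > 0" "\<And>\<phi> s. \<phi> \<in> feasible N \<Longrightarrow> s \<ge> s0 \<Longrightarrow> (LINT x|lebesgue. exp (s * \<phi> x) - 1) \<le> vol * (exp s - 1)"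
    using feasible_energy_le by blast
  have T0: "ref.entropy_at s0 > 0" using ref.entropy_at_strict_mono[of 0 s0] s0 by simp
  have "F \<tau> = 1" if \<tau>: "\<tau> \<ge> ref.entropy_at s0" for \<tau>
  proof -
    have \<tau>0: "\<tau> > 0" using \<tau> T0 by simp
    have "s0 \<le> ref.tilt \<tau>"
      using ref.tilt_mono[OF T0, of \<tau>] ref.tilt_entropy_at[OF s0(1)] \<tau> by (cases "\<tau> = ref.entropy_at s0") auto
    hence "f_chi N (1 / \<tau>) = ref.xi_at \<tau>"
      by (intro f_chi_eq_f_omega \<tau>0) (simp add: weight.energy_def s0(2))
    thus ?thesis using ref.xi_at_pos[OF \<tau>0] by (simp add: F_def)
  qed
  thus ?thesis using T0 by blast
qed

text \<open>By strict decrease, \<open>F\<close> cannot exceed 1 to the right of a point where it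
  equals 1. Hence the set where it equals 1 is a ray, and its infimum is positive because
  \<open>F\<close> exceeds 1 at some positive point.\<close>

lemma threshold_exists:
  assumes "vol < max_mass"
  shows "\<exists>\<tau>0>0. (\<forall>\<tau>\<ge>\<tau>0. F \<tau> = 1) \<and> (\<forall>a b. 0 < a \<longrightarrow> a < b \<longrightarrow> b \<le> \<tau>0 \<longrightarrow> F b < F a)"
proof -
  let ?Z = "{\<tau>. 0 < \<tau> \<and> F \<tau> = 1}"
  obtain \<tau>a where \<tau>a: "\<tau>a > 0" "F \<tau>a = 1" using F_eq_1_eventually by blast
  obtain \<tau>b where \<tau>b: "\<tau>b > 0" "F \<tau>b > 1" using F_gt_1_exists[OF assms] by blast
  have lb: "\<tau>b \<le> \<tau>" if "\<tau> \<in> ?Z" for \<tau>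
    using that \<tau>b F_strict_decreasing[of \<tau> \<tau>b] by force
  have ne: "?Z \<noteq> {}" using \<tau>a by blast
  have bdd: "bdd_below ?Z" using lb by (auto simp: bdd_below_def)
  define \<tau>0 where "\<tau>0 = Inf ?Z"
  have \<tau>0: "\<tau>b \<le> \<tau>0" unfolding \<tau>0_def using ne lb by (intro cInf_greatest)
  have below: "F \<tau> > 1" if "0 < \<tau>" "\<tau> < \<tau>0" for \<tau>
  proof -
    have "\<tau> \<notin> ?Z" using that cInf_lower[OF _ bdd, of \<tau>] unfolding \<tau>0_def by auto
    thus ?thesis using that F_ge_1[of \<tau>] by auto
  qed
  have above: "F \<tau> = 1" if gt: "\<tau> > \<tau>0" for \<tau>
  proof -
    obtain z where z: "z \<in> ?Z" "z < \<tau>" using gt cInf_less_iff[OF ne bdd, of \<tau>] unfolding \<tau>0_def by blast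
    show ?thesis
    proof (rule ccontr)
      assume "F \<tau> \<noteq> 1"
      hence "F \<tau> > 1" using F_ge_1[of \<tau>] z by force
      thus False using F_strict_decreasing[of z \<tau>] z by force
    qed
  qed
  \<comment> \<open>\<open>F\<close> is constantly 1 to the right of the infimum, so continuity
    gives the value there.\<close>
  have at: "F \<tau>0 = 1"
  proof -
    have "isCont F \<tau>0" using continuous_on_F \<tau>0 \<tau>b by (simp add: continuous_on_eq_continuous_at)
    hence "(F \<longlongrightarrow> F \<tau>0) (at_right \<tau>0)" by (simp add: isCont_def filterlim_at_split)
    moreover have "((\<lambda>_. 1) \<longlongrightarrow> F \<tau>0) (at_right \<tau>0) = (F \<longlongrightarrow> F \<tau>0) (at_right \<tau>0)"
      by (intro filterlim_cong refl) (auto simp: eventually_at_filter above)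
    ultimately show ?thesis by (simp add: tendsto_const_iff)
  qed
  have "F b < F a" if "0 < a" "a < b" "b \<le> \<tau>0" for a b
    using that below[of a] below[of b] at F_strict_decreasing[of a b] by (cases "b = \<tau>0") auto
  moreover have "F \<tau> = 1" if "\<tau> \<ge> \<tau>0" for \<tau> using that at above by (cases "\<tau> = \<tau>0") auto
  ultimately show ?thesis using \<tau>0 \<tau>b by (intro exI[of _ \<tau>0]) auto
qed

lemma ratio_eq_F: "f_chi N t / f_omega N t = F (1 / t)"
  using f_omega_eq[of "1 / t"] by (simp add: F_def)

end

theorem theorem1p3:
  fixes N :: "real^'n \<Rightarrow> real"
  assumes "is_norm N"
  shows "(packing_density N = 1 \<longrightarrow> (\<forall>t>0. f_chi N t = f_omega N t)) \<and>
         (packing_density N < 1 \<longrightarrow>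
            (\<exists>t0. 0 < t0 \<and> (\<forall>t. 0 < t \<and> t \<le> t0 \<longrightarrow> f_chi N t = f_omega N t) \<and>
                  continuous_on {t0..} (\<lambda>t. f_chi N t / f_omega N t) \<and>
                  strict_mono_on {t0..} (\<lambda>t. f_chi N t / f_omega N t)))"
proof -
  interpret finite_dim_norm N by unfold_locales (rule assms)
  have M: "max_mass > 0" using vol_pos vol_le_max_mass by linarith
  have omega: "f_omega N t > 0" if "t > 0" for t
    using f_omega_eq[of "1 / t"] ref.xi_at_pos[of "1 / t"] that by simp
  show ?thesis
  proof (intro conjI impI)
    assume "packing_density N = 1"
    hence Mv: "max_mass = vol" using M by (simp add: packing_density_eq)
    show "\<forall>t>0. f_chi N t = f_omega N t"
    proof (intro allI impI)
      fix t :: real assume t: "t > 0"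
      have "f_chi N (1 / (1 / t)) = ref.xi_at (1 / t)"
      proof (rule f_chi_eq_f_omega)
        fix \<phi> assume phi: "\<phi> \<in> feasible N" "weight \<phi>"
        let ?s = "ref.tilt (1 / t)"
        have s: "?s > 0" using t by (intro ref.tilt_pos) simp
        have "weight.energy \<phi> ?s \<le> (exp ?s - 1) * (LINT x|lebesgue. \<phi> x)" by (rule energy_le[OF phi]) (use s in simp)
        also have "\<dots> \<le> (exp ?s - 1) * max_mass" using s by (intro mult_left_mono integral_le_max_mass phi) simp
        finally show "weight.energy \<phi> ?s \<le> vol * (exp ?s - 1)" by (simp add: Mv mult.commute)
      qed (use t in simp)
      thus "f_chi N t = f_omega N t" using f_omega_eq[of "1 / t"] by simp
    qed
  next
    assume "packing_density N < 1"
    hence "vol < max_mass" using M by (simp add: packing_density_eq)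
    then obtain \<tau>0 where \<tau>0: "\<tau>0 > 0" "\<And>\<tau>. \<tau> \<ge> \<tau>0 \<Longrightarrow> F \<tau> = 1"
      "\<And>a b. 0 < a \<Longrightarrow> a < b \<Longrightarrow> b \<le> \<tau>0 \<Longrightarrow> F b < F a"
      using threshold_exists by blast
    show "\<exists>t0. 0 < t0 \<and> (\<forall>t. 0 < t \<and> t \<le> t0 \<longrightarrow> f_chi N t = f_omega N t) \<and>
                  continuous_on {t0..} (\<lambda>t. f_chi N t / f_omega N t) \<and>
                  strict_mono_on {t0..} (\<lambda>t. f_chi N t / f_omega N t)"
    proof (intro exI[of _ "1 / \<tau>0"] conjI allI impI)
      show "0 < 1 / \<tau>0" using \<tau>0 by simp
      fix t assume t: "0 < t \<and> t \<le> 1 / \<tau>0"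
      hence "\<tau>0 \<le> 1 / t" using \<tau>0(1) by (simp add: field_simps)
      hence "f_chi N t / f_omega N t = 1" unfolding ratio_eq_F by (rule \<tau>0(2))
      thus "f_chi N t = f_omega N t" using omega[of t] t by simp
    next
      show "continuous_on {1 / \<tau>0..} (\<lambda>t. f_chi N t / f_omega N t)"
        unfolding ratio_eq_F
      proof (rule continuous_on_compose2[OF continuous_on_F])
        have pos: "t > 0" if "t \<in> {1 / \<tau>0..}" for t using that \<tau>0(1) by (auto intro: less_le_trans[of _ "1 / \<tau>0"])
        show "continuous_on {1 / \<tau>0..} (\<lambda>t. 1 / t)" using pos by (intro continuous_intros) force
        show "(\<lambda>t. 1 / t) ` {1 / \<tau>0..} \<subseteq> {0<..}" using pos by auto
      qed
      show "strict_mono_on {1 / \<tau>0..} (\<lambda>t. f_chi N t / f_omega N t)"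
        unfolding ratio_eq_F
      proof (rule strict_mono_onI)
        fix r t assume rt: "r \<in> {1 / \<tau>0..}" "t \<in> {1 / \<tau>0..}" "r < t"
        have r: "r > 0" using rt(1) \<tau>0(1) by (auto intro: less_le_trans[of _ "1 / \<tau>0"])
        show "F (1 / r) < F (1 / t)"
        proof (rule \<tau>0(3))
          show "0 < 1 / t" "1 / t < 1 / r" using r rt by (auto simp: frac_less2)
          show "1 / r \<le> \<tau>0" using r rt(1) \<tau>0(1) by (auto simp: field_simps)
        qed
      qed
    qed
  qed
qed

end
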